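(* Let $(Q,N)$ be a (possibly dependent) pair of non-negative, non-degenerate random variables with $N$ integer-valued, and assume $\bar n:=\mathbb{E}N<1$ and $\bar q:=\mathbb{E}Q<\infty$. Consider the fixed-point equation $$R\ \stackrel{\mathcal D}{=}\ Q+\sum_{m=1}^{N}R_m,$$ where $R_1,R_2,\dots$ are i.i.d. copies of $R$, independent of $(Q,N)$. (i) There is exactly one distribution of a non-negative random variable $R$ with finite mean solving this equation, and for it $\bar r:=\mathbb{E}R=\bar q/(1-\bar n)$. (ii) Suppose in addition that condition (C) holds: there exists $\epsilon>0$ such that for every $c\in(\bar r-\epsilon,\bar r+\epsilon)$, $c>0$, the distribution of $Q+cN$ is intermediate regularly varying. Then $$\mathbb{P}(R>x)\sim\frac{1}{1-\bar n}\,\mathbb{P}(Q+\bar r N>x)\qquad (x\to\infty).$$ (iii) Condition (C) holds in each of the following cases: (a) $(Q,N)$ is two-dimensionally regularly varying, i.e. there is a tail $\bar F(x)=L(x)x^{-\alpha}$ ($\alpha>0$, $L$ slowly varying) with $\mathbb{P}(Q+N>x)\sim b\bar F(x)$ for some $b>0$, and the conditional law of $(Q,N)/(Q+N)$ given $Q+N>x$ converges weakly as $x\to\infty$ to a probability measure on $\{(\theta_0,\theta_1)\in[0,\infty)^2:\theta_0+\theta_1=1\}$; (b) $Q$ has an intermediate regularly varying distribution and $\mathbb{P}(N>x)=o(\mathbb{P}(Q>x))$; (c) $N$ has an intermediate regularly varying distribution and $\mathbb{P}(Q>x)=o(\mathbb{P}(N>x))$.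
   Context: A distribution $F$ on $\mathbb{R}$ with tail $\bar F=1-F$ is intermediate regularly varying (IRV) if $\lim_{\alpha\uparrow1}\limsup_{x\to\infty}\bar F(\alpha x)/\bar F(x)=1$. $f(x)\sim g(x)$ means $f(x)/g(x)\to1$. *)

theory Defs
  imports "HOL-Probability.Probability" "HOL-Library.Landau_Symbols"
begin

text \<open>Tail of a distribution on the reals.\<close>
definition tail :: "real measure \<Rightarrow> real \<Rightarrow> real" where
  "tail F x = measure F {x<..}"

text \<open>Intermediate regular variation:
  lim_{alpha -> 1-} limsup_{x -> oo} tail(alpha x)/tail(x) = 1.\<close>
definition IRV :: "real measure \<Rightarrow> bool" where
  "IRV F \<longleftrightarrow>
     ((\<lambda>a. Limsup at_top (\<lambda>x. ereal (tail F (a * x) / tail F x))) \<longlongrightarrow> ereal 1) (at_left 1)"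

text \<open>n-fold convolution power of a distribution on the reals (mu^{*0} = point mass at 0).\<close>
primrec convpow :: "real measure \<Rightarrow> nat \<Rightarrow> real measure" where
  "convpow \<mu> 0 = return borel 0"
| "convpow \<mu> (Suc n) = convolution \<mu> (convpow \<mu> n)"

text \<open>The map sending the law of R to the law of Q + sum_{m=1}^N R_m,
  where (Q,N) has joint law P and R_1, R_2, ... are iid with law mu, independent of (Q,N).\<close>
definition fixmap :: "(real \<times> nat) measure \<Rightarrow> real measure \<Rightarrow> real measure" where
  "fixmap P \<mu> = P \<bind> (\<lambda>\<omega>. distr (convpow \<mu> (snd \<omega>)) borel (\<lambda>x. fst \<omega> + x))"

text \<open>Distribution of a non-negative random variable R with finite mean solving the equation.\<close>
definition fp_solution :: "(real \<times> nat) measure \<Rightarrow> real measure \<Rightarrow> bool" where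
  "fp_solution P \<mu> \<longleftrightarrow> prob_space \<mu> \<and> sets \<mu> = sets borel \<and> (AE x in \<mu>. 0 \<le> x)
     \<and> integrable \<mu> (\<lambda>x. x) \<and> fixmap P \<mu> = \<mu>"

definition nondegenerate :: "'a measure \<Rightarrow> ('a \<Rightarrow> real) \<Rightarrow> bool" where
  "nondegenerate M f \<longleftrightarrow> \<not> (\<exists>c. AE \<omega> in M. f \<omega> = c)"

text \<open>Condition (C).\<close>
definition condC :: "(real \<times> nat) measure \<Rightarrow> real \<Rightarrow> bool" where
  "condC P r \<longleftrightarrow> (\<exists>\<epsilon>>0. \<forall>c. r - \<epsilon> < c \<and> c < r + \<epsilon> \<and> 0 < c \<longrightarrow>
       IRV (distr P borel (\<lambda>\<omega>. fst \<omega> + c * real (snd \<omega>))))"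

definition slowly_varying :: "(real \<Rightarrow> real) \<Rightarrow> bool" where
  "slowly_varying L \<longleftrightarrow> L \<in> borel_measurable borel \<and> (\<forall>\<^sub>F x in at_top. 0 < L x) \<and>
     (\<forall>t>0. ((\<lambda>x. L (t * x) / L x) \<longlongrightarrow> 1) at_top)"

definition angle :: "real \<times> nat \<Rightarrow> real \<times> real" where
  "angle \<omega> = (fst \<omega> / (fst \<omega> + real (snd \<omega>)), real (snd \<omega>) / (fst \<omega> + real (snd \<omega>)))"

text \<open>Conditional law of (Q,N)/(Q+N) given Q+N > x.\<close>
definition cond_angle_law :: "(real \<times> nat) measure \<Rightarrow> real \<Rightarrow> (real \<times> real) measure" where
  "cond_angle_law P x =
     distr (uniform_measure P {\<omega>\<in>space P. fst \<omega> + real (snd \<omega>) > x}) borel angle"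

definition simplex1 :: "(real \<times> real) set" where
  "simplex1 = {\<theta>. 0 \<le> fst \<theta> \<and> 0 \<le> snd \<theta> \<and> fst \<theta> + snd \<theta> = 1}"

text \<open>Weak convergence as x \<rightarrow> \<infinity> of a family of laws on R^2.\<close>
definition weak_conv_at_top :: "(real \<Rightarrow> (real \<times> real) measure) \<Rightarrow> (real \<times> real) measure \<Rightarrow> bool" where
  "weak_conv_at_top M \<nu> \<longleftrightarrow> (\<forall>f :: real \<times> real \<Rightarrow> real. continuous_on UNIV f \<and> bounded (range f) \<longrightarrow>
      ((\<lambda>x. \<integral>\<theta>. f \<theta> \<partial>M x) \<longlongrightarrow> (\<integral>\<theta>. f \<theta> \<partial>\<nu>)) at_top)"

text \<open>Two-dimensional regular variation of (Q,N).\<close>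
definition two_dim_RV :: "(real \<times> nat) measure \<Rightarrow> bool" where
  "two_dim_RV P \<longleftrightarrow> (\<exists>(\<alpha>::real) (L::real \<Rightarrow> real) (b::real) (G::real measure) (\<nu>::(real \<times> real) measure).
      0 < \<alpha> \<and> slowly_varying L \<and> 0 < b \<and>
      prob_space G \<and> sets G = sets borel \<and> (\<forall>\<^sub>F x in at_top. tail G x = L x * x powr (-\<alpha>)) \<and>
      (\<lambda>x. measure P {\<omega>\<in>space P. fst \<omega> + real (snd \<omega>) > x}) \<sim>[at_top] (\<lambda>x. b * tail G x) \<and>
      prob_space \<nu> \<and> sets \<nu> = sets (borel :: (real \<times> real) measure) \<and> measure \<nu> simplex1 = 1 \<and>
      weak_conv_at_top (cond_angle_law P) \<nu>)"

end

theory Submission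
  imports Defs
begin

text \<open>
  The characteristic function \<open>\<phi>\<close> of a solution satisfies \<open>\<phi> = E (e\<^bsup>i t Q\<^esup> \<phi>\<^sup>N)\<close>. As
  \<open>\<bar>z\<^sup>n - w\<^sup>n\<bar> \<le> n \<bar>z - w\<bar>\<close> on the unit disc, the right-hand side contracts with factor \<open>E N < 1\<close>; this gives
  uniqueness, and existence because the iterates started at \<open>0\<close> have bounded means and hence are tight.

  For the tails, let \<open>T\<close> and \<open>W\<close> be the tails of \<open>R\<close> and \<open>Q + r N\<close>. The sum \<open>Q + R\<^sub>1 + \<dots> + R\<^sub>N\<close> exceeds \<open>x\<close> either
  because \<open>Q + r N\<close> does, or because one of boundedly many summands does, up to negligible events. So
  \<open>T(x) \<approx> W(x) + E N T(x)\<close>, which is the claim. The error bound needs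
  \<open>P (R\<^sub>1 + \<dots> + R\<^sub>n - n c > y) \<le> C n K W(y)\<close> for \<open>c > r\<close>, uniformly in \<open>n\<close>, knowing \<open>T \<le> K W\<close> only below \<open>x\<close>. Under
  dominated variation of \<open>W\<close> this follows by halving \<open>y\<close>: without a jump above \<open>y/4\<close>, the walk must first pass \<open>y/4\<close>,
  which is unlikely uniformly in \<open>n\<close>, and then gain another \<open>y/2\<close>. Hence the bound \<open>T \<le> K W\<close> propagates to all scales.
\<close>

section \<open>Laws on the half-line and their convolution powers\<close>

text \<open>The obstacle is a circle: bounding \<open>T\<close> at \<open>x\<close> needs tail
  bounds for sums of \<open>N\<close> copies of \<open>R\<close>, and these need bounds on
  \<open>T\<close>. Two things break it. The upper estimate at \<open>x\<close> uses
  \<open>T\<close> only up to \<open>(1 - \<eta>) * x\<close>, and a tentative constant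
  \<open>K\<close> in T <= K W enters its error term linearly, with an arbitrarily small factor.
  This dictates the order of quantifiers: thresholds are chosen before \<open>K\<close>, and the
  least admissible \<open>K\<close> before the small factor. Since only the first moment of
  \<open>N\<close> is available, bounds for large \<open>N\<close> may grow at most linearly in n.
  Maxima of the walk, rather than its endpoint, allow a restart at the first passage, with an
  estimate of the remaining gain that is uniform in n. The lower bound is not circular: the summands
  are non-negative, so their Laplace transform already gives exponential control, and
  \<open>T\<close> occurs on both sides at the same point.\<close>

lemma borel_measurable_antimono:
  fixes f :: "real \<Rightarrow> real"
  assumes "antimono f"
  shows "f \<in> borel_measurable borel"
proof -
  have "mono (\<lambda>z. - f z)" using assms by (auto simp: mono_def antimono_def)
  from borel_measurable_mono[OF this] have "(\<lambda>z. - (- f z)) \<in> borel_measurable borel" by measurable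
  then show ?thesis by simp
qed

lemma filterlim_mult_pos_at_top:
  fixes k :: real
  assumes "0 < k"
  shows "filterlim (\<lambda>x. k * x) at_top at_top"
  using assms by (intro filterlim_tendsto_pos_mult_at_top[OF tendsto_const] filterlim_ident) auto

lemma (in real_distribution) tail_tendsto_0: "(tail M \<longlongrightarrow> 0) at_top"
proof -
  have "tail M = (\<lambda>z. 1 - cdf M z)"
  proof
    fix z :: real
    have "UNIV - {..z} = {z<..}" by auto
    then show "tail M z = 1 - cdf M z"
      using prob_compl[of "{..z}"] by (simp add: tail_def cdf_def)
  qed
  moreover have "((\<lambda>z. 1 - cdf M z) \<longlongrightarrow> 1 - 1) at_top"
    by (intro tendsto_intros cdf_lim_at_top_prob)
  ultimately show ?thesis by simp
qed

locale nonneg_law = real_distribution M for M :: "real measure" +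
  assumes nonneg: "AE x in M. 0 \<le> x"
    and integrable_id: "integrable M (\<lambda>x. x)"
begin

lemma prob_space_convpow: "prob_space (convpow M n)"
  and sets_convpow: "sets (convpow M n) = sets borel"
  and space_convpow: "space (convpow M n) = UNIV"
proof -
  have "prob_space (convpow M n) \<and> sets (convpow M n) = sets borel"
  proof (induction n)
    case 0
    show ?case by (simp add: prob_space_return)
  next
    case (Suc n)
    interpret C: prob_space "convpow M n" using Suc by simp
    interpret pair_prob_space M "convpow M n" ..
    have [measurable_cong]: "sets (convpow M n) = sets borel" using Suc by simp
    have "prob_space (M \<star> convpow M n)"
      unfolding convolution_def by (rule prob_space_distr) measurable
    then show ?case by simp
  qed
  then show "prob_space (convpow M n)" "sets (convpow M n) = sets borel" by auto
  from sets_eq_imp_space_eq[OF this(2)] show "space (convpow M n) = UNIV" by simp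
qed

lemma real_distribution_convpow: "real_distribution (convpow M n)"
  using prob_space_convpow sets_convpow space_convpow
  by (simp add: real_distribution_def real_distribution_axioms_def)

lemma nn_integral_convpow_Suc:
  assumes [measurable]: "f \<in> borel_measurable borel"
  shows "(\<integral>\<^sup>+z. f z \<partial>convpow M (Suc n)) = (\<integral>\<^sup>+x. \<integral>\<^sup>+y. f (x + y) \<partial>convpow M n \<partial>M)"
  using prob_space_convpow[of n] sets_convpow[of n]
  by (simp add: nn_integral_convolution prob_space_def finite_measure_axioms)

lemma AE_convpow_nonneg: "AE x in convpow M n. 0 \<le> x"
proof (induction n)
  case 0
  show ?case unfolding convpow.simps by (subst AE_return) auto
next
  case (Suc n)
  interpret C: real_distribution "convpow M n" by (rule real_distribution_convpow)
  have "(\<integral>\<^sup>+z. indicator {..<0} z \<partial>convpow M (Suc n))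
      = (\<integral>\<^sup>+x. \<integral>\<^sup>+y. indicator {..<0} (x + y) \<partial>convpow M n \<partial>M)"
    by (rule nn_integral_convpow_Suc) simp
  also have "\<dots> = (\<integral>\<^sup>+x. 0 \<partial>M)"
  proof (rule nn_integral_cong_AE, use nonneg in eventually_elim)
    case (elim x)
    have "(\<integral>\<^sup>+y. indicator {..<0} (x + y) \<partial>convpow M n) = (\<integral>\<^sup>+y. 0 \<partial>convpow M n)"
      by (rule nn_integral_cong_AE, use Suc in eventually_elim) (use elim in \<open>auto simp: indicator_def\<close>)
    then show ?case by simp
  qed
  finally have "emeasure (convpow M (Suc n)) {..<0} = 0"
    using sets_convpow[of "Suc n"] by (subst (asm) nn_integral_indicator) auto
  then have "{..<0} \<in> null_sets (convpow M (Suc n))"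
    using sets_convpow[of "Suc n"] by (auto simp: null_sets_def)
  from AE_not_in[OF this] show ?case by auto
qed

lemma nn_integral_convpow_id:
  "(\<integral>\<^sup>+x. ennreal x \<partial>convpow M n) = of_nat n * (\<integral>\<^sup>+x. ennreal x \<partial>M)"
proof (induction n)
  case 0
  show ?case by (simp add: nn_integral_return)
next
  case (Suc n)
  interpret C: real_distribution "convpow M n" by (rule real_distribution_convpow)
  have "(\<integral>\<^sup>+z. ennreal z \<partial>convpow M (Suc n))
      = (\<integral>\<^sup>+x. \<integral>\<^sup>+y. ennreal (x + y) \<partial>convpow M n \<partial>M)"
    by (rule nn_integral_convpow_Suc) simp
  also have "\<dots> = (\<integral>\<^sup>+x. ennreal x + of_nat n * (\<integral>\<^sup>+x. ennreal x \<partial>M) \<partial>M)"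
  proof (rule nn_integral_cong_AE, use nonneg in eventually_elim)
    case (elim x)
    have "(\<integral>\<^sup>+y. ennreal (x + y) \<partial>convpow M n) = (\<integral>\<^sup>+y. ennreal x + ennreal y \<partial>convpow M n)"
      by (rule nn_integral_cong_AE, use AE_convpow_nonneg[of n] in eventually_elim)
         (use elim in simp)
    also have "\<dots> = ennreal x + (\<integral>\<^sup>+y. ennreal y \<partial>convpow M n)"
      by (subst nn_integral_add) (auto simp: C.emeasure_space_1[simplified])
    finally show ?case by (simp add: Suc)
  qed
  also have "\<dots> = of_nat (Suc n) * (\<integral>\<^sup>+x. ennreal x \<partial>M)"
    by (subst nn_integral_add) (auto simp: emeasure_space_1[simplified] algebra_simps)
  finally show ?case .
qed

lemma char_convpow: "char (convpow M n) t = char M t ^ n"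
proof (induction n)
  case 0
  show ?case by (simp add: char_def integral_return)
next
  case (Suc n)
  interpret C: real_distribution "convpow M n" by (rule real_distribution_convpow)
  interpret pair_prob_space M "convpow M n" ..
  have int: "integrable (M \<Otimes>\<^sub>M convpow M n) (\<lambda>(x, y). iexp (t * (x + y)))"
    by (rule integrable_const_bound[where B = 1]) (auto simp: split_beta)
  have "char (convpow M (Suc n)) t = (CLINT z|M \<Otimes>\<^sub>M convpow M n. iexp (t * (fst z + snd z)))"
    by (simp add: char_def convolution_def integral_distr case_prod_beta')
  also have "\<dots> = (CLINT x|M. CLINT y|convpow M n. iexp (t * (x + y)))"
    using integral_fst'[OF int] by (simp add: case_prod_beta')
  also have "\<dots> = (CLINT x|M. iexp (t * x) * char (convpow M n) t)"
    by (simp add: char_def distrib_left exp_add flip: of_real_mult)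
  also have "\<dots> = char M t * char (convpow M n) t"
    by (simp add: char_def)
  also have "\<dots> = char M t ^ Suc n"
    by (simp add: Suc)
  finally show ?case .
qed

abbreviation sum_tail :: "nat \<Rightarrow> real \<Rightarrow> real" where
  "sum_tail n z \<equiv> tail (convpow M n) z"

lemma sum_tail_bounds: "0 \<le> sum_tail n z" "sum_tail n z \<le> 1"
  using prob_space.prob_le_1[OF prob_space_convpow[of n]] by (auto simp: tail_def)

lemma sum_tail_antimono: "x \<le> y \<Longrightarrow> sum_tail n y \<le> sum_tail n x"
  using prob_space_convpow[of n] sets_convpow[of n] unfolding tail_def
  by (intro finite_measure.finite_measure_mono) (auto simp: prob_space_def)

lemma sum_tail_measurable [measurable]: "sum_tail n \<in> borel_measurable borel"
  by (intro borel_measurable_antimono antimonoI sum_tail_antimono)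

lemma sum_tail_0: "sum_tail 0 z = (if z < 0 then 1 else 0)"
  by (simp add: tail_def measure_return indicator_def)

lemma sum_tail_Suc: "sum_tail (Suc n) z = (\<integral>x. sum_tail n (z - x) \<partial>M)"
proof -
  interpret C: real_distribution "convpow M n" by (rule real_distribution_convpow)
  interpret CS: real_distribution "convpow M (Suc n)" by (rule real_distribution_convpow)
  have "ennreal (sum_tail (Suc n) z) = (\<integral>\<^sup>+y. indicator {z<..} y \<partial>convpow M (Suc n))"
    by (subst nn_integral_indicator) (simp_all add: tail_def CS.emeasure_eq_measure del: convpow.simps)
  also have "\<dots> = (\<integral>\<^sup>+x. \<integral>\<^sup>+y. indicator {z<..} (x + y) \<partial>convpow M n \<partial>M)"
    by (rule nn_integral_convpow_Suc) simp
  also have "\<dots> = (\<integral>\<^sup>+x. ennreal (sum_tail n (z - x)) \<partial>M)"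
  proof (rule nn_integral_cong)
    fix x
    have "(\<integral>\<^sup>+y. indicator {z<..} (x + y) \<partial>convpow M n) = (\<integral>\<^sup>+y. indicator {z - x<..} y \<partial>convpow M n)"
      by (rule nn_integral_cong) (auto simp: indicator_def)
    then show "(\<integral>\<^sup>+y. indicator {z<..} (x + y) \<partial>convpow M n) = ennreal (sum_tail n (z - x))"
      by (simp add: tail_def C.emeasure_eq_measure)
  qed
  also have "\<dots> = ennreal (\<integral>x. sum_tail n (z - x) \<partial>M)"
    by (rule nn_integral_eq_integral)
       (auto intro!: integrable_const_bound[where B = 1] simp: sum_tail_bounds)
  finally show ?thesis
    by (simp add: sum_tail_bounds Bochner_Integration.integral_nonneg del: convpow.simps)
qed

end

section \<open>Maxima of the centred random walk\<close>

context nonneg_law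
begin

text \<open>With \<open>S\<^sub>k\<close> the partial sums, \<open>pass c n x\<close> is the probability that \<open>S\<^sub>k - k c > x\<close> for some \<open>k \<le> n\<close>,
  expressed by conditioning on the first step.\<close>

primrec pass :: "real \<Rightarrow> nat \<Rightarrow> real \<Rightarrow> real" where
  "pass c 0 x = (if x < 0 then 1 else 0)"
| "pass c (Suc n) x = (if x < 0 then 1 else \<integral>y. pass c n (x - y + c) \<partial>M)"

lemma pass_neg: "x < 0 \<Longrightarrow> pass c n x = 1"
  by (cases n) auto

text \<open>One joint induction is needed: monotonicity makes the integrand of the next step
  measurable, and the bounds make it integrable; only then is the Bochner integral monotone in the
  integrand.\<close>

lemma pass_props: "0 \<le> pass c n x \<and> pass c n x \<le> 1 \<and> antimono (pass c n)"
proof (induction n arbitrary: x)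
  case 0
  show ?case by (auto simp: antimono_def)
next
  case (Suc n)
  have am: "antimono (pass c n)" using Suc by blast
  have [measurable]: "pass c n \<in> borel_measurable borel" by (rule borel_measurable_antimono[OF am])
  have int: "integrable M (\<lambda>y. pass c n (z - y + c))" for z
    by (rule integrable_const_bound[where B = 1]) (use Suc in \<open>auto\<close>)
  have le1: "(\<integral>y. pass c n (z - y + c) \<partial>M) \<le> 1" for z
    using integral_mono[OF int, of "\<lambda>_. 1" z] Suc prob_space by simp
  have ge0: "0 \<le> (\<integral>y. pass c n (z - y + c) \<partial>M)" for z
    using Suc by (intro Bochner_Integration.integral_nonneg) auto
  have "antimono (pass c (Suc n))"
  proof (rule antimonoI)
    fix x y :: real assume xy: "x \<le> y"
    show "pass c (Suc n) y \<le> pass c (Suc n) x"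
      using xy le1 by (auto intro!: integral_mono int antimonoD[OF am])
  qed
  moreover have "0 \<le> pass c (Suc n) x" "pass c (Suc n) x \<le> 1" using le1 ge0 by auto
  ultimately show ?case by blast
qed

lemma pass_nonneg: "0 \<le> pass c n x" and pass_le_1: "pass c n x \<le> 1" and pass_antimono: "antimono (pass c n)"
  using pass_props by blast+

lemma pass_measurable [measurable]: "pass c n \<in> borel_measurable borel"
  by (rule borel_measurable_antimono[OF pass_antimono])

lemma integrable_pass [simp, intro]: "integrable M (\<lambda>y. pass c n (z - y + c))"
  by (rule integrable_const_bound[where B = 1]) (auto simp: pass_nonneg pass_le_1)

lemma pass_mono_Suc: "pass c n x \<le> pass c (Suc n) x"
proof (induction n arbitrary: x)
  case 0
  show ?case by (auto intro!: Bochner_Integration.integral_nonneg)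
next
  case (Suc n)
  show ?case
  proof (cases "x < 0")
    case False
    have "(\<integral>y. pass c n (x - y + c) \<partial>M) \<le> (\<integral>y. pass c (Suc n) (x - y + c) \<partial>M)"
      by (intro integral_mono integrable_pass Suc)
    then show ?thesis
      using False by (simp only: pass.simps(2)[of c n x] pass.simps(2)[of c "Suc n" x] if_False)
  qed (simp add: pass_neg)
qed

lemma pass_mono_n: "m \<le> n \<Longrightarrow> pass c m x \<le> pass c n x"
  by (rule lift_Suc_mono_le[of "\<lambda>n. pass c n x"]) (auto intro: pass_mono_Suc simp del: pass.simps)

text \<open>The endpoint of the centred walk is one of the positions over which its maximum is
  taken.\<close>

lemma sum_tail_le_pass: "sum_tail n (x + real n * c) \<le> pass c n x"
proof (induction n arbitrary: x)
  case 0
  show ?case by (simp add: sum_tail_0 del: convpow.simps)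
next
  case (Suc n)
  show ?case
  proof (cases "x < 0")
    case True
    then show ?thesis by (simp add: pass_neg sum_tail_bounds del: convpow.simps)
  next
    case False
    have "sum_tail (Suc n) (x + real (Suc n) * c) = (\<integral>y. sum_tail n ((x - y + c) + real n * c) \<partial>M)"
      unfolding sum_tail_Suc by (simp add: algebra_simps)
    also have "\<dots> \<le> (\<integral>y. pass c n (x - y + c) \<partial>M)"
      by (intro integral_mono Suc integrable_pass integrable_const_bound[where B = 1]) (auto simp: sum_tail_bounds)
    finally show ?thesis using False by (simp del: convpow.simps)
  qed
qed

abbreviation T :: "real \<Rightarrow> real" where "T \<equiv> tail M"

lemma T_bounds: "0 \<le> T z" "T z \<le> 1"
  by (auto simp: tail_def)

lemma T_eq_integral: "T z = (\<integral>y. indicator {z<..} y \<partial>M)"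
  by (simp add: tail_def)

lemma integrable_indicator_tail [simp, intro]: "integrable M (indicator {z<..} :: real \<Rightarrow> real)"
  by (rule integrable_const_bound[where B = 1]) auto

text \<open>To exceed \<open>a + J + b\<close> without a jump above \<open>J\<close>, the walk first passes \<open>a\<close> with overshoot
  at most \<open>J\<close> and then has to gain another \<open>b\<close>.\<close>

lemma pass_overshoot:
  assumes "0 \<le> a" "0 \<le> J" "0 \<le> b" "0 \<le> c" "m \<le> n"
  shows "pass c n (a + J + b) \<le> real m * T J + (pass c n a - pass c m a) + pass c n a * pass c n b"
  using assms
\<comment> \<open>The parameter \<open>m\<close> separates early from late first passages of
  \<open>a\<close>. Only jumps in the first \<open>m\<close> steps are charged to
  \<open>T J\<close>, while a passage after step \<open>m\<close> costs
  \<open>pass c n a - pass c m a\<close>. With \<open>m\<close> fixed the bound stays useful as n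
  grows; with m = n the late term vanishes.\<close>
proof (induction m arbitrary: n a)
  case 0
  have "pass c n (a + J + b) \<le> pass c n a"
    using 0 by (intro antimonoD[OF pass_antimono]) auto
  then show ?case using 0 pass_nonneg by (simp add: add_increasing2)
next
  case (Suc m)
  then obtain n' where n: "n = Suc n'" and mn: "m \<le> n'" by (cases n) auto
  have pw: "pass c n' (a + J + b - y + c) \<le> indicator {J<..} y + real m * T J
      + (pass c n' (a - y + c) - pass c m (a - y + c)) + pass c n' (a - y + c) * pass c n' b" for y
  proof -
    consider "J < y" | "y \<le> J" "a - y + c < 0" | "y \<le> J" "0 \<le> a - y + c" by linarith
    then show ?thesis
    proof cases
      case 1
      have "pass c m (a - y + c) \<le> pass c n' (a - y + c)" by (rule pass_mono_n[OF mn])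
      moreover have "0 \<le> pass c n' (a - y + c) * pass c n' b" "0 \<le> real m * T J"
        using pass_nonneg T_bounds by auto
      ultimately show ?thesis using 1 pass_le_1[of c n' "a + J + b - y + c"] by simp
    next
      case 2
      \<comment> \<open>The first step passes \<open>a\<close> but overshoots by at most
        \<open>J\<close>, so at least \<open>b\<close> remains to be gained. Both passage
        probabilities of the negative level are 1, so the late term cancels.\<close>
      have "pass c n' (a + J + b - y + c) \<le> pass c n' b"
        using 2 Suc.prems by (intro antimonoD[OF pass_antimono]) auto
      moreover have "0 \<le> real m * T J" using T_bounds by auto
      ultimately show ?thesis using 2 by (simp add: pass_neg)
    next
      case 3
      have "pass c n' ((a - y + c) + J + b) \<le> real m * T J + (pass c n' (a - y + c) - pass c m (a - y + c))
          + pass c n' (a - y + c) * pass c n' b"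
        using 3 Suc.prems mn by (intro Suc.IH) auto
      then show ?thesis using 3 by (simp add: algebra_simps)
    qed
  qed
  have "pass c n (a + J + b) = (\<integral>y. pass c n' (a + J + b - y + c) \<partial>M)"
    using Suc.prems n by simp
  also have "\<dots> \<le> (\<integral>y. indicator {J<..} y + real m * T J
      + (pass c n' (a - y + c) - pass c m (a - y + c)) + pass c n' (a - y + c) * pass c n' b \<partial>M)"
    by (intro integral_mono pw Bochner_Integration.integrable_add Bochner_Integration.integrable_diff
        integrable_mult_left) auto
  also have "\<dots> = T J + real m * T J + (pass c n a - pass c (Suc m) a) + pass c n a * pass c n' b"
    using Suc.prems n by (simp add: T_eq_integral prob_space[simplified])
  also have "pass c n a * pass c n' b \<le> pass c n a * pass c n b"
    using pass_nonneg pass_mono_Suc[of c n' b] n by (intro mult_left_mono) auto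
  finally show ?case by (simp add: algebra_simps)
qed

section \<open>Negative drift: passage probabilities that are small uniformly in the number of
  steps\<close>

abbreviation r :: real where "r \<equiv> (\<integral>x. x \<partial>M)"

lemma r_nonneg: "0 \<le> r"
  using nonneg by (rule integral_nonneg_AE)

lemma integrable_pos_parts [simp, intro]:
  "integrable M (\<lambda>y. max 0 (y - c))" "integrable M (\<lambda>y. max 0 (c - y))"
  using integrable_id by auto

text \<open>With \<open>I n\<close> the mean of the maximum over \<open>n\<close> steps, translation invariance of Lebesgue measure gives
  \<open>I (n + 1) + pass c n c * E (c - X)\<^sup>+ \<le> I n + E (X - c)\<^sup>+\<close>, and \<open>I n \<le> I (n + 1)\<close>.\<close>

lemma pass_drift_bound:
  assumes c: "0 \<le> c"
  shows "pass c n c * (\<integral>y. max 0 (c - y) \<partial>M) \<le> (\<integral>y. max 0 (y - c) \<partial>M)"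
proof -
  define I where "I n = (\<integral>\<^sup>+x. ennreal (pass c n x) * indicator {0..} x \<partial>lborel)" for n
  define A where "A = (\<integral>y. max 0 (y - c) \<partial>M)"
  define B where "B = (\<integral>y. max 0 (c - y) \<partial>M)"
  have A: "(\<integral>\<^sup>+y. ennreal (max 0 (y - c)) \<partial>M) = ennreal A" and B: "(\<integral>\<^sup>+y. ennreal (max 0 (c - y)) \<partial>M) = ennreal B"
    unfolding A_def B_def by (intro nn_integral_eq_integral; auto)+
  have A0: "0 \<le> A" "0 \<le> B"
    unfolding A_def B_def by (intro Bochner_Integration.integral_nonneg; auto)+
  interpret L: pair_sigma_finite lborel M
    by (simp add: pair_sigma_finite_def sigma_finite_measure_axioms lborel.sigma_finite_measure_axioms)
  have step: "I (Suc n) + ennreal (pass c n c) * ennreal B \<le> I n + ennreal A" for n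
  proof -
    define J where "J y = (\<integral>\<^sup>+u. ennreal (pass c n u) * indicator {c - y..} u \<partial>lborel)" for y
    have "I (Suc n) = (\<integral>\<^sup>+x. (\<integral>\<^sup>+y. ennreal (pass c n (x - y + c)) * indicator {0..} x \<partial>M) \<partial>lborel)"
      unfolding I_def
    proof (rule nn_integral_cong)
      fix x :: real
      have "(\<integral>\<^sup>+y. ennreal (pass c n (x - y + c)) \<partial>M) = ennreal (\<integral>y. pass c n (x - y + c) \<partial>M)"
        by (rule nn_integral_eq_integral) (auto simp: pass_nonneg)
      then show "ennreal (pass c (Suc n) x) * indicator {0..} x
          = (\<integral>\<^sup>+y. ennreal (pass c n (x - y + c)) * indicator {0..} x \<partial>M)"
        by (simp add: nn_integral_multc indicator_def)
    qed
    also have "\<dots> = (\<integral>\<^sup>+y. (\<integral>\<^sup>+x. ennreal (pass c n (x - y + c)) * indicator {0..} x \<partial>lborel) \<partial>M)"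
      by (rule L.Fubini'[symmetric]) (simp add: split_beta')
    also have "\<dots> = (\<integral>\<^sup>+y. J y \<partial>M)"
    proof (rule nn_integral_cong)
      fix y
      have "J y = (\<integral>\<^sup>+x. ennreal (pass c n ((c - y) + x)) * indicator {c - y..} ((c - y) + x) \<partial>lborel)"
        unfolding J_def
        using nn_integral_real_affine[of "\<lambda>u. ennreal (pass c n u) * indicator {c - y..} u" 1 "c - y"] by simp
      also have "\<dots> = (\<integral>\<^sup>+x. ennreal (pass c n (x - y + c)) * indicator {0..} x \<partial>lborel)"
        by (rule nn_integral_cong) (auto simp: indicator_def algebra_simps)
      finally show "(\<integral>\<^sup>+x. ennreal (pass c n (x - y + c)) * indicator {0..} x \<partial>lborel) = J y" ..
    qed
    finally have IJ: "I (Suc n) = (\<integral>\<^sup>+y. J y \<partial>M)" .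
    have [measurable]: "J \<in> borel_measurable borel"
    proof -
      have "J = (\<lambda>y. \<integral>\<^sup>+u. ennreal (pass c n u) * (if c - y \<le> u then 1 else 0) \<partial>lborel)"
        by (simp add: J_def indicator_def fun_eq_iff of_bool_def)
      then show ?thesis by simp
    qed
    \<comment> \<open>Compare integration from \<open>c - y\<close> with integration from 0. If y >=
      c, the added interval has length \<open>y - c\<close> and integrand at most 1. If y < c, an
      interval of length \<open>c - y\<close> is lost; as y >= 0 it lies below \<open>c\<close>,
      where the integrand is at least \<open>pass c n c\<close>.\<close>
    have Jb: "J y + ennreal (pass c n c) * ennreal (max 0 (c - y)) \<le> I n + ennreal (max 0 (y - c))" if "0 \<le> y" for y
    proof (cases "c \<le> y")
      case True
      have "J y \<le> (\<integral>\<^sup>+u. ennreal (pass c n u) * indicator {0..} u + indicator {c - y..0} u \<partial>lborel)"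
        unfolding J_def by (rule nn_integral_mono) (auto simp: indicator_def pass_le_1 pass_neg)
      also have "\<dots> = I n + ennreal (y - c)"
        using True by (subst nn_integral_add) (auto simp: I_def)
      finally show ?thesis using True by (cases "y = c") (auto simp: max_def)
    next
      case False
      have "ennreal (pass c n c) * ennreal (max 0 (c - y))
          = (\<integral>\<^sup>+u. ennreal (pass c n c) * indicator {0..<c - y} u \<partial>lborel)"
        using False by (simp add: nn_integral_cmult)
      then have "J y + ennreal (pass c n c) * ennreal (max 0 (c - y))
          = (\<integral>\<^sup>+u. ennreal (pass c n u) * indicator {c - y..} u + ennreal (pass c n c) * indicator {0..<c - y} u \<partial>lborel)"
        by (subst nn_integral_add) (auto simp: J_def)
      also have "\<dots> \<le> I n"
        unfolding I_def using that False
        by (intro nn_integral_mono) (auto simp: indicator_def intro!: ennreal_leI antimonoD[OF pass_antimono])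
      finally show ?thesis using False by simp
    qed
    have "I (Suc n) + ennreal (pass c n c) * ennreal B = (\<integral>\<^sup>+y. J y + ennreal (pass c n c) * ennreal (max 0 (c - y)) \<partial>M)"
      by (simp add: IJ nn_integral_add nn_integral_cmult B[simplified])
    also have "\<dots> \<le> (\<integral>\<^sup>+y. I n + ennreal (max 0 (y - c)) \<partial>M)"
      by (rule nn_integral_mono_AE) (use nonneg in eventually_elim, use Jb in blast)
    also have "\<dots> = I n + ennreal A"
      by (subst nn_integral_add) (auto simp: A A[simplified] emeasure_space_1[simplified])
    finally show ?thesis .
  qed
  \<comment> \<open>Finiteness is what permits cancelling \<open>I n\<close> in the extended
    reals.\<close>
  have fin: "I n < \<top>" for n
  proof (induction n)
    case 0
    have "I 0 = (\<integral>\<^sup>+x. 0 \<partial>(lborel :: real measure))"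
      unfolding I_def by (rule nn_integral_cong) (auto simp: indicator_def)
    then show ?case by simp
  next
    case (Suc n)
    have "I (Suc n) \<le> I (Suc n) + ennreal (pass c n c) * ennreal B" by simp
    also note step
    also have "I n + ennreal A < \<top>" using Suc by simp
    finally show ?case .
  qed
  have "I n \<le> I (Suc n)"
    unfolding I_def by (intro nn_integral_mono mult_right_mono ennreal_leI pass_mono_Suc) auto
  then have "I n + ennreal (pass c n c) * ennreal B \<le> I n + ennreal A"
    using step[of n] by (meson add_right_mono order_trans)
  then have "ennreal (pass c n c) * ennreal B \<le> ennreal A"
    using fin[of n] by (auto simp: ennreal_add_left_cancel_le)
  then show ?thesis
    using A0 pass_nonneg by (simp add: A_def B_def flip: ennreal_mult)
qed

text \<open>A drift below \<open>c\<close> makes E (c - X)^+ exceed E (X - c)^+, so level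
  \<open>c\<close> is passed with probability at most some \<rho> < 1 for every n. Passing a much
  higher level requires passing \<open>c\<close> and then gaining \<open>b\<close> afresh, so the
  limit l of the supremum over n satisfies l <= \<rho> l and is 0. Only a finite mean is
  used.\<close>

lemma pass_uniformly_small:
  assumes c: "r < c" and e: "0 < e"
  shows "\<exists>y\<ge>0. \<forall>n. \<forall>z\<ge>y. pass c n z \<le> e"
proof -
  have c0: "0 < c" using c r_nonneg by linarith
  define A where "A = (\<integral>y. max 0 (y - c) \<partial>M)"
  define B where "B = (\<integral>y. max 0 (c - y) \<partial>M)"
  have "B - A = (\<integral>y. max 0 (c - y) - max 0 (y - c) \<partial>M)"
    unfolding A_def B_def by (subst Bochner_Integration.integral_diff) auto
  also have "\<dots> = (\<integral>y. c - y \<partial>M)"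
    by (intro Bochner_Integration.integral_cong) (auto simp: max_def)
  also have "\<dots> = c - r"
    using integrable_id by (simp add: prob_space[simplified])
  finally have AB: "A < B" using c by simp
  have "0 \<le> A" unfolding A_def by (intro Bochner_Integration.integral_nonneg) auto
  define \<rho> where "\<rho> = A / B"
  have \<rho>: "0 \<le> \<rho>" "\<rho> < 1" using AB \<open>0 \<le> A\<close> by (auto simp: \<rho>_def)
  have pc: "pass c n c \<le> \<rho>" for n
    using pass_drift_bound[of c n] AB \<open>0 \<le> A\<close> c0 by (simp add: \<rho>_def A_def[symmetric] B_def[symmetric] field_simps)
  define P where "P y = (SUP n. pass c n y)" for y
  have bdd: "bdd_above (range (\<lambda>n. pass c n y))" for y
    by (rule bdd_aboveI[of _ 1]) (auto simp: pass_le_1)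
  have pP: "pass c n y \<le> P y" for n y
    unfolding P_def by (rule cSUP_upper[OF _ bdd]) simp
  have P0: "0 \<le> P y" for y using pP[of 0 y] pass_nonneg[of c 0 y] by linarith
  define l where "l = (INF y\<in>{0..}. P y)"
  have bddl: "bdd_below (P ` {0..})" by (rule bdd_belowI[of _ 0]) (auto simp: P0)
  have lP: "l \<le> P y" if "0 \<le> y" for y
    unfolding l_def using that by (intro cINF_lower bddl) auto
  have l0: "0 \<le> l" unfolding l_def by (rule cINF_greatest) (auto simp: P0)
  have key: "l \<le> 2 * d + \<rho> * P b" if d: "0 < d" and b: "0 \<le> b" for d b
  proof -
    \<comment> \<open>First choose \<open>m\<close> so that passages of \<open>c\<close> later than
      step \<open>m\<close> have probability below \<open>d\<close>, whatever n is; then choose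
      \<open>J\<close> so large that a jump above \<open>J\<close> within \<open>m\<close> steps is
      equally unlikely.\<close>
    have "P c - d < P c" using d by simp
    then obtain m where m: "P c - d < pass c m c"
      unfolding P_def[of c] using less_cSUP_iff[OF _ bdd] by auto
    have "((\<lambda>J. real m * T J) \<longlongrightarrow> real m * 0) at_top" by (intro tendsto_intros tail_tendsto_0)
    then have "\<forall>\<^sub>F J in at_top. real m * T J < d" using d by (auto dest: order_tendstoD)
    then obtain J where J: "0 \<le> J" "real m * T J < d"
      by (metis (mono_tags, lifting) eventually_at_top_linorder nle_le)
    have "pass c n (c + J + b) \<le> 2 * d + \<rho> * P b" for n
    proof -
      \<comment> \<open>\<open>pass_overshoot\<close> requires the split point \<open>m\<close> not
        to exceed the number of steps.\<close>
      have "pass c n (c + J + b) \<le> pass c (max m n) (c + J + b)" by (intro pass_mono_n) simp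
      also have "\<dots> \<le> real m * T J + (pass c (max m n) c - pass c m c) + pass c (max m n) c * pass c (max m n) b"
        by (rule pass_overshoot) (use c0 J b in auto)
      also have "\<dots> \<le> d + d + \<rho> * P b"
        using J m pP[of "max m n" c] by (intro add_mono mult_mono pc pP pass_nonneg \<rho>) auto
      finally show ?thesis by simp
    qed
    then have "P (c + J + b) \<le> 2 * d + \<rho> * P b" unfolding P_def[of "c + J + b"] by (intro cSUP_least) auto
    then show ?thesis using lP[of "c + J + b"] c0 J b by simp
  qed
  have "l \<le> \<rho> * P b" if "0 \<le> b" for b
  proof (rule field_le_epsilon)
    fix d :: real assume "0 < d"
    then show "l \<le> \<rho> * P b + d" using key[of "d / 2" b] that by simp
  qed
  then have *: "l \<le> \<rho> * P b" if "0 \<le> b" for b using that by blast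
  have "l \<le> \<rho> * l"
  proof (cases "\<rho> = 0")
    case True then show ?thesis using *[of 0] by simp
  next
    case False
    have "l / \<rho> \<le> l" unfolding l_def[of] using * False \<rho> unfolding l_def[symmetric]
      by (subst l_def, intro cINF_greatest) (auto simp: field_simps)
    then show ?thesis using False \<rho> by (simp add: field_simps)
  qed
  then have "l * (1 - \<rho>) \<le> 0" by (simp add: algebra_simps)
  then have "l = 0" using l0 \<rho> by (simp add: mult_le_0_iff)
  then have "\<exists>y\<in>{0..}. P y < e"
    using e cINF_less_iff[OF _ bddl, of e] unfolding l_def by auto
  then obtain y where y: "0 \<le> y" "P y < e" by auto
  have "pass c n z \<le> e" if "y \<le> z" for n z
    using antimonoD[OF pass_antimono[of c n] that] pP[of n y] y by linarith
  then show ?thesis using y by auto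
qed

text \<open>\<open>x1\<close> and \<open>C\<close> are fixed before \<open>K\<close>,
  \<open>x\<close> and \<open>n\<close>, so the bound can be used while
  \<open>T u <= K * W u\<close> is still being established. The condition
  \<open>1 <= K * W x1\<close> lets the trivial bound 1 start the induction over scales.\<close>

lemma pass_linear_bound:
  fixes W :: "real \<Rightarrow> real"
  assumes c: "r < c" and W_pos: "\<And>x. 0 < W x" and W_antimono: "antimono W"
    and W_half: "\<And>x. x0 \<le> x \<Longrightarrow> W (x / 2) \<le> D * W x"
  shows "\<exists>x1>0. \<exists>C>0. \<forall>K x n y. (\<forall>u. 0 \<le> u \<and> u \<le> x \<longrightarrow> T u \<le> K * W u) \<longrightarrow> 1 \<le> K * W x1
      \<longrightarrow> x1 \<le> y \<longrightarrow> y \<le> x \<longrightarrow> 1 \<le> n \<longrightarrow> pass c n y \<le> C * real n * K * W y"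
proof -
  have c0: "0 < c" using c r_nonneg by linarith
  have "0 < D * W (max x0 1)"
    using W_half[of "max x0 1"] W_pos[of "max x0 1 / 2"] by simp
  then have D: "0 < D" using W_pos zero_less_mult_pos2 by blast
  \<comment> \<open>Halving the level costs a factor \<open>D\<close> in \<open>W\<close>; the
    probability \<open>1 / (2 * D)\<close> compensates it and leaves a contraction by 1/2.\<close>
  obtain y0 where y0: "0 \<le> y0" "\<And>n z. y0 \<le> z \<Longrightarrow> pass c n z \<le> 1 / (2 * D)"
    using pass_uniformly_small[OF c, of "1 / (2 * D)"] D by auto
  define x1 where "x1 = max (4 * y0) (max (4 * x0) 1)"
  have x1: "0 < x1" "4 * y0 \<le> x1" "4 * x0 \<le> x1" by (auto simp: x1_def)
  \<comment> \<open>Chosen so that D^2 + C/2 <= C (halving step) and D^2 + 1/2 <= C (lowest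
    scale).\<close>
  define C where "C = 2 * D\<^sup>2 + 1"
  have C: "0 < C" by (simp add: C_def add_nonneg_pos)
  have main: "pass c n y \<le> C * real n * K * W y"
    if K: "\<And>u. 0 \<le> u \<Longrightarrow> u \<le> x \<Longrightarrow> T u \<le> K * W u" "1 \<le> K * W x1"
      and y: "x1 \<le> y" "y \<le> x" "y \<le> 2 ^ k * x1" and n: "1 \<le> n" for k K x n y
    using y
  proof (induction k arbitrary: y)
    have K0: "0 < K" using K(2) W_pos[of x1] by (metis less_le_trans zero_less_mult_pos2 zero_less_one)
    \<comment> \<open>Here the overshoot bound is taken with m = n, so no late passages are left
      over; a jump above y/4 is paid for by two halvings of \<open>W\<close>.\<close>
    have rec: "pass c n y \<le> D\<^sup>2 * real n * K * W y + pass c n (y / 2) / (2 * D)" if y: "x1 \<le> y" "y \<le> x" for y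
    proof -
      have "pass c n y = pass c n (y / 4 + y / 4 + y / 2)" by simp
      also have "\<dots> \<le> real n * T (y / 4) + (pass c n (y / 4) - pass c n (y / 4)) + pass c n (y / 4) * pass c n (y / 2)"
        by (rule pass_overshoot) (use y x1 c0 in auto)
      also have "\<dots> \<le> real n * (K * (D * (D * W y))) + 1 / (2 * D) * pass c n (y / 2)"
      proof -
        have "T (y / 4) \<le> K * W (y / 2 / 2)" using K(1)[of "y / 4"] y x1 by simp
        also have "\<dots> \<le> K * (D * W (y / 2))"
          using K0 x1 y by (intro mult_left_mono W_half) auto
        also have "\<dots> \<le> K * (D * (D * W y))"
          using K0 D x1 y by (intro mult_left_mono W_half) auto
        finally have "real n * T (y / 4) \<le> real n * (K * (D * (D * W y)))" by (intro mult_left_mono) auto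
        moreover have "pass c n (y / 4) * pass c n (y / 2) \<le> 1 / (2 * D) * pass c n (y / 2)"
          using y0 x1 y pass_nonneg by (intro mult_right_mono) auto
        ultimately show ?thesis by simp
      qed
      finally show ?thesis by (simp add: power2_eq_square mult_ac)
    qed
    have KW: "0 \<le> real n * K * W y" "K * W y \<le> real n * K * W y" for y
      using K0 W_pos[of y] n by (auto simp: less_imp_le)
    \<comment> \<open>On the lowest scale y/2 may lie below \<open>x1\<close>, out of reach of the
      recursion; there 1 <= K W(x1) <= K W(y/2) serves instead.\<close>
    have small: "pass c n y \<le> C * real n * K * W y" if y: "x1 \<le> y" "y \<le> x" "y \<le> 2 * x1" for y
    proof -
      have "pass c n (y / 2) \<le> K * W x1" using K(2) pass_le_1[of c n "y / 2"] by linarith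
      also have "\<dots> \<le> K * W (y / 2)"
        using K0 y by (intro mult_left_mono antimonoD[OF W_antimono]) auto
      also have "\<dots> \<le> K * (D * W y)"
        using K0 x1 y by (intro mult_left_mono W_half) auto
      finally have "pass c n (y / 2) / (2 * D) \<le> K * W y / 2"
        using D by (simp add: field_simps)
      then have "pass c n y \<le> D\<^sup>2 * (real n * K * W y) + real n * K * W y / 2"
        using rec[OF y(1,2)] KW[of y] by (simp add: mult_ac)
      also have "\<dots> \<le> C * (real n * K * W y)"
      proof -
        have "(D\<^sup>2 + 1 / 2) * (real n * K * W y) \<le> C * (real n * K * W y)"
          by (intro mult_right_mono KW) (simp add: C_def)
        then show ?thesis by (simp add: algebra_simps)
      qed
      finally show ?thesis by (simp add: mult_ac)
    qed
    {
      case 0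
      then show ?case using x1 by (intro small) auto
    next
      case (Suc k)
      show ?case
      proof (cases "y \<le> 2 * x1")
        case True
        then show ?thesis using small Suc by blast
      next
        case False
        have "pass c n (y / 2) \<le> C * real n * K * W (y / 2)"
          using Suc.prems False x1 by (intro Suc.IH) auto
        also have "\<dots> \<le> C * real n * K * (D * W y)"
          using Suc.prems x1 K0 C by (intro mult_left_mono W_half) auto
        finally have "pass c n (y / 2) / (2 * D) \<le> C * real n * K * W y / 2"
          using D by (simp add: field_simps)
        then have "pass c n y \<le> (D\<^sup>2 + C / 2) * (real n * K * W y)"
          using rec[of y] Suc.prems by (simp add: algebra_simps)
        also have "\<dots> \<le> C * (real n * K * W y)"
          by (intro mult_right_mono KW) (simp add: C_def)
        finally show ?thesis by (simp add: mult_ac)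
      qed
    }
  qed
  have pow: "\<exists>k. y \<le> 2 ^ k * x1" for y
  proof -
    obtain k where "y / x1 < 2 ^ k" using real_arch_pow[of 2 "y / x1"] by auto
    then show ?thesis using x1 by (auto simp: field_simps intro!: exI[of _ k])
  qed
  show ?thesis
  proof (rule exI[of _ x1], rule conjI[OF x1(1)], rule exI[of _ C], rule conjI[OF C], intro allI impI)
    fix K x y and n :: nat
    assume K: "\<forall>u. 0 \<le> u \<and> u \<le> x \<longrightarrow> T u \<le> K * W u" "1 \<le> K * W x1"
      and y: "x1 \<le> y" "y \<le> x" and n: "1 \<le> n"
    obtain k where "y \<le> 2 ^ k * x1" using pow by blast
    then show "pass c n y \<le> C * real n * K * W y" using K y n by (intro main[of x K y k n]) auto
  qed
qed

section \<open>One large summand, and an exponential lower bound for sums\<close>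

lemma integrable_sum_tail [simp, intro]: "integrable M (\<lambda>y. sum_tail n (z - y))"
  by (rule integrable_const_bound[where B = 1]) (auto simp: sum_tail_bounds)

lemma sum_tail_neg: "z < 0 \<Longrightarrow> sum_tail n z = 1"
proof -
  assume z: "z < 0"
  interpret C: real_distribution "convpow M n" by (rule real_distribution_convpow)
  show ?thesis unfolding tail_def
    by (subst C.prob_eq_1) (use AE_convpow_nonneg[of n] z in \<open>auto elim!: eventually_mono\<close>)
qed

lemma sum_tail_mono_Suc: "sum_tail n z \<le> sum_tail (Suc n) z"
proof -
  have "sum_tail n z = (\<integral>y. sum_tail n z \<partial>M)" by (simp add: prob_space[simplified])
  also have "\<dots> \<le> (\<integral>y. sum_tail n (z - y) \<partial>M)"
    by (rule integral_mono_AE) (use nonneg in \<open>auto elim!: eventually_mono intro!: sum_tail_antimono\<close>)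
  finally show ?thesis by (simp only: sum_tail_Suc)
qed

text \<open>Either some summand exceeds \<open>u\<close>, or some summand lies in (v, u] and the
  others still add up to more than \<open>v\<close>. For bounded n the factor
  \<open>sum_tail n v\<close> makes the second event of smaller order.\<close>

lemma sum_tail_upper:
  assumes "0 \<le> v" "v \<le> u"
  shows "sum_tail n (u + real n * v) \<le> real n * T u + real n * T v * sum_tail n v"
proof (induction n)
  case 0
  show ?case using assms by (simp add: sum_tail_0 del: convpow.simps)
next
  case (Suc n)
  have pw: "sum_tail n (u + real (Suc n) * v - y) \<le> indicator {u<..} y + sum_tail n (u + real n * v) + indicator {v<..} y * sum_tail n v" for y
  proof -
    consider "u < y" | "y \<le> v" "y \<le> u" | "v < y" "y \<le> u" using assms by linarith
    then show ?thesis
    proof cases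
      case 1
      then show ?thesis using sum_tail_bounds[of n] by (simp add: add_increasing2 indicator_def)
    next
      case 2
      then have "sum_tail n (u + real (Suc n) * v - y) \<le> sum_tail n (u + real n * v)" by (intro sum_tail_antimono) (simp add: algebra_simps)
      then show ?thesis using 2 by simp
    next
      case 3
      have "0 \<le> real n * v" using assms by simp
      then have "sum_tail n (u + real (Suc n) * v - y) \<le> sum_tail n v" using 3 by (intro sum_tail_antimono) (simp add: algebra_simps)
      then show ?thesis using 3 sum_tail_bounds[of n "u + real n * v"] by simp
    qed
  qed
  have "sum_tail (Suc n) (u + real (Suc n) * v) \<le> (\<integral>y. indicator {u<..} y + sum_tail n (u + real n * v) + indicator {v<..} y * sum_tail n v \<partial>M)"
    unfolding sum_tail_Suc by (intro integral_mono pw) auto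
  also have "\<dots> = T u + sum_tail n (u + real n * v) + T v * sum_tail n v"
    by (simp add: T_eq_integral prob_space[simplified])
  also have "\<dots> \<le> T u + (real n * T u + real n * T v * sum_tail n v) + T v * sum_tail n v"
    using Suc by simp
  also have "\<dots> = real (Suc n) * T u + real (Suc n) * T v * sum_tail n v" by (simp add: algebra_simps)
  also have "\<dots> \<le> real (Suc n) * T u + real (Suc n) * T v * sum_tail (Suc n) v"
    by (intro add_left_mono mult_left_mono sum_tail_mono_Suc mult_nonneg_nonneg T_bounds) auto
  finally show ?case .
qed

text \<open>As summands are non-negative, a single one above \<open>x\<close> suffices. With t = T
  x, the left side is a weakened Bonferroni bound for 1 - (1 - t)^n.\<close>

lemma sum_tail_lower:
  assumes "0 \<le> x"
  shows "real n * T x * (1 - real n * T x) \<le> sum_tail n x"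
proof (induction n)
  case 0
  show ?case using sum_tail_bounds(1)[of 0 x] by (simp del: convpow.simps)
next
  case (Suc n)
  let ?t = "T x"
  have t: "0 \<le> ?t" "?t \<le> 1" using T_bounds by auto
  have "?t + (1 - ?t) * sum_tail n x = (\<integral>y. indicator {x<..} y * (1 - sum_tail n x) + sum_tail n x \<partial>M)"
    by (simp add: T_eq_integral prob_space[simplified] algebra_simps)
  also have "\<dots> \<le> (\<integral>y. sum_tail n (x - y) \<partial>M)"
  proof (rule integral_mono_AE)
    show "AE y in M. indicator {x<..} y * (1 - sum_tail n x) + sum_tail n x \<le> sum_tail n (x - y)"
      using nonneg by eventually_elim (auto simp: indicator_def sum_tail_neg intro!: sum_tail_antimono)
  qed auto
  finally have "?t + (1 - ?t) * sum_tail n x \<le> sum_tail (Suc n) x" by (simp only: sum_tail_Suc)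
  moreover have "(1 - ?t) * (real n * ?t * (1 - real n * ?t)) \<le> (1 - ?t) * sum_tail n x"
    using Suc t by (intro mult_left_mono) auto
  moreover have "real (Suc n) * ?t * (1 - real (Suc n) * ?t) \<le> ?t + (1 - ?t) * (real n * ?t * (1 - real n * ?t))"
  proof -
    \<comment> \<open>This product is exactly the right side minus the left side.\<close>
    have "0 \<le> ?t\<^sup>2 * (real n + 1 + (real n)\<^sup>2 * ?t)" using t by simp
    then show ?thesis by (simp add: algebra_simps power2_eq_square)
  qed
  ultimately show ?case by linarith
qed

text \<open>A Chernoff bound: a non-negative X with mean above \<open>c\<close> satisfies E e^(-sX)
  <= e^(-sc) for some s > 0, whence P (S_n <= n c - y) <= e^(-sy) for all n at once. The induction
  on n replaces independence plus Markov's inequality.\<close>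

lemma sum_tail_lower_uniform:
  assumes c: "c < r"
  shows "\<exists>s>0. \<forall>n y. 1 - exp (- s * y) \<le> sum_tail n (real n * c - y)"
proof -
  \<comment> \<open>With s = 1/(k+1) this is (1 - e^(-sx))/s. It tends to x and is dominated by x,
    so its mean tends to \<open>r\<close> and exceeds \<open>c\<close> for some k.\<close>
  define f where "f k x = real (Suc k) * (1 - exp (- x / real (Suc k)))" for k :: nat and x :: real
  have lim: "(\<lambda>k. f k x) \<longlonglongrightarrow> x" for x
    unfolding f_def by real_asymp
  have bnd: "norm (f k x) \<le> x" if "0 \<le> x" for k x
  proof -
    have "1 - exp (- x / real (Suc k)) \<le> x / real (Suc k)" using exp_ge_add_one_self[of "- x / real (Suc k)"] by simp
    moreover have "exp (- x / real (Suc k)) \<le> 1" using that by simp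
    moreover have "real (Suc k) * (1 - exp (- x / real (Suc k))) \<le> real (Suc k) * (x / real (Suc k))"
      by (intro mult_left_mono calculation(1)) simp
    ultimately show ?thesis by (simp add: f_def)
  qed
  have "(\<lambda>k. \<integral>x. f k x \<partial>M) \<longlonglongrightarrow> (\<integral>x. x \<partial>M)"
  proof (rule integral_dominated_convergence)
    show "integrable M (\<lambda>x. x)" by (rule integrable_id)
    show "AE x in M. norm (f k x) \<le> x" for k using nonneg by eventually_elim (rule bnd)
  qed (use lim in \<open>auto simp: f_def\<close>)
  then have "\<forall>\<^sub>F k in sequentially. c < (\<integral>x. f k x \<partial>M)" using c by (rule order_tendstoD)
  then obtain k where k: "c < (\<integral>x. f k x \<partial>M)" by (auto dest: eventually_happens)
  define s where "s = 1 / real (Suc k)"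
  have s: "0 < s" by (simp add: s_def)
  have int: "integrable M (\<lambda>x. exp (- s * x))"
    by (rule integrable_const_bound[where B = 1]) (use nonneg s in \<open>auto elim!: eventually_mono\<close>)
  have "(\<integral>x. f k x \<partial>M) = (\<integral>x. (1 - exp (- s * x)) / s \<partial>M)" by (simp add: f_def s_def)
  also have "\<dots> = (1 - (\<integral>x. exp (- s * x) \<partial>M)) / s" using int by (simp add: prob_space[simplified])
  finally have "c * s < 1 - (\<integral>x. exp (- s * x) \<partial>M)"
    using k s by (simp add: pos_less_divide_eq del: mult_minus_left)
  then have "(\<integral>x. exp (- s * x) \<partial>M) \<le> 1 - s * c" by (simp add: mult.commute)
  also have "\<dots> \<le> exp (- s * c)" using exp_ge_add_one_self[of "- s * c"] by simp
  finally have le: "(\<integral>x. exp (- s * x) \<partial>M) \<le> exp (- s * c)" .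
  have "1 - exp (- s * y) \<le> sum_tail n (real n * c - y)" for n y
  proof (induction n arbitrary: y)
    case 0
    then show ?case using s by (simp add: sum_tail_0 del: convpow.simps) (simp add: mult_nonneg_nonpos)
  next
    case (Suc n)
    have "exp (- s * (y - c)) * (\<integral>x. exp (- s * x) \<partial>M) \<le> exp (- s * (y - c)) * exp (- s * c)"
      by (intro mult_left_mono le) simp
    also have "\<dots> = exp (- s * y)" by (simp add: algebra_simps flip: exp_add)
    finally have "1 - exp (- s * y) \<le> 1 - exp (- s * (y - c)) * (\<integral>x. exp (- s * x) \<partial>M)" by simp
    also have "\<dots> = (\<integral>x. 1 - exp (- s * (y - c)) * exp (- s * x) \<partial>M)"
      using int by (simp add: prob_space[simplified])
    also have "\<dots> \<le> (\<integral>x. sum_tail n (real (Suc n) * c - y - x) \<partial>M)"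
    proof (rule integral_mono)
      show "integrable M (\<lambda>x. 1 - exp (- s * (y - c)) * exp (- s * x))"
        using int by auto
      fix x
      have "1 - exp (- s * (y - c + x)) \<le> sum_tail n (real n * c - (y - c + x))" by (rule Suc)
      then show "1 - exp (- s * (y - c)) * exp (- s * x) \<le> sum_tail n (real (Suc n) * c - y - x)"
        by (simp add: algebra_simps flip: exp_add)
    qed auto
    finally show ?case by (simp only: sum_tail_Suc)
  qed
  then show ?thesis using s by blast
qed

end

section \<open>The branching fixed-point map\<close>

locale branching = prob_space P for P :: "(real \<times> nat) measure" +
  assumes sets_P [measurable_cong]: "sets P = sets (borel \<Otimes>\<^sub>M (count_space UNIV :: nat measure))"
    and Q_nonneg: "AE \<omega> in P. 0 \<le> fst \<omega>"
    and N_int: "integrable P (\<lambda>\<omega>. real (snd \<omega>))"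
    and Q_int: "integrable P fst"
begin

lemma space_P [simp]: "space P = UNIV"
  using sets_eq_imp_space_eq[OF sets_P] by (simp add: space_pair_measure)

lemma measurable_Q [measurable]: "fst \<in> borel_measurable P"
  and measurable_N [measurable]: "snd \<in> P \<rightarrow>\<^sub>M count_space UNIV"
  by measurable

abbreviation qbar :: real where "qbar \<equiv> (\<integral>\<omega>. fst \<omega> \<partial>P)"
abbreviation nbar :: real where "nbar \<equiv> (\<integral>\<omega>. real (snd \<omega>) \<partial>P)"

lemma qbar_nonneg: "0 \<le> qbar"
  using Q_nonneg by (rule integral_nonneg_AE)

lemma nbar_nonneg: "0 \<le> nbar"
  by simp

abbreviation kernel :: "real measure \<Rightarrow> real \<times> nat \<Rightarrow> real measure" where
  "kernel \<mu> \<omega> \<equiv> distr (convpow \<mu> (snd \<omega>)) borel (\<lambda>x. fst \<omega> + x)"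

lemma prob_space_kernel:
  assumes "nonneg_law \<mu>"
  shows "prob_space (kernel \<mu> \<omega>)"
proof -
  interpret mu: nonneg_law \<mu> by fact
  show ?thesis
    by (intro prob_space.prob_space_distr mu.prob_space_convpow)
       (use mu.sets_convpow in \<open>simp cong: measurable_cong_sets\<close>)
qed

text \<open>For fixed n, the measure of a section of a product set depends measurably on the shift;
  the countably many values of \<open>N\<close> are then glued together.\<close>

lemma kernel_measurable:
  assumes "nonneg_law \<mu>"
  shows "kernel \<mu> \<in> P \<rightarrow>\<^sub>M prob_algebra borel"
proof (rule measurable_prob_algebraI)
  interpret mu: nonneg_law \<mu> by fact
  show "prob_space (kernel \<mu> \<omega>)" for \<omega> by (rule prob_space_kernel[OF assms])
  then have sub: "subprob_space (kernel \<mu> \<omega>)" for \<omega>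
    by (intro prob_space_imp_subprob_space)
  show "kernel \<mu> \<in> P \<rightarrow>\<^sub>M subprob_algebra borel"
  proof (rule measurable_subprob_algebra)
    fix A :: "real set" assume [measurable]: "A \<in> sets borel"
    have g: "(\<lambda>q. emeasure (convpow \<mu> n) {x. q + x \<in> A}) \<in> borel_measurable borel" for n
    proof -
      interpret C: real_distribution "convpow \<mu> n" by (rule mu.real_distribution_convpow)
      have "{z :: real \<times> real. fst z + snd z \<in> A} \<in> sets (borel \<Otimes>\<^sub>M convpow \<mu> n)"
      proof -
        have "{z \<in> space (borel \<Otimes>\<^sub>M convpow \<mu> n). fst z + snd z \<in> A} \<in> sets (borel \<Otimes>\<^sub>M convpow \<mu> n)"
          by measurable
        then show ?thesis by (simp add: space_pair_measure)
      qed
      from C.measurable_emeasure_Pair[OF this] show ?thesis by (simp add: vimage_def)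
    qed
    have eq: "emeasure (kernel \<mu> \<omega>) A = emeasure (convpow \<mu> (snd \<omega>)) {x. fst \<omega> + x \<in> A}" for \<omega>
      by (subst emeasure_distr)
         (use mu.sets_convpow mu.space_convpow in \<open>auto cong: measurable_cong_sets simp: vimage_def\<close>)
    show "(\<lambda>\<omega>. emeasure (kernel \<mu> \<omega>) A) \<in> borel_measurable P"
      unfolding eq
      by (rule measurable_compose_countable[where f = "\<lambda>n \<omega>. emeasure (convpow \<mu> n) {x. fst \<omega> + x \<in> A}" and g = snd])
         (auto intro: measurable_compose[OF measurable_Q g])
  qed (use sub in auto)
qed

lemma kernel_measurable' [measurable]:
  "nonneg_law \<mu> \<Longrightarrow> kernel \<mu> \<in> P \<rightarrow>\<^sub>M subprob_algebra borel"
  by (rule measurable_prob_algebraD[OF kernel_measurable])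

lemma sets_fixmap [simp]: "nonneg_law \<mu> \<Longrightarrow> sets (fixmap P \<mu>) = sets borel"
  unfolding fixmap_def by (subst sets_bind[where N = borel]) auto

lemma nn_integral_fixmap:
  assumes "nonneg_law \<mu>" and [measurable]: "f \<in> borel_measurable borel"
  shows "(\<integral>\<^sup>+x. f x \<partial>fixmap P \<mu>) = (\<integral>\<^sup>+\<omega>. \<integral>\<^sup>+x. f (fst \<omega> + x) \<partial>convpow \<mu> (snd \<omega>) \<partial>P)"
proof -
  interpret mu: nonneg_law \<mu> by fact
  have "(\<integral>\<^sup>+x. f x \<partial>fixmap P \<mu>) = (\<integral>\<^sup>+\<omega>. \<integral>\<^sup>+x. f x \<partial>kernel \<mu> \<omega> \<partial>P)"
    unfolding fixmap_def by (rule nn_integral_bind[OF assms(2) kernel_measurable'[OF assms(1)]])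
  also have "\<dots> = (\<integral>\<^sup>+\<omega>. \<integral>\<^sup>+x. f (fst \<omega> + x) \<partial>convpow \<mu> (snd \<omega>) \<partial>P)"
    by (intro nn_integral_cong nn_integral_distr)
       (use mu.sets_convpow in \<open>auto cong: measurable_cong_sets\<close>)
  finally show ?thesis .
qed

lemma prob_space_fixmap:
  assumes "nonneg_law \<mu>"
  shows "prob_space (fixmap P \<mu>)"
  unfolding fixmap_def
  by (rule prob_space_bind[OF AE_I2 kernel_measurable'[OF assms]]) (rule prob_space_kernel[OF assms])

text \<open>Stated with the non-negative integral, since it is this computation that shows the image
  law to have a finite mean.\<close>

lemma nn_integral_fixmap_id:
  assumes "nonneg_law \<mu>"
  shows "(\<integral>\<^sup>+x. ennreal x \<partial>fixmap P \<mu>) = ennreal (qbar + nbar * (\<integral>x. x \<partial>\<mu>))"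
proof -
  interpret mu: nonneg_law \<mu> by fact
  have r: "(\<integral>\<^sup>+x. ennreal x \<partial>\<mu>) = ennreal mu.r"
    by (rule nn_integral_eq_integral[OF mu.integrable_id mu.nonneg])
  have "(\<integral>\<^sup>+x. ennreal x \<partial>fixmap P \<mu>) = (\<integral>\<^sup>+\<omega>. \<integral>\<^sup>+x. ennreal (fst \<omega> + x) \<partial>convpow \<mu> (snd \<omega>) \<partial>P)"
    by (rule nn_integral_fixmap[OF assms]) simp
  also have "\<dots> = (\<integral>\<^sup>+\<omega>. ennreal (fst \<omega> + real (snd \<omega>) * mu.r) \<partial>P)"
  proof (rule nn_integral_cong_AE, use Q_nonneg in eventually_elim)
    case (elim \<omega>)
    interpret C: real_distribution "convpow \<mu> (snd \<omega>)" by (rule mu.real_distribution_convpow)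
    have "(\<integral>\<^sup>+x. ennreal (fst \<omega> + x) \<partial>convpow \<mu> (snd \<omega>))
        = (\<integral>\<^sup>+x. ennreal (fst \<omega>) + ennreal x \<partial>convpow \<mu> (snd \<omega>))"
      by (rule nn_integral_cong_AE, use mu.AE_convpow_nonneg[of "snd \<omega>"] in eventually_elim)
         (use elim in simp)
    also have "\<dots> = ennreal (fst \<omega>) + of_nat (snd \<omega>) * ennreal mu.r"
      by (subst nn_integral_add) (auto simp: C.emeasure_space_1[simplified] mu.nn_integral_convpow_id r)
    finally show ?case using elim mu.r_nonneg by (simp add: ennreal_mult flip: ennreal_of_nat_eq_real_of_nat)
  qed
  also have "\<dots> = ennreal (\<integral>\<omega>. fst \<omega> + real (snd \<omega>) * mu.r \<partial>P)"
    by (rule nn_integral_eq_integral)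
       (use N_int Q_int Q_nonneg mu.r_nonneg in \<open>auto elim!: eventually_mono\<close>)
  also have "(\<integral>\<omega>. fst \<omega> + real (snd \<omega>) * mu.r \<partial>P) = qbar + nbar * mu.r"
    using N_int Q_int by simp
  finally show ?thesis .
qed

lemma nonneg_law_fixmap:
  assumes "nonneg_law \<mu>"
  shows "nonneg_law (fixmap P \<mu>)" and "(\<integral>x. x \<partial>fixmap P \<mu>) = qbar + nbar * (\<integral>x. x \<partial>\<mu>)"
proof -
  interpret mu: nonneg_law \<mu> by fact
  interpret F: prob_space "fixmap P \<mu>" by (rule prob_space_fixmap[OF assms])
  have [measurable_cong]: "sets (fixmap P \<mu>) = sets borel" using assms by simp
  have nn: "AE x in fixmap P \<mu>. 0 \<le> x"
  proof -
    have "(AE x in P \<bind> kernel \<mu>. 0 \<le> x) \<longleftrightarrow> (AE \<omega> in P. AE x in kernel \<mu> \<omega>. 0 \<le> x)"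
      by (rule AE_bind[OF kernel_measurable'[OF assms]]) measurable
    moreover have "AE \<omega> in P. AE x in kernel \<mu> \<omega>. 0 \<le> x"
      using Q_nonneg
    proof eventually_elim
      case (elim \<omega>)
      have "AE x in convpow \<mu> (snd \<omega>). 0 \<le> fst \<omega> + x"
        using mu.AE_convpow_nonneg[of "snd \<omega>"] by eventually_elim (use elim in simp)
      then show ?case
        by (subst AE_distr_iff) (use mu.sets_convpow in \<open>auto cong: measurable_cong_sets\<close>)
    qed
    ultimately show ?thesis unfolding fixmap_def by blast
  qed
  have int: "integrable (fixmap P \<mu>) (\<lambda>x. x)"
    using nn nn_integral_fixmap_id[OF assms] by (intro integrableI_nonneg) auto
  show "nonneg_law (fixmap P \<mu>)"
    using nn int F.prob_space_axioms assms sets_eq_imp_space_eq[of "fixmap P \<mu>" borel]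
    by (simp add: nonneg_law_def nonneg_law_axioms_def real_distribution_def real_distribution_axioms_def)
  show "(\<integral>x. x \<partial>fixmap P \<mu>) = qbar + nbar * mu.r"
  proof -
    have "ennreal (\<integral>x. x \<partial>fixmap P \<mu>) = ennreal (qbar + nbar * mu.r)"
      using nn_integral_eq_integral[OF int nn] nn_integral_fixmap_id[OF assms] by simp
    moreover have "0 \<le> qbar + nbar * mu.r"
      by (intro add_nonneg_nonneg mult_nonneg_nonneg qbar_nonneg nbar_nonneg mu.r_nonneg)
    ultimately show ?thesis using integral_nonneg_AE[OF nn] by (subst (asm) ennreal_inj)
  qed
qed

lemma tail_fixmap:
  assumes "nonneg_law \<mu>"
  shows "tail (fixmap P \<mu>) z = (\<integral>\<omega>. tail (convpow \<mu> (snd \<omega>)) (z - fst \<omega>) \<partial>P)"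
    and "(\<lambda>\<omega>. tail (convpow \<mu> (snd \<omega>)) (z - fst \<omega>)) \<in> borel_measurable P"
proof -
  interpret mu: nonneg_law \<mu> by fact
  interpret F: prob_space "fixmap P \<mu>" by (rule prob_space_fixmap[OF assms])
  show meas: "(\<lambda>\<omega>. tail (convpow \<mu> (snd \<omega>)) (z - fst \<omega>)) \<in> borel_measurable P"
    by (rule measurable_compose_countable[where f = "\<lambda>n \<omega>. mu.sum_tail n (z - fst \<omega>)" and g = snd]) measurable
  have "ennreal (tail (fixmap P \<mu>) z) = (\<integral>\<^sup>+x. indicator {z<..} x \<partial>fixmap P \<mu>)"
    using assms by (subst nn_integral_indicator) (simp_all add: tail_def F.emeasure_eq_measure)
  also have "\<dots> = (\<integral>\<^sup>+\<omega>. \<integral>\<^sup>+x. indicator {z<..} (fst \<omega> + x) \<partial>convpow \<mu> (snd \<omega>) \<partial>P)"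
    by (rule nn_integral_fixmap[OF assms]) simp
  also have "\<dots> = (\<integral>\<^sup>+\<omega>. ennreal (mu.sum_tail (snd \<omega>) (z - fst \<omega>)) \<partial>P)"
  proof (rule nn_integral_cong)
    fix \<omega> :: "real \<times> nat"
    interpret C: real_distribution "convpow \<mu> (snd \<omega>)" by (rule mu.real_distribution_convpow)
    have "(\<integral>\<^sup>+x. indicator {z<..} (fst \<omega> + x) \<partial>convpow \<mu> (snd \<omega>))
        = (\<integral>\<^sup>+x. indicator {z - fst \<omega><..} x \<partial>convpow \<mu> (snd \<omega>))"
      by (rule nn_integral_cong) (auto simp: indicator_def)
    then show "(\<integral>\<^sup>+x. indicator {z<..} (fst \<omega> + x) \<partial>convpow \<mu> (snd \<omega>)) = ennreal (mu.sum_tail (snd \<omega>) (z - fst \<omega>))"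
      by (simp add: tail_def C.emeasure_eq_measure)
  qed
  also have "\<dots> = ennreal (\<integral>\<omega>. mu.sum_tail (snd \<omega>) (z - fst \<omega>) \<partial>P)"
    by (rule nn_integral_eq_integral[OF integrable_const_bound[where B = 1]])
       (use meas mu.sum_tail_bounds in \<open>auto\<close>)
  finally show "tail (fixmap P \<mu>) z = (\<integral>\<omega>. tail (convpow \<mu> (snd \<omega>)) (z - fst \<omega>) \<partial>P)"
    by (simp add: tail_def Bochner_Integration.integral_nonneg)
qed

lemma char_fixmap:
  assumes "nonneg_law \<mu>"
  shows "char (fixmap P \<mu>) t = (CLINT \<omega>|P. iexp (t * fst \<omega>) * char \<mu> t ^ snd \<omega>)"
proof -
  interpret mu: nonneg_law \<mu> by fact
  interpret F: nonneg_law "fixmap P \<mu>" by (rule nonneg_law_fixmap[OF assms])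
  have ker: "char (kernel \<mu> \<omega>) t = iexp (t * fst \<omega>) * char \<mu> t ^ snd \<omega>" for \<omega>
  proof -
    have "char (kernel \<mu> \<omega>) t = (CLINT x|convpow \<mu> (snd \<omega>). iexp (t * (fst \<omega> + x)))"
      unfolding char_def
      by (subst integral_distr) (use mu.sets_convpow in \<open>auto cong: measurable_cong_sets\<close>)
    also have "\<dots> = iexp (t * fst \<omega>) * char (convpow \<mu> (snd \<omega>)) t"
      by (simp add: char_def distrib_left exp_add flip: of_real_mult)
    finally show ?thesis by (simp add: mu.char_convpow)
  qed
  have ker': "(CLINT x|kernel \<mu> \<omega>. iexp (t * x)) = iexp (t * fst \<omega>) * char \<mu> t ^ snd \<omega>" for \<omega>
    using ker[of \<omega>] unfolding char_def[of "kernel \<mu> \<omega>"] .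
  \<comment> \<open>The mixture formula is set up for bounded real integrands; the real and
    imaginary parts of the exponential are inserted separately.\<close>
  have bind: "(\<integral>x. f x \<partial>fixmap P \<mu>) = (\<integral>\<omega>. \<integral>x. f x \<partial>kernel \<mu> \<omega> \<partial>P)"
    if "f \<in> borel_measurable borel" "\<And>x. \<bar>f x\<bar> \<le> 1" for f :: "real \<Rightarrow> real"
    unfolding fixmap_def
    by (rule integral_bind[where K = borel and B = 1 and B' = 1, OF that kernel_measurable'[OF assms]])
       (simp_all only: finite_measure_axioms prob_space.emeasure_space_1[OF prob_space_kernel[OF assms]]
          ennreal_1 order_refl eventually_True)
  have intk: "complex_integrable (kernel \<mu> \<omega>) (\<lambda>x. iexp (t * x))" for \<omega>
    by (rule prob_space.integrable_iexp[OF prob_space_kernel[OF assms]]) auto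
  have meas: "(\<lambda>\<omega>. iexp (t * fst \<omega>) * char \<mu> t ^ snd \<omega>) \<in> borel_measurable P"
    by (rule measurable_compose_countable[where f = "\<lambda>n \<omega>. iexp (t * fst \<omega>) * char \<mu> t ^ n" and g = snd]) measurable
  have int: "complex_integrable P (\<lambda>\<omega>. iexp (t * fst \<omega>) * char \<mu> t ^ snd \<omega>)"
    by (rule integrable_const_bound[where B = 1])
       (use meas mu.cmod_char_le_1 in \<open>auto simp: norm_mult norm_power power_le_one\<close>)
  have intF: "complex_integrable (fixmap P \<mu>) (\<lambda>x. iexp (t * x))"
    by (rule F.integrable_iexp) auto
  show ?thesis
  proof (rule complex_eqI)
    have "Re (char (fixmap P \<mu>) t) = (\<integral>x. Re (iexp (t * x)) \<partial>fixmap P \<mu>)"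
      unfolding char_def by (rule integral_Re[OF intF, symmetric])
    also have "\<dots> = (\<integral>\<omega>. \<integral>x. Re (iexp (t * x)) \<partial>kernel \<mu> \<omega> \<partial>P)"
      by (rule bind) (auto simp: Re_exp)
    also have "\<dots> = (\<integral>\<omega>. Re (iexp (t * fst \<omega>) * char \<mu> t ^ snd \<omega>) \<partial>P)"
      by (intro Bochner_Integration.integral_cong refl) (simp only: integral_Re[OF intk] ker')
    also have "\<dots> = Re (CLINT \<omega>|P. iexp (t * fst \<omega>) * char \<mu> t ^ snd \<omega>)"
      by (rule integral_Re[OF int])
    finally show "Re (char (fixmap P \<mu>) t) = Re (CLINT \<omega>|P. iexp (t * fst \<omega>) * char \<mu> t ^ snd \<omega>)" .
    have "Im (char (fixmap P \<mu>) t) = (\<integral>x. Im (iexp (t * x)) \<partial>fixmap P \<mu>)"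
      unfolding char_def by (rule integral_Im[OF intF, symmetric])
    also have "\<dots> = (\<integral>\<omega>. \<integral>x. Im (iexp (t * x)) \<partial>kernel \<mu> \<omega> \<partial>P)"
      by (rule bind) (auto simp: Im_exp)
    also have "\<dots> = (\<integral>\<omega>. Im (iexp (t * fst \<omega>) * char \<mu> t ^ snd \<omega>) \<partial>P)"
      by (intro Bochner_Integration.integral_cong refl) (simp only: integral_Im[OF intk] ker')
    also have "\<dots> = Im (CLINT \<omega>|P. iexp (t * fst \<omega>) * char \<mu> t ^ snd \<omega>)"
      by (rule integral_Im[OF int])
    finally show "Im (char (fixmap P \<mu>) t) = Im (CLINT \<omega>|P. iexp (t * fst \<omega>) * char \<mu> t ^ snd \<omega>)" .
  qed
qed

end

section \<open>Existence and uniqueness\<close>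

lemma nonneg_law_return_0: "nonneg_law (return borel 0)"
proof (intro nonneg_law.intro real_distribution.intro nonneg_law_axioms.intro real_distribution_axioms.intro)
  show "prob_space (return borel (0 :: real))" by (rule prob_space_return) simp
  show "AE x in return borel (0 :: real). 0 \<le> x" by (subst AE_return) auto
  have "(\<integral>\<^sup>+x. ennreal (norm x) \<partial>return borel (0 :: real)) = ennreal (norm (0 :: real))"
    by (rule nn_integral_return) simp_all
  then show "integrable (return borel (0 :: real)) (\<lambda>x. x)"
    by (intro integrableI_bounded) (simp_all only: measurable_return1 measurable_ident_sets[OF refl] norm_zero ennreal_0 ennreal_zero_less_top infinity_ennreal_def)
qed simp_all

locale subcritical_branching = branching +
  assumes N_mean: "nbar < 1"
begin

definition rbar :: real where "rbar = qbar / (1 - nbar)"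

lemma rbar_nonneg: "0 \<le> rbar"
  using N_mean qbar_nonneg by (simp add: rbar_def)

lemma rbar_eq: "rbar = qbar + nbar * rbar"
  using N_mean by (simp add: rbar_def field_simps)

lemma fp_solution_nonneg_law: "fp_solution P \<mu> \<Longrightarrow> nonneg_law \<mu>"
  using sets_eq_imp_space_eq[of \<mu> borel]
  by (auto simp: fp_solution_def nonneg_law_def nonneg_law_axioms_def real_distribution_def real_distribution_axioms_def)

lemma fp_solution_iff: "fp_solution P \<mu> \<longleftrightarrow> nonneg_law \<mu> \<and> fixmap P \<mu> = \<mu>"
proof
  assume "nonneg_law \<mu> \<and> fixmap P \<mu> = \<mu>"
  then interpret mu: nonneg_law \<mu> by blast
  show "fp_solution P \<mu>"
    using \<open>nonneg_law \<mu> \<and> fixmap P \<mu> = \<mu>\<close> mu.prob_space_axioms mu.nonneg mu.integrable_id by (simp add: fp_solution_def)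
qed (use fp_solution_nonneg_law in \<open>auto simp: fp_solution_def\<close>)

lemma fp_solution_mean:
  assumes "fp_solution P \<mu>"
  shows "(\<integral>x. x \<partial>\<mu>) = rbar"
proof -
  have "nonneg_law \<mu>" "fixmap P \<mu> = \<mu>" using assms by (auto simp: fp_solution_iff)
  then have "(\<integral>x. x \<partial>\<mu>) = qbar + nbar * (\<integral>x. x \<partial>\<mu>)" using nonneg_law_fixmap(2)[of \<mu>] by simp
  then show ?thesis using N_mean by (simp add: rbar_def field_simps)
qed

lemma measurable_iexp_power:
  "(\<lambda>\<omega>. iexp (t * fst \<omega>) * (z :: complex) ^ snd \<omega>) \<in> borel_measurable P"
  by (rule measurable_compose_countable[where f = "\<lambda>n \<omega>. iexp (t * fst \<omega>) * z ^ n" and g = snd]) measurable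

lemma char_fixmap_contraction:
  assumes "nonneg_law \<mu>" "nonneg_law \<nu>"
  shows "norm (char (fixmap P \<mu>) t - char (fixmap P \<nu>) t) \<le> nbar * norm (char \<mu> t - char \<nu> t)"
proof -
  interpret mu: nonneg_law \<mu> by fact
  interpret nu: nonneg_law \<nu> by fact
  have int: "complex_integrable P (\<lambda>\<omega>. iexp (t * fst \<omega>) * z ^ snd \<omega>)" if "norm z \<le> 1" for z :: complex
    by (rule integrable_const_bound[where B = 1])
       (use that measurable_iexp_power in \<open>auto simp: norm_mult norm_power power_le_one\<close>)
  note int' = int[OF mu.cmod_char_le_1[of t]] int[OF nu.cmod_char_le_1[of t]]
  have "norm (char (fixmap P \<mu>) t - char (fixmap P \<nu>) t)
      = norm (CLINT \<omega>|P. iexp (t * fst \<omega>) * char \<mu> t ^ snd \<omega> - iexp (t * fst \<omega>) * char \<nu> t ^ snd \<omega>)"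
    unfolding char_fixmap[OF assms(1)] char_fixmap[OF assms(2)]
    by (subst Bochner_Integration.integral_diff[OF int']) simp
  also have "\<dots> \<le> (\<integral>\<omega>. norm (iexp (t * fst \<omega>) * char \<mu> t ^ snd \<omega> - iexp (t * fst \<omega>) * char \<nu> t ^ snd \<omega>) \<partial>P)"
    by (rule integral_norm_bound)
  also have "\<dots> \<le> (\<integral>\<omega>. real (snd \<omega>) * norm (char \<mu> t - char \<nu> t) \<partial>P)"
  proof (rule integral_mono)
    show "integrable P (\<lambda>\<omega>. norm (iexp (t * fst \<omega>) * char \<mu> t ^ snd \<omega> - iexp (t * fst \<omega>) * char \<nu> t ^ snd \<omega>))"
      by (intro integrable_norm Bochner_Integration.integrable_diff int')
    show "integrable P (\<lambda>\<omega>. real (snd \<omega>) * norm (char \<mu> t - char \<nu> t))" using N_int by simp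
    fix \<omega> :: "real \<times> nat"
    have "norm (char \<mu> t ^ snd \<omega> - char \<nu> t ^ snd \<omega>) \<le> real (snd \<omega>) * norm (char \<mu> t - char \<nu> t)"
      by (rule norm_power_diff[OF mu.cmod_char_le_1 nu.cmod_char_le_1])
    then show "norm (iexp (t * fst \<omega>) * char \<mu> t ^ snd \<omega> - iexp (t * fst \<omega>) * char \<nu> t ^ snd \<omega>)
        \<le> real (snd \<omega>) * norm (char \<mu> t - char \<nu> t)"
      by (simp add: norm_mult flip: right_diff_distrib)
  qed
  finally show ?thesis by simp
qed

lemma fp_solution_unique:
  assumes "fp_solution P \<mu>" "fp_solution P \<nu>"
  shows "\<mu> = \<nu>"
proof (rule Levy_uniqueness)
  have nl: "nonneg_law \<mu>" "nonneg_law \<nu>" using assms by (auto simp: fp_solution_iff)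
  then show "real_distribution \<mu>" "real_distribution \<nu>" by (auto simp: nonneg_law_def)
  show "char \<mu> = char \<nu>"
  proof
    fix t
    have "norm (char \<mu> t - char \<nu> t) \<le> nbar * norm (char \<mu> t - char \<nu> t)"
      using char_fixmap_contraction[OF nl, of t] assms by (simp add: fp_solution_iff)
    then have "norm (char \<mu> t - char \<nu> t) * (1 - nbar) \<le> 0" by (simp add: algebra_simps)
    then show "char \<mu> t = char \<nu> t" using N_mean by (simp add: mult_le_0_iff)
  qed
qed

section \<open>Existence through a weak limit of iterates\<close>

definition iter :: "nat \<Rightarrow> real measure" where
  "iter k = (fixmap P ^^ k) (return borel 0)"

lemma iter_Suc: "iter (Suc k) = fixmap P (iter k)"
  by (simp add: iter_def)

lemma nonneg_law_iter: "nonneg_law (iter k)"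
  by (induction k) (simp_all add: iter_def nonneg_law_return_0 nonneg_law_fixmap(1))

lemma iter_mean: "(\<integral>x. x \<partial>iter k) \<le> rbar"
proof (induction k)
  case 0
  then show ?case using rbar_nonneg by (simp add: iter_def integral_return)
next
  case (Suc k)
  have "(\<integral>x. x \<partial>iter (Suc k)) = qbar + nbar * (\<integral>x. x \<partial>iter k)"
    unfolding iter_Suc by (rule nonneg_law_fixmap(2)[OF nonneg_law_iter])
  also have "\<dots> \<le> qbar + nbar * rbar"
    using Suc by (intro add_left_mono mult_left_mono) auto
  finally show ?case by (simp flip: rbar_eq)
qed

text \<open>Tightness yields only a subsequential limit. Geometric decay of consecutive differences
  makes the subsequence shifted by one step converge to the same limit, which forces it to be a
  fixed point.\<close>

lemma iter_char_diff: "(\<lambda>k. char (iter (Suc k)) t - char (iter k) t) \<longlonglongrightarrow> 0"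
proof -
  define a where "a = norm (char (iter 1) t - char (iter 0) t)"
  have bound: "norm (char (iter (Suc k)) t - char (iter k) t) \<le> nbar ^ k * a" for k
  proof (induction k)
    case (Suc k)
    have "norm (char (iter (Suc (Suc k))) t - char (iter (Suc k)) t)
        \<le> nbar * norm (char (iter (Suc k)) t - char (iter k) t)"
      using char_fixmap_contraction[OF nonneg_law_iter[of "Suc k"] nonneg_law_iter[of k], of t] by (simp only: iter_Suc)
    also have "\<dots> \<le> nbar * (nbar ^ k * a)" by (intro mult_left_mono Suc) auto
    finally show ?case by simp
  qed (simp add: a_def)
  have "(\<lambda>k. nbar ^ k * a) \<longlonglongrightarrow> 0"
    using N_mean by (intro tendsto_mult_left_zero LIMSEQ_power_zero) simp
  then show ?thesis by (rule Lim_null_comparison[rotated]) (use bound in auto)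
qed

lemma tight_iter: "tight iter"
  unfolding tight_def
proof (intro conjI allI impI)
  fix n show "real_distribution (iter n)" using nonneg_law_iter[of n] by (simp add: nonneg_law_def)
next
  fix e :: real assume e: "0 < e"
  \<comment> \<open>Markov's inequality gives rbar/b < e; the summand 1 makes this strict and
    \<open>b\<close> positive even if \<open>rbar\<close> is 0. The left endpoint -1 below is needed
    because the half-open interval has to contain the point 0.\<close>
  define b where "b = (rbar + 1) / e"
  have b: "0 < b" using e rbar_nonneg by (simp add: b_def)
  have "1 - e < measure (iter n) {-1<..b}" for n
  proof -
    interpret I: nonneg_law "iter n" by (rule nonneg_law_iter)
    have "measure (iter n) {x \<in> space (iter n). b \<le> x} \<le> (\<integral>x. x \<partial>iter n) / b"
      by (rule integral_Markov_inequality_measure[where A = UNIV])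
         (use I.nonneg I.integrable_id b in auto)
    also have "\<dots> \<le> rbar / b" using iter_mean b by (intro divide_right_mono) auto
    also have "\<dots> < e" using e rbar_nonneg by (simp add: b_def divide_less_eq)
    finally have "measure (iter n) {x. b \<le> x} < e" by simp
    moreover have "1 - measure (iter n) {x. b \<le> x} \<le> measure (iter n) {-1<..b}"
    proof -
      have "1 - measure (iter n) {x. b \<le> x} = measure (iter n) (UNIV - {x. b \<le> x})"
        using I.prob_compl[of "{x. b \<le> x}"] by simp
      also have "\<dots> \<le> measure (iter n) {-1<..b}"
        by (rule I.finite_measure_mono_AE) (use I.nonneg in \<open>auto elim!: eventually_mono\<close>)
      finally show ?thesis .
    qed
    ultimately show ?thesis by simp
  qed
  then show "\<exists>a b. a < b \<and> (\<forall>n. 1 - e < measure (iter n) {a<..b})"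
    using b by (intro exI[of _ "-1"] exI[of _ b]) auto
qed

text \<open>A weak limit need not inherit support or moments by itself, so both are transferred
  through bounded continuous test functions before the fixed-point equation is addressed.\<close>

lemma fp_solution_exists: "\<exists>\<mu>. fp_solution P \<mu>"
proof -
  obtain s M where s: "strict_mono (s :: nat \<Rightarrow> nat)" and "real_distribution M"
    and wc: "weak_conv_m (iter \<circ> id \<circ> s) M"
    using tight_imp_convergent_subsubsequence[OF tight_iter strict_mono_id] by blast
  interpret M: real_distribution M by fact
  have rd: "real_distribution ((iter \<circ> id \<circ> s) k)" for k
    using nonneg_law_iter by (simp add: nonneg_law_def)
  have conv: "(\<lambda>k. \<integral>x. f x \<partial>iter (s k)) \<longlonglongrightarrow> (\<integral>x. f x \<partial>M)"
    if "\<And>x. isCont f x" "\<And>x. norm (f x) \<le> B" for f :: "real \<Rightarrow> real" and B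
    using weak_conv_imp_integral_bdd_continuous_conv[OF rd M.real_distribution_axioms wc that] by simp
  have "nonneg_law M"
  proof
    \<comment> \<open>A bounded continuous function that vanishes exactly on the non-negative
      half-line: its zero mean carries the support condition to the limit.\<close>
    define f :: "real \<Rightarrow> real" where "f x = max 0 (min 1 (- x))" for x
    have f: "isCont f x" "norm (f x) \<le> 1" for x unfolding f_def by (auto intro!: continuous_intros)
    have [measurable]: "f \<in> borel_measurable borel" unfolding f_def by measurable
    have "(\<integral>x. f x \<partial>iter (s k)) = 0" for k
    proof -
      interpret I: nonneg_law "iter (s k)" by (rule nonneg_law_iter)
      have "(\<integral>x. f x \<partial>iter (s k)) = (\<integral>x. 0 \<partial>iter (s k))"
        by (rule integral_cong_AE) (use I.nonneg in \<open>auto simp: f_def elim!: eventually_mono\<close>)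
      then show ?thesis by simp
    qed
    then have "(\<lambda>k :: nat. 0) \<longlonglongrightarrow> (\<integral>x. f x \<partial>M)" using conv[OF f] by simp
    then have "(\<integral>x. f x \<partial>M) = 0" by (simp add: LIMSEQ_const_iff)
    moreover have "integrable M f" by (rule M.integrable_const_bound[where B = 1]) (use f in auto)
    ultimately have "AE x in M. f x = 0"
      by (subst (asm) integral_nonneg_eq_0_iff_AE) (auto simp: f_def)
    then show nn: "AE x in M. 0 \<le> x" by eventually_elim (auto simp: f_def max_def min_def split: if_splits)
    \<comment> \<open>Bounded truncations of the absolute value have means at most
      \<open>rbar\<close> in the limit; Fatou's lemma removes the truncation.\<close>
    define g :: "nat \<Rightarrow> real \<Rightarrow> real" where "g n x = min \<bar>x\<bar> (real n)" for n x
    have g: "isCont (g n) x" "norm (g n x) \<le> real n" for n x unfolding g_def by (auto intro!: continuous_intros)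
    have [measurable]: "g n \<in> borel_measurable borel" for n unfolding g_def by measurable
    have gM: "(\<integral>x. g n x \<partial>M) \<le> rbar" for n
    proof (rule LIMSEQ_le_const2[OF conv[OF g]])
      have "(\<integral>x. g n x \<partial>iter (s k)) \<le> rbar" for k
      proof -
        interpret I: nonneg_law "iter (s k)" by (rule nonneg_law_iter)
        have "(\<integral>x. g n x \<partial>iter (s k)) \<le> (\<integral>x. x \<partial>iter (s k))"
        proof (rule integral_mono_AE)
          show "integrable (iter (s k)) (g n)"
            by (rule I.integrable_const_bound[where B = "real n"]) (use g in auto)
          show "AE x in iter (s k). g n x \<le> x" using I.nonneg by eventually_elim (auto simp: g_def)
        qed (rule I.integrable_id)
        then show ?thesis using iter_mean[of "s k"] by simp
      qed
      then show "\<exists>N. \<forall>k\<ge>N. (\<integral>x. g n x \<partial>iter (s k)) \<le> rbar" by blast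
    qed
    have "(\<integral>\<^sup>+x. ennreal (norm x) \<partial>M) = (\<integral>\<^sup>+x. liminf (\<lambda>n. ennreal (g n x)) \<partial>M)"
    proof (rule nn_integral_cong)
      fix x
      have "(\<lambda>n. g n x) \<longlonglongrightarrow> \<bar>x\<bar>"
      proof (rule tendsto_eventually)
        obtain N where "\<bar>x\<bar> \<le> real N" using real_arch_simple by blast
        then show "\<forall>\<^sub>F n in sequentially. g n x = \<bar>x\<bar>"
          by (intro eventually_sequentiallyI[of N]) (auto simp: g_def min_def)
      qed
      then have "(\<lambda>n. ennreal (g n x)) \<longlonglongrightarrow> ennreal \<bar>x\<bar>" by (intro tendsto_ennrealI)
      then show "ennreal (norm x) = liminf (\<lambda>n. ennreal (g n x))" by (simp add: lim_imp_Liminf)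
    qed
    also have "\<dots> \<le> liminf (\<lambda>n. \<integral>\<^sup>+x. ennreal (g n x) \<partial>M)"
      by (rule nn_integral_liminf) simp
    also have "\<dots> \<le> liminf (\<lambda>n :: nat. ennreal rbar)"
    proof (intro Liminf_mono always_eventually allI)
      fix n
      have "(\<integral>\<^sup>+x. ennreal (g n x) \<partial>M) = ennreal (\<integral>x. g n x \<partial>M)"
        by (intro nn_integral_eq_integral M.integrable_const_bound[where B = "real n"])
           (use g in \<open>auto simp: g_def\<close>)
      then show "(\<integral>\<^sup>+x. ennreal (g n x) \<partial>M) \<le> ennreal rbar" using gM by (simp add: ennreal_leI)
    qed
    also have "\<dots> < \<infinity>" by (simp add: Liminf_const)
    finally show "integrable M (\<lambda>x. x)" by (intro integrableI_bounded) auto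
  qed
  then interpret M: nonneg_law M .
  have "fixmap P M = M"
  proof (rule Levy_uniqueness)
    show "real_distribution M" by fact
    show "real_distribution (fixmap P M)"
      using nonneg_law_fixmap(1)[OF \<open>nonneg_law M\<close>] by (simp add: nonneg_law_def)
    show "char (fixmap P M) = char M"
    proof
      fix t
      have c: "(\<lambda>k. char (iter (s k)) t) \<longlonglongrightarrow> char M t"
        using levy_continuity1[OF rd M.real_distribution_axioms wc] by simp
      have "(\<lambda>k. char (iter (Suc (s k))) t - char (iter (s k)) t) \<longlonglongrightarrow> 0"
        using LIMSEQ_subseq_LIMSEQ[OF iter_char_diff s] by (simp add: o_def)
      from tendsto_add[OF this c] have "(\<lambda>k. char (iter (Suc (s k))) t) \<longlonglongrightarrow> char M t" by simp
      moreover have "(\<lambda>k. char (iter (Suc (s k))) t) \<longlonglongrightarrow> char (fixmap P M) t"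
      proof -
        \<comment> \<open>The contraction estimate doubles as continuity of \<open>fixmap\<close>
          along the subsequence.\<close>
        have "norm (char (iter (Suc (s k))) t - char (fixmap P M) t) \<le> nbar * norm (char (iter (s k)) t - char M t)" for k
          unfolding iter_Suc by (rule char_fixmap_contraction[OF nonneg_law_iter \<open>nonneg_law M\<close>])
        moreover have "(\<lambda>k. nbar * norm (char (iter (s k)) t - char M t)) \<longlonglongrightarrow> nbar * norm (char M t - char M t)"
          by (intro tendsto_intros c)
        ultimately have "(\<lambda>k. char (iter (Suc (s k))) t - char (fixmap P M) t) \<longlonglongrightarrow> 0"
          by (intro Lim_null_comparison[of "\<lambda>k. char (iter (Suc (s k))) t - char (fixmap P M) t"]) auto
        then show ?thesis by (simp add: LIM_zero_iff)
      qed
      ultimately show "char (fixmap P M) t = char M t" by (rule LIMSEQ_unique[symmetric])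
    qed
  qed
  then show ?thesis using \<open>nonneg_law M\<close> by (auto simp: fp_solution_iff)
qed

end

section \<open>Intermediate regular variation\<close>

text \<open>A quotient-free form of \<open>IRV\<close>. One \<open>a\<close> for each
  \<open>e\<close> is enough, because for antitone \<open>W\<close> every larger \<open>a\<close>
  below 1 works as well.\<close>

definition irv_fun :: "(real \<Rightarrow> real) \<Rightarrow> bool" where
  "irv_fun W \<longleftrightarrow> antimono W \<and> (\<forall>x. 0 < W x) \<and>
     (\<forall>e>0. \<exists>a. 0 < a \<and> a < 1 \<and> (\<forall>\<^sub>F x in at_top. W (a * x) \<le> (1 + e) * W x))"

lemma tail_antimono:
  assumes "finite_measure F" "sets F = sets borel"
  shows "antimono (tail F)"
  using assms unfolding tail_def by (intro antimonoI finite_measure.finite_measure_mono) auto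

lemma IRV_iff_irv_fun:
  assumes F: "finite_measure F" "sets F = sets borel"
  shows "IRV F \<longleftrightarrow> irv_fun (tail F)"
proof
  let ?L = "\<lambda>a. Limsup at_top (\<lambda>x. ereal (tail F (a * x) / tail F x))"
  note am = tail_antimono[OF F]
  {
    assume irv: "IRV F"
    then have lim: "(?L \<longlongrightarrow> ereal 1) (at_left 1)" by (simp add: IRV_def)
    have nn: "0 \<le> tail F x" for x by (simp add: tail_def)
    \<comment> \<open>A vanishing tail would make the quotients 0, by the convention for division by
      zero, so their upper limit could not approach 1.\<close>
    have pos: "0 < tail F x0" for x0
    proof (rule ccontr)
      assume "\<not> 0 < tail F x0"
      then have z: "tail F x = 0" if "x0 \<le> x" for x
        using antimonoD[OF am that] nn[of x] nn[of x0] by linarith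
      have "?L a = 0" for a
      proof -
        have "?L a = Limsup at_top (\<lambda>x :: real. 0)"
          by (rule Limsup_eq, rule eventually_at_top_linorderI[of x0]) (simp add: z zero_ereal_def)
        then show ?thesis by (simp add: Limsup_const)
      qed
      then have "((\<lambda>_. 0) \<longlongrightarrow> ereal 1) (at_left (1 :: real))" using lim by simp
      then show False by (simp add: tendsto_const_iff zero_ereal_def)
    qed
    have "\<exists>a. 0 < a \<and> a < 1 \<and> (\<forall>\<^sub>F x in at_top. tail F (a * x) \<le> (1 + e) * tail F x)" if e: "0 < e" for e
    proof -
      have "\<forall>\<^sub>F a in at_left 1. ?L a < ereal (1 + e)" using lim by (rule order_tendstoD) (use e in simp)
      moreover have "\<forall>\<^sub>F a in at_left (1 :: real). a \<in> {0<..<1}" by (rule eventually_at_left_real) simp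
      ultimately have "\<forall>\<^sub>F a in at_left (1 :: real). ?L a < ereal (1 + e) \<and> a \<in> {0<..<1}" by (rule eventually_conj)
      then obtain a where a: "?L a < ereal (1 + e)" "0 < a" "a < 1"
        by (auto dest: eventually_happens)
      from Limsup_lessD[OF a(1)] have "\<forall>\<^sub>F x in at_top. tail F (a * x) \<le> (1 + e) * tail F x"
        by (rule eventually_mono) (use pos in \<open>simp add: divide_less_eq\<close>)
      then show ?thesis using a by blast
    qed
    then show "irv_fun (tail F)" using am pos by (simp add: irv_fun_def)
  }
  {
    assume irv: "irv_fun (tail F)"
    then have pos: "0 < tail F x" for x by (simp add: irv_fun_def)
    have "(?L \<longlongrightarrow> ereal 1) (at_left 1)"
    proof (rule order_tendstoI)
      fix l assume l: "l < ereal 1"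
      have "l < ?L a" if a: "0 < a" "a < 1" for a
      proof -
        have "\<forall>\<^sub>F x in at_top. ereal 1 \<le> ereal (tail F (a * x) / tail F x)"
        proof (rule eventually_at_top_linorderI[of 0])
          fix x :: real assume "0 \<le> x"
          then have "a * x \<le> x" using a by (simp add: mult_left_le_one_le)
          then show "ereal 1 \<le> ereal (tail F (a * x) / tail F x)"
            using antimonoD[OF am] pos by simp
        qed
        then have "Limsup at_top (\<lambda>x :: real. ereal 1) \<le> ?L a" by (rule Limsup_mono)
        then show ?thesis using l by (simp add: Limsup_const)
      qed
      then show "\<forall>\<^sub>F a in at_left 1. l < ?L a"
        using eventually_at_left_real[of 0 "1 :: real"] by (auto elim: eventually_mono)
    next
      fix u assume u: "ereal 1 < u"
      obtain w where w: "ereal 1 < ereal w" "ereal w < u" using ereal_dense2[OF u] by auto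
      then have "0 < w - 1" by simp
      then obtain a0 where a0: "0 < a0" "a0 < 1" "\<forall>\<^sub>F x in at_top. tail F (a0 * x) \<le> w * tail F x"
        using irv unfolding irv_fun_def by (metis add.commute diff_add_cancel)
      have "?L a < u" if a: "a0 < a" "a < 1" for a
      proof -
        have "\<forall>\<^sub>F x in at_top. ereal (tail F (a * x) / tail F x) \<le> ereal w"
          using a0(3) eventually_ge_at_top[of 0]
        proof eventually_elim
          case (elim x)
          have "tail F (a * x) \<le> tail F (a0 * x)"
            using a elim by (intro antimonoD[OF am] mult_right_mono) auto
          then show ?case using elim pos by (simp add: divide_le_eq)
        qed
        then have "?L a \<le> Limsup at_top (\<lambda>x :: real. ereal w)" by (rule Limsup_mono)
        then show ?thesis using w by (simp add: Limsup_const)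
      qed
      then show "\<forall>\<^sub>F a in at_left 1. ?L a < u"
        using eventually_at_left_real[OF a0(2)] by (auto elim: eventually_mono)
    qed
    then show "IRV F" by (simp add: IRV_def)
  }
qed

lemma irv_funD:
  assumes "irv_fun W"
  shows "antimono W" "0 < W x" "0 < e \<Longrightarrow> \<exists>a. 0 < a \<and> a < 1 \<and> (\<forall>\<^sub>F x in at_top. W (a * x) \<le> (1 + e) * W x)"
  using assms by (auto simp: irv_fun_def)

text \<open>Iterating one comparison m times costs 2^m and reaches a^m, which falls below any given
  \<open>k\<close>.\<close>

lemma irv_fun_dominated:
  assumes W: "irv_fun W" and k: "0 < k"
  shows "\<exists>D>0. \<forall>\<^sub>F x in at_top. W (k * x) \<le> D * W x"
proof -
  obtain a where a: "0 < a" "a < 1" "\<forall>\<^sub>F x in at_top. W (a * x) \<le> 2 * W x"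
    using irv_funD(3)[OF W, of 1] by auto
  have pow: "\<forall>\<^sub>F x in at_top. W (a ^ m * x) \<le> 2 ^ m * W x" for m
  proof (induction m)
    case (Suc m)
    have "filterlim (\<lambda>x. a ^ m * x) at_top at_top"
      using a by (intro filterlim_mult_pos_at_top) auto
    from eventually_compose_filterlim[OF a(3) this] Suc show ?case
    proof eventually_elim
      case (elim x)
      then show ?case using irv_funD(2)[OF W] by (simp add: mult.assoc)
    qed
  qed simp
  obtain m where m: "a ^ m < k" using real_arch_pow_inv[OF k a(2)] by blast
  have "\<forall>\<^sub>F x in at_top. W (k * x) \<le> 2 ^ m * W x"
    using pow[of m] eventually_ge_at_top[of 0]
  proof eventually_elim
    case (elim x)
    have "W (k * x) \<le> W (a ^ m * x)"
      using m elim by (intro antimonoD[OF irv_funD(1)[OF W]] mult_right_mono) auto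
    then show ?case using elim by simp
  qed
  then show ?thesis by (intro exI[of _ "2 ^ m"]) simp
qed

text \<open>A single margin for all later comparisons: the first two serve the upper estimate of
  \<open>T\<close>, the third the lower one.\<close>

lemma irv_fun_eta:
  assumes W: "irv_fun W" and e: "0 < e"
  shows "\<exists>\<eta>. 0 < \<eta> \<and> \<eta> \<le> 1 / 2 \<and> (\<forall>\<^sub>F x in at_top. W ((1 - \<eta>) * x) \<le> (1 + e) * W x)
    \<and> (\<forall>\<^sub>F x in at_top. W ((1 - \<eta>)\<^sup>2 * x) \<le> (1 + e) * W x)
    \<and> (\<forall>\<^sub>F x in at_top. W x \<le> (1 + e) * W ((1 + \<eta>) / (1 - \<eta>) * x))"
proof -
  obtain a where a: "0 < a" "a < 1" "\<forall>\<^sub>F x in at_top. W (a * x) \<le> (1 + e) * W x"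
    using irv_funD(3)[OF W e] by auto
  have le: "\<forall>\<^sub>F x in at_top. W (b * x) \<le> (1 + e) * W x" if "a \<le> b" for b
    using a(3) eventually_ge_at_top[of 0]
  proof eventually_elim
    case (elim x)
    have "W (b * x) \<le> W (a * x)"
      using that elim by (intro antimonoD[OF irv_funD(1)[OF W]] mult_right_mono) auto
    then show ?case using elim by simp
  qed
  \<comment> \<open>Then a = 1 - 2\<eta> is below (1 - \<eta>)^2, and a (1 + \<eta>) <= 1 - \<eta>,
    so all three factors are controlled by the one comparison at \<open>a\<close>.\<close>
  define \<eta> where "\<eta> = (1 - a) / 2"
  have \<eta>: "0 < \<eta>" "\<eta> \<le> 1 / 2" "a = 1 - 2 * \<eta>" using a by (auto simp: \<eta>_def field_simps)
  define b where "b = (1 + \<eta>) / (1 - \<eta>)"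
  have b: "0 < b" "a * b \<le> 1"
  proof -
    have "(1 - 2 * \<eta>) * (1 + \<eta>) \<le> 1 - \<eta>" by (simp add: algebra_simps)
    then show "a * b \<le> 1" unfolding \<eta>(3) b_def using \<eta>(1,2) by (simp add: pos_divide_le_eq)
  qed (use \<eta> in \<open>auto simp: b_def\<close>)
  have "filterlim (\<lambda>x. b * x) at_top at_top"
    using b by (intro filterlim_mult_pos_at_top) auto
  from eventually_compose_filterlim[OF a(3) this] eventually_ge_at_top[of 0]
  have "\<forall>\<^sub>F x in at_top. W x \<le> (1 + e) * W (b * x)"
  proof eventually_elim
    case (elim x)
    have "W x \<le> W (a * (b * x))"
      using mult_right_mono[OF b(2) elim(2)]
      by (intro antimonoD[OF irv_funD(1)[OF W]]) (simp add: mult.assoc)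
    then show ?case using elim by simp
  qed
  moreover have "a \<le> 1 - \<eta>" "a \<le> (1 - \<eta>)\<^sup>2"
    using \<eta> by (auto simp: power2_eq_square algebra_simps)
  ultimately show ?thesis using \<eta> le unfolding b_def by blast
qed

section \<open>Tail asymptotics\<close>

text \<open>Positivity of \<open>qbar\<close> makes \<open>rbar\<close> positive, so that dividing
  or multiplying it by 1 - \<eta> yields slopes strictly above or below the mean.\<close>

locale branching_solution = subcritical_branching P + mu: nonneg_law \<mu> for P \<mu> +
  assumes fix_eq: "fixmap P \<mu> = \<mu>"
    and qbar_pos: "0 < qbar"
begin

definition V :: "real \<times> nat \<Rightarrow> real" where "V \<omega> = fst \<omega> + rbar * real (snd \<omega>)"
definition W :: "real \<Rightarrow> real" where "W x = measure P {\<omega> \<in> space P. V \<omega> > x}"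

lemma mu_mean: "mu.r = rbar"
  by (rule fp_solution_mean) (simp add: fp_solution_iff fix_eq mu.nonneg_law_axioms)

lemma rbar_pos: "0 < rbar"
  using qbar_pos N_mean by (simp add: rbar_def)

lemma measurable_V [measurable]: "V \<in> borel_measurable P"
  unfolding V_def by measurable

lemma W_eq_integral: "W x = (\<integral>\<omega>. indicator {\<omega>. V \<omega> > x} \<omega> \<partial>P)"
  by (simp add: W_def)

lemma integrable_indicator_V [simp, intro]:
  "integrable P (\<lambda>\<omega>. indicator {\<omega>. V \<omega> > x} \<omega> :: real)"
  by (rule integrable_const_bound[where B = 1]) auto

text \<open>On \<open>core B\<close> both Q and N are bounded (for Q >= 0), so estimates for
  boundedly many summands apply. Off it, bounds linear in N are integrated against a weight that
  vanishes as B grows.\<close>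

definition core :: "nat \<Rightarrow> (real \<times> nat) set" where
  "core B = {\<omega>. snd \<omega> \<le> B \<and> V \<omega> \<le> real B}"

lemma sets_core [measurable]: "core B \<in> sets P"
proof -
  have "{\<omega> \<in> space P. snd \<omega> \<le> B \<and> V \<omega> \<le> real B} \<in> sets P" by measurable
  then show ?thesis by (simp add: core_def)
qed

lemma sets_compl_core [measurable]: "- core B \<in> sets P"
  using sets.compl_sets[OF sets_core[of B]] by (simp add: Compl_eq_Diff_UNIV)

lemma integrable_N_indicator [simp, intro]:
  assumes "A \<in> sets P"
  shows "integrable P (\<lambda>\<omega>. real (snd \<omega>) * indicator A \<omega>)"
  using assms N_int by (rule integrable_real_mult_indicator)

lemma core_exhausts:
  assumes "0 < e"
  shows "\<exists>B\<ge>1. (\<integral>\<omega>. real (snd \<omega>) * indicator (- core B) \<omega> \<partial>P) < e"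
proof -
  have "(\<lambda>B. \<integral>\<omega>. real (snd \<omega>) * indicator (- core B) \<omega> \<partial>P) \<longlonglongrightarrow> (\<integral>\<omega>. 0 \<partial>P)"
  proof (rule integral_dominated_convergence[where w = "\<lambda>\<omega>. real (snd \<omega>)"])
    show "AE \<omega> in P. (\<lambda>B. real (snd \<omega>) * indicator (- core B) \<omega>) \<longlonglongrightarrow> 0"
    proof (rule AE_I2, rule tendsto_eventually)
      fix \<omega> :: "real \<times> nat"
      obtain B where "max (real (snd \<omega>)) (V \<omega>) \<le> real B" using real_arch_simple by blast
      then show "\<forall>\<^sub>F B in sequentially. real (snd \<omega>) * indicator (- core B) \<omega> = 0"
        by (intro eventually_sequentiallyI[of B]) (auto simp: core_def)
    qed
    show "(\<lambda>\<omega>. real (snd \<omega>) * indicator (- core B) \<omega>) \<in> borel_measurable P" for B by measurable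
  qed (auto simp: N_int indicator_def)
  then have "\<forall>\<^sub>F B in sequentially. (\<integral>\<omega>. real (snd \<omega>) * indicator (- core B) \<omega> \<partial>P) < e"
    using assms by (intro order_tendstoD(2)) auto
  then have "\<forall>\<^sub>F B in sequentially. (\<integral>\<omega>. real (snd \<omega>) * indicator (- core B) \<omega> \<partial>P) < e \<and> 1 \<le> B"
    using eventually_ge_at_top by (rule eventually_conj)
  then show ?thesis by (auto dest: eventually_happens)
qed

lemma T_fixed_point: "mu.T z = (\<integral>\<omega>. mu.sum_tail (snd \<omega>) (z - fst \<omega>) \<partial>P)"
  using tail_fixmap(1)[OF mu.nonneg_law_axioms, of z] by (simp add: fix_eq)

lemma integrable_sum_tail_P [simp, intro]: "integrable P (\<lambda>\<omega>. mu.sum_tail (snd \<omega>) (z - fst \<omega>))"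
  by (rule integrable_const_bound[where B = 1])
     (use tail_fixmap(2)[OF mu.nonneg_law_axioms] mu.sum_tail_bounds in auto)

end

locale irv_branching_solution = branching_solution +
  assumes irv: "irv_fun W"
begin

lemmas W_antimono = irv_funD(1)[OF irv]
lemmas W_pos = irv_funD(2)[OF irv]

text \<open>If \<open>Q + r N\<close> is not large itself, then either the sum contains one large summand, or its centred
  version is large with \<open>N\<close> or \<open>Q\<close> large, which \<open>pass_linear_bound\<close> controls.\<close>

lemma T_upper:
  assumes \<eta>: "0 < \<eta>" "\<eta> \<le> 1 / 2"
  shows "\<exists>K0. \<forall>e>0. \<exists>x0>0. \<forall>x\<ge>x0. \<forall>K\<ge>K0. (\<forall>u. 0 \<le> u \<and> u \<le> (1 - \<eta>) * x \<longrightarrow> mu.T u \<le> K * W u) \<longrightarrow>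
    mu.T x \<le> W ((1 - \<eta>)\<^sup>2 * x) + nbar * mu.T ((1 - \<eta>) * x) + e * K * W x"
proof -
  \<comment> \<open>With this slope q + n c <= V/(1 - \<eta>). So V <= (1 - \<eta>)^2 x implies x -
    q >= \<eta> x + n c: the centred sum still has to gain \<eta> x.\<close>
  define c where "c = rbar / (1 - \<eta>)"
  have c: "mu.r < c" "rbar < c" "0 < c"
    using \<eta> rbar_pos by (auto simp: c_def mu_mean field_simps)
  obtain D where D: "\<forall>\<^sub>F x in at_top. W (1 / 2 * x) \<le> D * W x"
    using irv_fun_dominated[OF irv, of "1 / 2"] by auto
  then obtain xh where xh: "\<And>x. xh \<le> x \<Longrightarrow> W (x / 2) \<le> D * W x"
    by (auto simp: eventually_at_top_linorder)
  obtain x1 C where x1: "0 < x1" and C: "0 < C"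
    and lin: "\<And>K x n y. (\<forall>u. 0 \<le> u \<and> u \<le> x \<longrightarrow> mu.T u \<le> K * W u) \<Longrightarrow> 1 \<le> K * W x1
      \<Longrightarrow> x1 \<le> y \<Longrightarrow> y \<le> x \<Longrightarrow> 1 \<le> n \<Longrightarrow> mu.pass c n y \<le> C * real n * K * W y"
    using mu.pass_linear_bound[OF c(1) W_pos W_antimono xh] by blast
  obtain D1 where D1: "0 < D1" "\<forall>\<^sub>F x in at_top. W (\<eta> * x) \<le> D1 * W x"
    using irv_fun_dominated[OF irv \<eta>(1)] by auto
  show ?thesis
  \<comment> \<open>This threshold for \<open>K\<close> secures \<open>1 <= K * W x1\<close> and is
    fixed before \<open>e\<close>, on which \<open>T_upper_sharp\<close> relies.\<close>
  proof (rule exI[of _ "1 / W x1"], intro allI impI)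
    fix e :: real assume e: "0 < e"
    have "0 < e / (2 * C * D1)" using e C D1 by simp
    from core_exhausts[OF this] obtain B where B: "1 \<le> B"
      and tailB: "(\<integral>\<omega>. real (snd \<omega>) * indicator (- core B) \<omega> \<partial>P) < e / (2 * C * D1)" by auto
    \<comment> \<open>\<open>B\<close> summands of size at most k x use half of the slack \<eta> x;
      the other half absorbs Q, which is at most \<open>B\<close> on the core.\<close>
    define k where "k = \<eta> / (2 * real B)"
    have k: "0 < k" "k \<le> \<eta> / 2" "real B * k = \<eta> / 2" using \<eta> B by (auto simp: k_def field_simps)
    obtain D2 where D2: "0 < D2" "\<forall>\<^sub>F x in at_top. W (k * x) \<le> D2 * W x"
      using irv_fun_dominated[OF irv k(1)] by auto
    have "(mu.sum_tail B \<longlongrightarrow> 0) at_top"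
      by (rule real_distribution.tail_tendsto_0[OF mu.real_distribution_convpow])
    moreover have "filterlim (\<lambda>x. k * x) at_top at_top"
      using k by (intro filterlim_mult_pos_at_top) auto
    ultimately have "((\<lambda>x. mu.sum_tail B (k * x)) \<longlongrightarrow> 0) at_top"
      by (rule filterlim_compose)
    then have hB: "\<forall>\<^sub>F x in at_top. mu.sum_tail B (k * x) < e / (2 * D2)"
      using e D2 by (intro order_tendstoD(2)) auto
    have "\<forall>\<^sub>F x in at_top. W (\<eta> * x) \<le> D1 * W x \<and> W (k * x) \<le> D2 * W x \<and> mu.sum_tail B (k * x) < e / (2 * D2)
        \<and> max 1 (max (x1 / \<eta>) (2 * real B / \<eta>)) \<le> x"
      using D1(2) D2(2) hB eventually_ge_at_top[of "max 1 (max (x1 / \<eta>) (2 * real B / \<eta>))"]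
      by eventually_elim blast
    then obtain x0 where x0: "\<And>x. x0 \<le> x \<Longrightarrow> W (\<eta> * x) \<le> D1 * W x \<and> W (k * x) \<le> D2 * W x
        \<and> mu.sum_tail B (k * x) < e / (2 * D2) \<and> max 1 (max (x1 / \<eta>) (2 * real B / \<eta>)) \<le> x"
      by (auto simp: eventually_at_top_linorder)
    show "\<exists>x0>0. \<forall>x\<ge>x0. \<forall>K\<ge>1 / W x1. (\<forall>u. 0 \<le> u \<and> u \<le> (1 - \<eta>) * x \<longrightarrow> mu.T u \<le> K * W u) \<longrightarrow>
      mu.T x \<le> W ((1 - \<eta>)\<^sup>2 * x) + nbar * mu.T ((1 - \<eta>) * x) + e * K * W x"
    proof (rule exI[of _ "max 1 x0"], intro conjI allI impI)
      fix x K assume "max 1 x0 \<le> x" and K: "1 / W x1 \<le> K"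
        and TK: "\<forall>u. 0 \<le> u \<and> u \<le> (1 - \<eta>) * x \<longrightarrow> mu.T u \<le> K * W u"
      then have x: "W (\<eta> * x) \<le> D1 * W x" "W (k * x) \<le> D2 * W x" "mu.sum_tail B (k * x) < e / (2 * D2)"
        "1 \<le> x" "x1 \<le> \<eta> * x" "real B \<le> \<eta> * x / 2"
        using x0[of x] \<eta> by (auto simp: field_simps)
      have K1: "1 \<le> K * W x1" using K W_pos[of x1] by (simp add: field_simps)
      then have K0: "0 < K" using W_pos[of x1] by (metis less_le_trans zero_less_mult_pos2 zero_less_one)
      define a where "a = mu.T ((1 - \<eta>) * x) + e / 2 * K * W x"
      define b where "b = C * K * D1 * W x"
      have ab: "0 \<le> a" "0 \<le> b"
        unfolding a_def b_def using mu.T_bounds e K0 W_pos[of x] C D1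
        by (auto intro!: add_nonneg_nonneg mult_nonneg_nonneg less_imp_le)
      have pw: "mu.sum_tail (snd \<omega>) (x - fst \<omega>) \<le> indicator {\<omega>. (1 - \<eta>)\<^sup>2 * x < V \<omega>} \<omega>
          + a * real (snd \<omega>) + b * (real (snd \<omega>) * indicator (- core B) \<omega>)" if q: "0 \<le> fst \<omega>" for \<omega>
      proof -
        obtain q n where \<omega>: "\<omega> = (q, n)" by (cases \<omega>)
        have nn: "0 \<le> a * real n" "0 \<le> b * real n" using ab by auto
        consider "(1 - \<eta>)\<^sup>2 * x < V \<omega>" | "V \<omega> \<le> (1 - \<eta>)\<^sup>2 * x" "\<omega> \<in> core B"
          | "V \<omega> \<le> (1 - \<eta>)\<^sup>2 * x" "\<omega> \<notin> core B" by linarith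
        then show ?thesis
        proof cases
          case 1
          have "0 \<le> b * (real (snd \<omega>) * indicator (- core B) \<omega>)" using ab by simp
          then show ?thesis using 1 nn mu.sum_tail_bounds(2)[of n "x - q"] by (simp add: \<omega>)
        next
          case 2
          have nB: "n \<le> B" and "V \<omega> \<le> real B" using 2 by (auto simp: core_def \<omega>)
          moreover have "q \<le> V \<omega>" using rbar_nonneg by (simp add: V_def \<omega>)
          ultimately have "q \<le> \<eta> * x / 2" using x(6) by linarith
          have "real n * (k * x) \<le> real B * (k * x)"
            using nB k x(4) by (intro mult_right_mono) auto
          also have "\<dots> = \<eta> / 2 * x" by (simp flip: k(3))
          finally have "(1 - \<eta>) * x + real n * (k * x) \<le> x - q"
            using \<open>q \<le> \<eta> * x / 2\<close> by (simp add: algebra_simps)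
          then have "mu.sum_tail n (x - q) \<le> mu.sum_tail n ((1 - \<eta>) * x + real n * (k * x))" by (rule mu.sum_tail_antimono)
          also have kx: "0 \<le> k * x" "k * x \<le> (1 - \<eta>) * x"
            using k \<eta> x(4) by (auto intro!: mult_right_mono)
          have "mu.sum_tail n ((1 - \<eta>) * x + real n * (k * x))
              \<le> real n * mu.T ((1 - \<eta>) * x) + real n * mu.T (k * x) * mu.sum_tail n (k * x)"
            by (rule mu.sum_tail_upper[OF kx])
          also have "mu.T (k * x) * mu.sum_tail n (k * x) \<le> (K * (D2 * W x)) * (e / (2 * D2))"
          proof (rule mult_mono)
            have "mu.T (k * x) \<le> K * W (k * x)" using TK kx by blast
            also have "\<dots> \<le> K * (D2 * W x)" using x K0 by (intro mult_left_mono) auto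
            finally show "mu.T (k * x) \<le> K * (D2 * W x)" .
            have "mu.sum_tail n (k * x) \<le> mu.sum_tail B (k * x)"
              using nB by (rule lift_Suc_mono_le[of "\<lambda>n. mu.sum_tail n (k * x)", OF mu.sum_tail_mono_Suc])
            then show "mu.sum_tail n (k * x) \<le> e / (2 * D2)" using x by simp
          qed (use K0 D2 W_pos[of x] mu.sum_tail_bounds in auto)
          then have "real n * mu.T (k * x) * mu.sum_tail n (k * x) \<le> real n * ((K * (D2 * W x)) * (e / (2 * D2)))"
            by (simp only: mult.assoc) (rule mult_left_mono, auto)
          finally have "mu.sum_tail n (x - q) \<le> a * real n" using D2(1) by (simp add: a_def field_simps)
          then show ?thesis using 2 by (simp add: \<omega>)
        next
          case 3
          have "rbar * real n / (1 - \<eta>) + q \<le> V \<omega> / (1 - \<eta>)"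
          proof -
            have "0 \<le> q * \<eta>" using q \<eta> by (simp add: \<omega>)
            then have "q \<le> q / (1 - \<eta>)" using \<eta> by (simp add: field_simps)
            then show ?thesis by (simp add: V_def \<omega> add_divide_distrib)
          qed
          also have "\<dots> \<le> (1 - \<eta>) * x"
            using 3 \<eta> by (simp add: power2_eq_square field_simps)
          finally have qn: "\<eta> * x + real n * c \<le> x - q" by (simp add: c_def algebra_simps)
          then have "mu.sum_tail n (x - q) \<le> mu.sum_tail n (\<eta> * x + real n * c)" by (rule mu.sum_tail_antimono)
          also have "\<dots> \<le> mu.pass c n (\<eta> * x)" by (rule mu.sum_tail_le_pass)
          also have "\<dots> \<le> b * real n"
          proof (cases "n = 0")
            case True
            then show ?thesis using x x1 by simp
          next
            case False
            have "mu.pass c n (\<eta> * x) \<le> C * real n * K * W (\<eta> * x)"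
              \<comment> \<open>Since \<eta> <= 1/2, the level \<eta> x lies within the range (1 -
                \<eta>) x where the bound on \<open>T\<close> is assumed.\<close>
              using \<eta> x False by (intro lin[OF TK K1]) auto
            also have "\<dots> \<le> C * real n * K * (D1 * W x)"
              using x C K0 by (intro mult_left_mono) auto
            finally show ?thesis by (simp add: b_def mult_ac)
          qed
          finally show ?thesis using 3 nn by (simp add: \<omega>)
        qed
      qed
      have "mu.T x \<le> (\<integral>\<omega>. indicator {\<omega>. (1 - \<eta>)\<^sup>2 * x < V \<omega>} \<omega>
          + a * real (snd \<omega>) + b * (real (snd \<omega>) * indicator (- core B) \<omega>) \<partial>P)"
        unfolding T_fixed_point
      proof (rule integral_mono_AE)
        show "AE \<omega> in P. mu.sum_tail (snd \<omega>) (x - fst \<omega>) \<le> indicator {\<omega>. (1 - \<eta>)\<^sup>2 * x < V \<omega>} \<omega>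
          + a * real (snd \<omega>) + b * (real (snd \<omega>) * indicator (- core B) \<omega>)"
          using Q_nonneg by eventually_elim (rule pw)
      qed (use N_int in auto)
      also have "\<dots> = W ((1 - \<eta>)\<^sup>2 * x) + a * nbar + b * (\<integral>\<omega>. real (snd \<omega>) * indicator (- core B) \<omega> \<partial>P)"
        using N_int by (simp add: W_eq_integral)
      also have "b * (\<integral>\<omega>. real (snd \<omega>) * indicator (- core B) \<omega> \<partial>P) \<le> b * (e / (2 * C * D1))"
        using tailB ab by (intro mult_left_mono) auto
      also have "b * (e / (2 * C * D1)) = e / 2 * K * W x"
        using C D1 by (simp add: b_def)
      also have "a * nbar \<le> nbar * mu.T ((1 - \<eta>) * x) + e / 2 * K * W x"
      proof -
        have "nbar * (e / 2 * K * W x) \<le> 1 * (e / 2 * K * W x)"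
          using N_mean e K0 W_pos[of x] by (intro mult_right_mono) auto
        then show ?thesis by (simp add: a_def algebra_simps)
      qed
      finally show "mu.T x \<le> W ((1 - \<eta>)\<^sup>2 * x) + nbar * mu.T ((1 - \<eta>) * x) + e * K * W x"
        by (simp add: algebra_simps)
    qed simp
  qed
qed

text \<open>Two sources of a large sum: a large \<open>V\<close>, where the exponential bound makes
  the sum exceed \<open>x\<close> almost surely up to \<open>e\<close>, and a point of the core with
  one summand above \<open>x\<close>. For x > B they are disjoint, so their contributions
  add.\<close>

lemma T_lower:
  assumes \<eta>: "0 < \<eta>" "\<eta> \<le> 1 / 2" and e: "0 < e" "e < 1"
  shows "\<forall>\<^sub>F x in at_top. (1 - e) * W ((1 + \<eta>) / (1 - \<eta>) * x) + (1 - e) * (nbar - e) * mu.T x \<le> mu.T x"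
proof -
  \<comment> \<open>Now (1 - \<eta>) V <= q + n c, so V > (1 + \<eta>)/(1 - \<eta>) x leaves a
    surplus \<eta> x for the exponential bound.\<close>
  define c where "c = rbar * (1 - \<eta>)"
  have "c < mu.r" using \<eta> rbar_pos by (simp add: c_def mu_mean)
  from mu.sum_tail_lower_uniform[OF this] obtain s where s: "0 < s"
    and low: "\<And>n y. 1 - exp (- s * y) \<le> mu.sum_tail n (real n * c - y)" by blast
  obtain B where B: "1 \<le> B" and tailB: "(\<integral>\<omega>. real (snd \<omega>) * indicator (- core B) \<omega> \<partial>P) < e"
    using core_exhausts[OF e(1)] by auto
  have "nbar = (\<integral>\<omega>. real (snd \<omega>) * indicator (core B) \<omega> + real (snd \<omega>) * indicator (- core B) \<omega> \<partial>P)"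
    by (rule Bochner_Integration.integral_cong) (auto simp: indicator_def)
  also have "\<dots> = (\<integral>\<omega>. real (snd \<omega>) * indicator (core B) \<omega> \<partial>P) + (\<integral>\<omega>. real (snd \<omega>) * indicator (- core B) \<omega> \<partial>P)"
    by (rule Bochner_Integration.integral_add) auto
  finally have coreB: "nbar - e \<le> (\<integral>\<omega>. real (snd \<omega>) * indicator (core B) \<omega> \<partial>P)" using tailB by simp
  have "((\<lambda>x. real B * mu.T x) \<longlongrightarrow> real B * 0) at_top" by (intro tendsto_intros mu.tail_tendsto_0)
  then have TB: "\<forall>\<^sub>F x in at_top. real B * mu.T x < e" using e by (intro order_tendstoD(2)) auto
  have "((\<lambda>x. exp (- s * (\<eta> * x))) \<longlongrightarrow> 0) at_top" using s \<eta> by real_asymp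
  then have ex: "\<forall>\<^sub>F x in at_top. exp (- s * (\<eta> * x)) < e" using e by (intro order_tendstoD(2)) auto
  show ?thesis
    using TB ex eventually_gt_at_top[of "real B"]
  proof eventually_elim
    case (elim x)
    define l where "l = (1 + \<eta>) / (1 - \<eta>)"
    have l: "1 \<le> l" using \<eta> by (simp add: l_def)
    have pw: "(1 - e) * indicator {\<omega>. l * x < V \<omega>} \<omega> + (1 - e) * mu.T x * (real (snd \<omega>) * indicator (core B) \<omega>)
        \<le> mu.sum_tail (snd \<omega>) (x - fst \<omega>)" if q: "0 \<le> fst \<omega>" for \<omega>
    proof -
      obtain q n where \<omega>: "\<omega> = (q, n)" by (cases \<omega>)
      have "x \<le> l * x" using l elim B by (simp add: mult_le_cancel_right1)
      then have disj: "\<omega> \<notin> core B" if "l * x < V \<omega>" 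
      proof -
        have "real B < V \<omega>" using that elim \<open>x \<le> l * x\<close> by linarith
        then show ?thesis by (simp add: core_def)
      qed
      consider "l * x < V \<omega>" "\<omega> \<notin> core B" | "\<not> l * x < V \<omega>" "\<omega> \<in> core B" | "\<not> l * x < V \<omega>" "\<omega> \<notin> core B"
        using disj by blast
      then show ?thesis
      proof cases
        case 1
        have "(1 + \<eta>) * x < (1 - \<eta>) * V \<omega>"
          using 1 \<eta> by (simp add: l_def field_simps)
        also have "\<dots> \<le> q + real n * c"
          using q \<eta> by (simp add: V_def c_def \<omega> algebra_simps)
        finally have "x - q \<le> real n * c - \<eta> * x" by (simp add: algebra_simps)
        then have "mu.sum_tail n (real n * c - \<eta> * x) \<le> mu.sum_tail n (x - q)" by (rule mu.sum_tail_antimono)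
        then show ?thesis using low[of "\<eta> * x" n] elim 1 by (simp add: \<omega>)
      next
        case 2
        have nB: "real n \<le> real B" using 2 by (simp add: core_def \<omega>)
        have "real n * mu.T x \<le> real B * mu.T x" using nB mu.T_bounds by (intro mult_right_mono) auto
        then have "1 - e \<le> 1 - real n * mu.T x" using elim by linarith
        then have "real n * mu.T x * (1 - e) \<le> real n * mu.T x * (1 - real n * mu.T x)"
          using mu.T_bounds by (intro mult_left_mono) auto
        also have "\<dots> \<le> mu.sum_tail n x" using elim by (intro mu.sum_tail_lower) auto
        also have "\<dots> \<le> mu.sum_tail n (x - q)" using q by (intro mu.sum_tail_antimono) (simp add: \<omega>)
        finally show ?thesis using 2 by (simp add: \<omega> mult_ac)
      next
        case 3
        then show ?thesis using mu.sum_tail_bounds by simp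
      qed
    qed
    have "(1 - e) * W (l * x) + (1 - e) * mu.T x * (nbar - e)
        \<le> (1 - e) * W (l * x) + (1 - e) * mu.T x * (\<integral>\<omega>. real (snd \<omega>) * indicator (core B) \<omega> \<partial>P)"
      using coreB e mu.T_bounds by (intro add_left_mono mult_left_mono) auto
    also have "\<dots> = (\<integral>\<omega>. (1 - e) * indicator {\<omega>. l * x < V \<omega>} \<omega>
        + (1 - e) * mu.T x * (real (snd \<omega>) * indicator (core B) \<omega>) \<partial>P)"
      by (simp add: W_eq_integral)
    also have "\<dots> \<le> (\<integral>\<omega>. mu.sum_tail (snd \<omega>) (x - fst \<omega>) \<partial>P)"
    proof (rule integral_mono_AE)
      show "AE \<omega> in P. (1 - e) * indicator {\<omega>. l * x < V \<omega>} \<omega>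
        + (1 - e) * mu.T x * (real (snd \<omega>) * indicator (core B) \<omega>) \<le> mu.sum_tail (snd \<omega>) (x - fst \<omega>)"
        using Q_nonneg by eventually_elim (rule pw)
    qed auto
    also have "\<dots> = mu.T x" by (rule T_fixed_point[symmetric])
    finally show ?case by (simp add: l_def mult_ac)
  qed
qed

text \<open>A bound with constant \<open>K\<close> up to (1 - \<eta>) x gives at x the constant 1 +
  e + \<theta> K with \<theta> < 1, which is at most \<open>K\<close> once \<open>K\<close> is
  large; the same \<open>K\<close> therefore survives at every scale.\<close>

lemma T_dominated: "\<exists>K>0. \<forall>u\<ge>0. mu.T u \<le> K * W u"
proof -
  \<comment> \<open>Makes \<theta> = nbar (1 + e) + e at most nbar + 2e = 1 - 2e.\<close>
  define e where "e = (1 - nbar) / 4"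
  have e: "0 < e" using N_mean by (simp add: e_def)
  have e1: "e \<le> 1" 
  proof -
    have "(1 - nbar) / 4 \<le> (1 - 0) / 4" by (intro divide_right_mono diff_left_mono nbar_nonneg) simp
    also have "(1 - 0) / 4 \<le> (1 :: real)" by simp
    finally show ?thesis by (simp only: e_def)
  qed
  define \<theta> where "\<theta> = nbar * (1 + e) + e"
  have "nbar * e \<le> 1 * e" using N_mean e by (intro mult_right_mono) auto
  then have "\<theta> \<le> nbar + 2 * e" by (simp add: \<theta>_def algebra_simps)
  also have "\<dots> = 1 - 2 * e" by (simp add: e_def field_simps)
  finally have \<theta>: "\<theta> < 1" using e by simp
  obtain \<eta> where \<eta>: "0 < \<eta>" "\<eta> \<le> 1 / 2" "\<forall>\<^sub>F x in at_top. W ((1 - \<eta>) * x) \<le> (1 + e) * W x"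
    "\<forall>\<^sub>F x in at_top. W ((1 - \<eta>)\<^sup>2 * x) \<le> (1 + e) * W x"
    using irv_fun_eta[OF irv e] by blast
  obtain K0 x0 where x0: "0 < x0" and upper: "\<And>x K. x0 \<le> x \<Longrightarrow> K0 \<le> K \<Longrightarrow>
      (\<forall>u. 0 \<le> u \<and> u \<le> (1 - \<eta>) * x \<longrightarrow> mu.T u \<le> K * W u) \<Longrightarrow>
      mu.T x \<le> W ((1 - \<eta>)\<^sup>2 * x) + nbar * mu.T ((1 - \<eta>) * x) + e * K * W x"
    using T_upper[OF \<eta>(1,2)] e by metis
  have "\<forall>\<^sub>F x in at_top. W ((1 - \<eta>) * x) \<le> (1 + e) * W x \<and> W ((1 - \<eta>)\<^sup>2 * x) \<le> (1 + e) * W x"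
    using \<eta>(3,4) by (rule eventually_conj)
  then obtain x2 where x2: "\<And>x. x2 \<le> x \<Longrightarrow> W ((1 - \<eta>) * x) \<le> (1 + e) * W x \<and> W ((1 - \<eta>)\<^sup>2 * x) \<le> (1 + e) * W x"
    by (auto simp: eventually_at_top_linorder)
  define y where "y = max x0 x2"
  have y: "0 < y" "x0 \<le> y" "x2 \<le> y" using x0 by (auto simp: y_def)
  \<comment> \<open>The three lower bounds admit \<open>T_upper\<close>, absorb 1 + e <= 2 in the
    induction step, and cover u <= y through T <= 1.\<close>
  define K where "K = max K0 (max (2 / (1 - \<theta>)) (1 / W y))"
  have K: "K0 \<le> K" "2 / (1 - \<theta>) \<le> K" "1 / W y \<le> K" by (auto simp: K_def)
  have Kpos: "0 < K" using K(3) W_pos[of y] by (meson less_le_trans zero_less_divide_1_iff)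
  \<comment> \<open>\<open>k\<close> counts how many contractions by 1 - \<eta> bring
    \<open>u\<close> below the base level \<open>y\<close>.\<close>
  have main: "mu.T u \<le> K * W u" if "0 \<le> u" "(1 - \<eta>) ^ k * u \<le> y" for k u
    using that
  proof (induction k arbitrary: u)
    case 0
    have "mu.T u \<le> K * W y"
      using mu.T_bounds(2)[of u] K(3) W_pos[of y] by (simp add: field_simps)
    also have "\<dots> \<le> K * W u" using 0 Kpos by (intro mult_left_mono antimonoD[OF W_antimono]) auto
    finally show ?case .
  next
    case (Suc k)
    have IH: "mu.T v \<le> K * W v" if v: "0 \<le> v" "v \<le> (1 - \<eta>) * u" for v
    proof (rule Suc.IH[OF v(1)])
      have "(1 - \<eta>) ^ k * v \<le> (1 - \<eta>) ^ k * ((1 - \<eta>) * u)"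
        using v \<eta> by (intro mult_left_mono) auto
      then show "(1 - \<eta>) ^ k * v \<le> y" using Suc.prems by (simp add: mult_ac)
    qed
    show ?case
    proof (cases "u \<le> y")
      case True
      have "mu.T u \<le> K * W y"
        using mu.T_bounds(2)[of u] K(3) W_pos[of y] by (simp add: field_simps)
      also have "\<dots> \<le> K * W u" using True Kpos by (intro mult_left_mono antimonoD[OF W_antimono]) auto
      finally show ?thesis .
    next
      case False
      have "mu.T u \<le> W ((1 - \<eta>)\<^sup>2 * u) + nbar * mu.T ((1 - \<eta>) * u) + e * K * W u"
        using False y K IH by (intro upper) auto
      also have "W ((1 - \<eta>)\<^sup>2 * u) \<le> (1 + e) * W u" using x2[of u] False y by simp
      also have "nbar * mu.T ((1 - \<eta>) * u) \<le> nbar * (K * ((1 + e) * W u))"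
      proof (rule mult_left_mono)
        have "mu.T ((1 - \<eta>) * u) \<le> K * W ((1 - \<eta>) * u)"
          using \<eta> Suc.prems by (intro IH) auto
        also have "\<dots> \<le> K * ((1 + e) * W u)" using x2[of u] False y Kpos by (intro mult_left_mono) auto
        finally show "mu.T ((1 - \<eta>) * u) \<le> K * ((1 + e) * W u)" .
      qed simp
      finally have "mu.T u \<le> (1 + e + \<theta> * K) * W u" by (simp add: \<theta>_def algebra_simps)
      also have "\<dots> \<le> K * W u"
      proof (rule mult_right_mono)
        have "2 \<le> K * (1 - \<theta>)" using K(2) \<theta> by (simp add: field_simps)
        then show "1 + e + \<theta> * K \<le> K" using e1 by (simp add: algebra_simps)
      qed (use W_pos[of u] in simp)
      finally show ?thesis .
    qed
  qed
  have "mu.T u \<le> K * W u" if u: "0 \<le> u" for u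
  proof (cases "u = 0")
    case True
    then show ?thesis using main[of u 0] y by simp
  next
    case False
    then have "0 < u" using u by simp
    obtain k where "(1 - \<eta>) ^ k < y / u"
      using real_arch_pow_inv[of "y / u" "1 - \<eta>"] \<eta> y \<open>0 < u\<close> by auto
    then show ?thesis using \<open>0 < u\<close> by (intro main[of u k]) (auto simp: field_simps)
  qed
  then show ?thesis using Kpos by blast
qed

text \<open>The infimum t of eventual constants plays the part of the upper limit of T/W.
  \<open>T_upper\<close> with vanishing error gives t <= 1 + nbar t; finiteness of t, from
  \<open>T_dominated\<close>, is what allows solving for t.\<close>

lemma T_upper_sharp:
  assumes d: "0 < d"
  shows "\<forall>\<^sub>F x in at_top. mu.T x \<le> (1 / (1 - nbar) + d) * W x"
proof -
  obtain K where K: "0 < K" "\<And>u. 0 \<le> u \<Longrightarrow> mu.T u \<le> K * W u" using T_dominated by blast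
  define A where "A = {t. 0 \<le> t \<and> (\<forall>\<^sub>F x in at_top. mu.T x \<le> t * W x)}"
  define t where "t = Inf A"
  have "K \<in> A" using K eventually_at_top_linorderI[of 0 "\<lambda>x. mu.T x \<le> K * W x"] by (simp add: A_def)
  have bdd: "bdd_below A" by (rule bdd_belowI[of _ 0]) (auto simp: A_def)
  have t0: "0 \<le> t" unfolding t_def using \<open>K \<in> A\<close> by (intro cInf_greatest) (auto simp: A_def)
  have above: "\<forall>\<^sub>F x in at_top. mu.T x \<le> t' * W x" if lt: "t < t'" for t'
  proof -
    have "A \<noteq> {}" using \<open>K \<in> A\<close> by auto
    then obtain a where a: "a \<in> A" "a < t'"
      using lt cInf_less_iff[OF _ bdd, of t'] unfolding t_def by auto
    then have "\<forall>\<^sub>F x in at_top. mu.T x \<le> a * W x" by (simp add: A_def)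
    then show ?thesis
    proof eventually_elim
      case (elim x)
      have "a * W x \<le> t' * W x" using a W_pos[of x] by (intro mult_right_mono) auto
      then show ?case using elim by linarith
    qed
  qed
  have step: "t \<le> (1 + e) + nbar * ((t + e) * (1 + e)) + e * K" if e: "0 < e" for e
  proof -
    obtain \<eta> where \<eta>: "0 < \<eta>" "\<eta> \<le> 1 / 2" "\<forall>\<^sub>F x in at_top. W ((1 - \<eta>) * x) \<le> (1 + e) * W x"
      "\<forall>\<^sub>F x in at_top. W ((1 - \<eta>)\<^sup>2 * x) \<le> (1 + e) * W x"
      using irv_fun_eta[OF irv e] by blast
    obtain K0 where K0: "\<And>e. 0 < e \<Longrightarrow> \<exists>x0>0. \<forall>x\<ge>x0. \<forall>K\<ge>K0. (\<forall>u. 0 \<le> u \<and> u \<le> (1 - \<eta>) * x \<longrightarrow> mu.T u \<le> K * W u) \<longrightarrow>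
      mu.T x \<le> W ((1 - \<eta>)\<^sup>2 * x) + nbar * mu.T ((1 - \<eta>) * x) + e * K * W x"
      using T_upper[OF \<eta>(1,2)] by blast
    \<comment> \<open>\<open>K0\<close> depends on \<eta> and hence on \<open>e\<close>, so it may
      blow up as e -> 0. \<open>T_upper\<close> is therefore applied with constant \<open>L\<close>
      and small factor e K / L; the error becomes e K with \<open>K\<close> fixed.\<close>
    define L where "L = max K K0"
    have L: "0 < L" "K \<le> L" using K by (auto simp: L_def)
    have TL: "mu.T u \<le> L * W u" if "0 \<le> u" for u
      by (rule order_trans[OF K(2)[OF that] mult_right_mono[OF L(2)]]) (use W_pos[of u] in simp)
    have "0 < e * K / L" using e K L by simp
    from K0[OF this] obtain x0 where x0': "\<forall>x\<ge>x0. \<forall>K'\<ge>K0. (\<forall>u. 0 \<le> u \<and> u \<le> (1 - \<eta>) * x \<longrightarrow> mu.T u \<le> K' * W u) \<longrightarrow>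
      mu.T x \<le> W ((1 - \<eta>)\<^sup>2 * x) + nbar * mu.T ((1 - \<eta>) * x) + e * K / L * K' * W x" by blast
    have x0: "mu.T x \<le> W ((1 - \<eta>)\<^sup>2 * x) + nbar * mu.T ((1 - \<eta>) * x) + e * K / L * L * W x" if "x0 \<le> x" for x
      using x0'[rule_format, OF that, of L] TL by (simp add: L_def)
    have "filterlim (\<lambda>x. (1 - \<eta>) * x) at_top at_top"
      using \<eta> by (intro filterlim_mult_pos_at_top) auto
    from eventually_compose_filterlim[OF above[of "t + e"] this] e
    have "\<forall>\<^sub>F x in at_top. mu.T ((1 - \<eta>) * x) \<le> (t + e) * W ((1 - \<eta>) * x)" by simp
    then have "\<forall>\<^sub>F x in at_top. mu.T x \<le> ((1 + e) + nbar * ((t + e) * (1 + e)) + e * K) * W x"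
      using \<eta>(3,4) eventually_ge_at_top[of x0]
    proof eventually_elim
      case (elim x)
      have "mu.T ((1 - \<eta>) * x) \<le> (t + e) * ((1 + e) * W x)"
        using elim(1) mult_left_mono[OF elim(2), of "t + e"] t0 e by linarith
      then have "nbar * mu.T ((1 - \<eta>) * x) \<le> nbar * ((t + e) * ((1 + e) * W x))" by (intro mult_left_mono) auto
      then show ?case using x0[OF elim(4)] elim(3) L by (simp add: algebra_simps)
    qed
    then have "(1 + e) + nbar * ((t + e) * (1 + e)) + e * K \<in> A"
      using e t0 K nbar_nonneg by (auto simp: A_def intro!: add_nonneg_nonneg mult_nonneg_nonneg)
    then show ?thesis unfolding t_def by (rule cInf_lower[OF _ bdd])
  qed
  have "t \<le> 1 + nbar * t"
  proof (rule tendsto_lowerbound)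
    show "((\<lambda>e. (1 + e) + nbar * ((t + e) * (1 + e)) + e * K) \<longlongrightarrow> 1 + nbar * t) (at_right 0)"
      by (auto intro!: tendsto_eq_intros)
    show "\<forall>\<^sub>F e in at_right 0. t \<le> (1 + e) + nbar * ((t + e) * (1 + e)) + e * K"
      using step by (auto simp: eventually_at_filter)
  qed simp
  then have "t * (1 - nbar) \<le> 1" by (simp add: algebra_simps)
  then have "t \<le> 1 / (1 - nbar)" using N_mean by (simp add: pos_le_divide_eq)
  then show ?thesis using d by (intro above) simp
qed

text \<open>Both occurrences of \<open>T\<close> in \<open>T_lower\<close> are at the same point, so
  the inequality is solved for \<open>T\<close> directly; the resulting factor \<open>G e\<close>
  tends to 1/(1 - nbar) as e -> 0.\<close>

lemma T_lower_sharp: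
  assumes d: "0 < d"
  shows "\<forall>\<^sub>F x in at_top. (1 / (1 - nbar) - d) * W x \<le> mu.T x"
proof -
  define G where "G e = (1 - e) / (1 + e) / (1 - (1 - e) * (nbar - e))" for e
  have "(G \<longlongrightarrow> (1 - 0) / (1 + 0) / (1 - (1 - 0) * (nbar - 0))) (at_right 0)"
    unfolding G_def using N_mean by (intro tendsto_intros) auto
  then have "(G \<longlongrightarrow> 1 / (1 - nbar)) (at_right 0)" by simp
  then have "\<forall>\<^sub>F e in at_right 0. 1 / (1 - nbar) - d < G e"
    by (rule order_tendstoD(1)) (use d in simp)
  moreover have "\<forall>\<^sub>F e in at_right (0 :: real). e \<in> {0<..<1}" by (rule eventually_at_right_real) simp
  ultimately have "\<forall>\<^sub>F e in at_right (0 :: real). 1 / (1 - nbar) - d < G e \<and> e \<in> {0<..<1}" by (rule eventually_conj)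
  then obtain e where e: "1 / (1 - nbar) - d < G e" "0 < e" "e < 1" by (auto dest: eventually_happens)
  have "(1 - e) * (nbar - e) < 1"
  proof -
    have "(1 - e) * (nbar - e) \<le> (1 - e) * 1" using N_mean e by (intro mult_left_mono) auto
    also have "(1 - e) * 1 < 1" using e by simp
    finally show ?thesis .
  qed
  then have den: "0 < 1 - (1 - e) * (nbar - e)" by simp
  obtain \<eta> where \<eta>: "0 < \<eta>" "\<eta> \<le> 1 / 2" "\<forall>\<^sub>F x in at_top. W x \<le> (1 + e) * W ((1 + \<eta>) / (1 - \<eta>) * x)"
    using irv_fun_eta[OF irv e(2)] by blast
  show ?thesis
    using \<eta>(3) T_lower[OF \<eta>(1,2) e(2,3)]
  proof eventually_elim
    case (elim x)
    have "(1 - e) / (1 + e) * W x \<le> (1 - e) * W ((1 + \<eta>) / (1 - \<eta>) * x)"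
    proof -
      have "W x / (1 + e) \<le> W ((1 + \<eta>) / (1 - \<eta>) * x)"
        using elim(1) e by (simp add: pos_divide_le_eq mult.commute)
      then have "(1 - e) * (W x / (1 + e)) \<le> (1 - e) * W ((1 + \<eta>) / (1 - \<eta>) * x)"
        using e by (intro mult_left_mono) auto
      then show ?thesis by simp
    qed
    then have "(1 - e) / (1 + e) * W x \<le> mu.T x * (1 - (1 - e) * (nbar - e))"
      using elim(2) by (simp add: algebra_simps)
    then have "(1 - e) / (1 + e) * W x / (1 - (1 - e) * (nbar - e)) \<le> mu.T x"
      by (subst pos_divide_le_eq[OF den])
    then have "G e * W x \<le> mu.T x"
      by (simp add: G_def)
    moreover have "(1 / (1 - nbar) - d) * W x \<le> G e * W x"
      using e W_pos[of x] by (intro mult_right_mono) auto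
    ultimately show ?case by linarith
  qed
qed

theorem T_asymp: "mu.T \<sim>[at_top] (\<lambda>x. 1 / (1 - nbar) * W x)"
proof (rule asymp_equivI')
  have "((\<lambda>x. mu.T x / W x) \<longlongrightarrow> 1 / (1 - nbar)) at_top"
  proof (rule tendstoI)
    fix d :: real assume "0 < d"
    then have "0 < d / 2" by simp
    from T_lower_sharp[OF this] T_upper_sharp[OF this]
    show "\<forall>\<^sub>F x in at_top. dist (mu.T x / W x) (1 / (1 - nbar)) < d"
    proof eventually_elim
      case (elim x)
      then have "1 / (1 - nbar) - d / 2 \<le> mu.T x / W x" "mu.T x / W x \<le> 1 / (1 - nbar) + d / 2"
        using W_pos[of x] by (auto simp: pos_le_divide_eq pos_divide_le_eq)
      then show ?case using \<open>0 < d\<close> unfolding dist_real_def by linarith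
    qed
  qed
  from tendsto_mult[OF tendsto_const[of "1 - nbar"] this]
  have "((\<lambda>x. (1 - nbar) * (mu.T x / W x)) \<longlongrightarrow> (1 - nbar) * (1 / (1 - nbar))) at_top" .
  then show "((\<lambda>x. mu.T x / (1 / (1 - nbar) * W x)) \<longlongrightarrow> 1) at_top"
    using N_mean by (simp add: mult.commute)
qed

end

section \<open>Sufficient conditions\<close>

lemma irv_fun_sandwich:
  assumes U: "irv_fun U" and am: "antimono U'" and le: "\<And>x. U x \<le> U' x"
    and upper: "\<And>d. 0 < d \<Longrightarrow> \<forall>\<^sub>F x in at_top. U' x \<le> (1 + d) * U x"
  shows "irv_fun U'"
  unfolding irv_fun_def
proof (intro conjI allI impI am)
  show "0 < U' x" for x using irv_funD(2)[OF U, of x] le[of x] by linarith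
  fix e :: real assume e: "0 < e"
  \<comment> \<open>For d <= 1 one has (1 + d)^2 <= 1 + 3d <= 1 + e; one factor compares
    \<open>U'\<close> with \<open>U\<close>, the other compares \<open>U\<close> at two
    points.\<close>
  define d where "d = min 1 (e / 3)"
  have d: "0 < d" "d \<le> 1" "3 * d \<le> e" using e by (auto simp: d_def)
  have dd: "(1 + d) * (1 + d) \<le> 1 + e"
  proof -
    have "d * d \<le> 1 * d" using d by (intro mult_right_mono) auto
    moreover have "(1 + d) * (1 + d) = 1 + 2 * d + d * d" by (simp add: algebra_simps)
    ultimately show ?thesis using d by linarith
  qed
  obtain a where a: "0 < a" "a < 1" "\<forall>\<^sub>F x in at_top. U (a * x) \<le> (1 + d) * U x"
    using irv_funD(3)[OF U d(1)] by auto
  have "filterlim (\<lambda>x. a * x) at_top at_top"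
    using a by (intro filterlim_mult_pos_at_top) auto
  from eventually_compose_filterlim[OF upper[OF d(1)] this] a(3)
  have "\<forall>\<^sub>F x in at_top. U' (a * x) \<le> (1 + e) * U' x"
  proof eventually_elim
    case (elim x)
    have Ux: "0 < U x" by (rule irv_funD(2)[OF U])
    have "U' (a * x) \<le> (1 + d) * ((1 + d) * U x)"
      using elim(1) mult_left_mono[OF elim(2), of "1 + d"] d by linarith
    also have "\<dots> = (1 + d) * (1 + d) * U x" by simp
    also have "\<dots> \<le> (1 + e) * U x" using dd Ux by (intro mult_right_mono) auto
    also have "\<dots> \<le> (1 + e) * U' x" using le[of x] e by (intro mult_left_mono) auto
    finally show ?case .
  qed
  then show "\<exists>a. 0 < a \<and> a < 1 \<and> (\<forall>\<^sub>F x in at_top. U' (a * x) \<le> (1 + e) * U' x)" using a by blast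
qed

lemma irv_fun_scale:
  assumes U: "irv_fun U" and c: "0 < c"
  shows "irv_fun (\<lambda>x. U (x / c))"
  unfolding irv_fun_def
proof (intro conjI allI impI)
  show "antimono (\<lambda>x. U (x / c))"
    using c by (intro antimonoI antimonoD[OF irv_funD(1)[OF U]] divide_right_mono) auto
  show "0 < U (x / c)" for x by (rule irv_funD(2)[OF U])
  fix e :: real assume "0 < e"
  then obtain a where a: "0 < a" "a < 1" "\<forall>\<^sub>F x in at_top. U (a * x) \<le> (1 + e) * U x"
    using irv_funD(3)[OF U] by auto
  have "filterlim (\<lambda>x. x / c) at_top at_top"
    using c by (intro filterlim_at_top_mult_tendsto_pos[OF tendsto_const, of "1 / c", simplified] filterlim_ident) auto
  from eventually_compose_filterlim[OF a(3) this]
  show "\<exists>a. 0 < a \<and> a < 1 \<and> (\<forall>\<^sub>F x in at_top. U (a * x / c) \<le> (1 + e) * U (x / c))"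
    using a by auto
qed

section \<open>Regular variation under a negligible perturbation\<close>

context prob_space
begin

lemma tail_distr:
  assumes "X \<in> borel_measurable M"
  shows "tail (distr M borel X) x = prob {\<omega> \<in> space M. X \<omega> > x}"
  using assms unfolding tail_def by (subst measure_distr) (auto simp: vimage_def Int_def conj_commute)

lemma IRV_distr_iff:
  assumes [measurable]: "X \<in> borel_measurable M"
  shows "IRV (distr M borel X) \<longleftrightarrow> irv_fun (\<lambda>x. prob {\<omega> \<in> space M. X \<omega> > x})"
proof -
  interpret D: prob_space "distr M borel X" by (rule prob_space_distr) simp
  have "tail (distr M borel X) = (\<lambda>x. prob {\<omega> \<in> space M. X \<omega> > x})"
    by (rule ext) (rule tail_distr, simp)
  then show ?thesis by (subst IRV_iff_irv_fun) (auto intro: D.finite_measure_axioms)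
qed

lemma antimono_prob_greater:
  fixes X :: "'a \<Rightarrow> real"
  assumes [measurable]: "X \<in> borel_measurable M"
  shows "antimono (\<lambda>x. prob {\<omega> \<in> space M. X \<omega> > x})"
proof (rule antimonoI, rule finite_measure_mono)
  show "{\<omega> \<in> space M. x < X \<omega>} \<in> events" for x by measurable
qed auto

text \<open>If X + kY > x, then X > a x or Y > (1 - a) x / k. The first probability is close to that
  of X > x, and dominated variation keeps the second negligible despite the rescaling of its
  level.\<close>

lemma irv_fun_add_negligible:
  assumes [measurable]: "X \<in> borel_measurable M" "Y \<in> borel_measurable M"
    and Y: "AE \<omega> in M. 0 \<le> Y \<omega>" and k: "0 < k"
    and irv: "irv_fun (\<lambda>x. prob {\<omega> \<in> space M. X \<omega> > x})"
    and small: "(\<lambda>x. prob {\<omega> \<in> space M. Y \<omega> > x}) \<in> o[at_top](\<lambda>x. prob {\<omega> \<in> space M. X \<omega> > x})"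
  shows "irv_fun (\<lambda>x. prob {\<omega> \<in> space M. X \<omega> + k * Y \<omega> > x})"
proof (rule irv_fun_sandwich[OF irv])
  define U where "U x = prob {\<omega> \<in> space M. X \<omega> > x}" for x
  have irvU: "irv_fun U" using irv by (simp add: U_def[abs_def])
  show "antimono (\<lambda>x. prob {\<omega> \<in> space M. X \<omega> + k * Y \<omega> > x})" by (rule antimono_prob_greater) simp
  show "prob {\<omega> \<in> space M. X \<omega> > x} \<le> prob {\<omega> \<in> space M. X \<omega> + k * Y \<omega> > x}" for x
  proof (rule finite_measure_mono_AE)
    show "AE \<omega> in M. \<omega> \<in> {\<omega> \<in> space M. X \<omega> > x} \<longrightarrow> \<omega> \<in> {\<omega> \<in> space M. X \<omega> + k * Y \<omega> > x}"
      using Y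
    proof eventually_elim
      case (elim \<omega>)
      then have "0 \<le> k * Y \<omega>" using k by simp
      then show ?case by auto
    qed
  qed simp
  fix d :: real assume d: "0 < d"
  obtain a where a: "0 < a" "a < 1" "\<forall>\<^sub>F x in at_top. U (a * x) \<le> (1 + d / 2) * U x"
    using irv_funD(3)[OF irvU, of "d / 2"] d by auto
  define t where "t = (1 - a) / k"
  have t: "0 < t" using a k by (simp add: t_def)
  obtain D where D: "0 < D" "\<forall>\<^sub>F x in at_top. U (t * x) \<le> D * U x"
    using irv_fun_dominated[OF irvU t] by auto
  have "0 < d / (2 * D)" using d D by simp
  from landau_o.smallD[OF small this]
  have "\<forall>\<^sub>F x in at_top. prob {\<omega> \<in> space M. Y \<omega> > x} \<le> d / (2 * D) * U x"
    by (simp add: U_def)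
  moreover have "filterlim (\<lambda>x. t * x) at_top at_top"
    using t by (intro filterlim_mult_pos_at_top) auto
  ultimately have "\<forall>\<^sub>F x in at_top. prob {\<omega> \<in> space M. Y \<omega> > t * x} \<le> d / (2 * D) * U (t * x)"
    by (rule eventually_compose_filterlim)
  with a(3) D(2) have "\<forall>\<^sub>F x in at_top. prob {\<omega> \<in> space M. X \<omega> + k * Y \<omega> > x} \<le> (1 + d) * U x"
  proof eventually_elim
    case (elim x)
    have "prob {\<omega> \<in> space M. X \<omega> + k * Y \<omega> > x}
        \<le> prob ({\<omega> \<in> space M. X \<omega> > a * x} \<union> {\<omega> \<in> space M. Y \<omega> > t * x})"
    proof (rule finite_measure_mono)
      have "x < X \<omega> + k * Y \<omega> \<Longrightarrow> X \<omega> \<le> a * x \<Longrightarrow> t * x < Y \<omega>" for \<omega>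
        using k by (simp add: t_def pos_divide_less_eq algebra_simps)
      then show "{\<omega> \<in> space M. x < X \<omega> + k * Y \<omega>} \<subseteq> {\<omega> \<in> space M. a * x < X \<omega>} \<union> {\<omega> \<in> space M. t * x < Y \<omega>}"
        by (auto simp: not_less) (meson linorder_not_le)
    qed simp
    also have "\<dots> \<le> U (a * x) + prob {\<omega> \<in> space M. Y \<omega> > t * x}"
      unfolding U_def by (rule measure_Un_le) simp_all
    also have "\<dots> \<le> (1 + d / 2) * U x + d / (2 * D) * (D * U x)"
    proof (rule add_mono[OF elim(1)])
      have "d / (2 * D) * U (t * x) \<le> d / (2 * D) * (D * U x)"
        using elim(2) d D by (intro mult_left_mono) auto
      then show "prob {\<omega> \<in> space M. Y \<omega> > t * x} \<le> d / (2 * D) * (D * U x)" using elim(3) by linarith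
    qed
    also have "\<dots> = (1 + d) * U x" using D by (simp add: algebra_simps)
    finally show ?case .
  qed
  then show "\<forall>\<^sub>F x in at_top. prob {\<omega> \<in> space M. X \<omega> + k * Y \<omega> > x} \<le> (1 + d) * prob {\<omega> \<in> space M. X \<omega> > x}"
    by (simp add: U_def)
qed

end

context branching
begin

lemma condCI:
  assumes "\<And>c. 0 < c \<Longrightarrow> irv_fun (\<lambda>x. prob {\<omega> \<in> space P. fst \<omega> + c * real (snd \<omega>) > x})"
  shows "condC P r"
  unfolding condC_def using assms by (intro exI[of _ 1]) (auto simp: IRV_distr_iff)

lemma condC_Q_dominates:
  assumes "IRV (distr P borel fst)"
    and "(\<lambda>x. prob {\<omega> \<in> space P. real (snd \<omega>) > x}) \<in> o[at_top](\<lambda>x. prob {\<omega> \<in> space P. fst \<omega> > x})"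
  shows "condC P r"
proof (rule condCI)
  fix c :: real assume "0 < c"
  then show "irv_fun (\<lambda>x. prob {\<omega> \<in> space P. fst \<omega> + c * real (snd \<omega>) > x})"
    using assms by (intro irv_fun_add_negligible) (auto simp: IRV_distr_iff)
qed

text \<open>Dividing by \<open>c\<close> exchanges the roles: Q + cN > x means N + Q/c > x/c, a
  negligible perturbation of N at a rescaled level.\<close>

lemma condC_N_dominates:
  assumes "IRV (distr P borel (\<lambda>\<omega>. real (snd \<omega>)))"
    and "(\<lambda>x. prob {\<omega> \<in> space P. fst \<omega> > x}) \<in> o[at_top](\<lambda>x. prob {\<omega> \<in> space P. real (snd \<omega>) > x})"
  shows "condC P r"
proof (rule condCI)
  fix c :: real assume c: "0 < c"
  then have "irv_fun (\<lambda>x. prob {\<omega> \<in> space P. real (snd \<omega>) + 1 / c * fst \<omega> > x})"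
    using assms Q_nonneg by (intro irv_fun_add_negligible) (auto simp: IRV_distr_iff)
  from irv_fun_scale[OF this c]
  have "irv_fun (\<lambda>x. prob {\<omega> \<in> space P. real (snd \<omega>) + 1 / c * fst \<omega> > x / c})" .
  moreover have "real (snd \<omega>) + 1 / c * fst \<omega> > x / c \<longleftrightarrow> fst \<omega> + c * real (snd \<omega>) > x" for \<omega> :: "real \<times> nat" and x
    using c by (simp add: field_simps)
  ultimately show "irv_fun (\<lambda>x. prob {\<omega> \<in> space P. fst \<omega> + c * real (snd \<omega>) > x})" by simp
qed

section \<open>Two-dimensional regular variation\<close>

lemma measurable_angle [measurable]: "angle \<in> borel_measurable P"
  unfolding angle_def by measurable

definition QN_tail :: "real \<Rightarrow> real" where "QN_tail x = prob {\<omega> \<in> space P. fst \<omega> + real (snd \<omega>) > x}"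

definition angle_mass :: "(real \<times> real \<Rightarrow> real) \<Rightarrow> real \<Rightarrow> real" where
  "angle_mass \<psi> y = (\<integral>\<omega>. indicator {\<omega>. fst \<omega> + real (snd \<omega>) > y} \<omega> * \<psi> (angle \<omega>) \<partial>P)"

lemma measurable_angle_mass_integrand [measurable]:
  assumes [measurable]: "\<psi> \<in> borel_measurable borel"
  shows "(\<lambda>\<omega>. indicator {\<omega>. fst \<omega> + real (snd \<omega>) > y} \<omega> * \<psi> (angle \<omega>) :: real) \<in> borel_measurable P"
proof -
  have "{\<omega> \<in> space P. fst \<omega> + real (snd \<omega>) > y} \<in> sets P" by measurable
  then have [measurable]: "{\<omega>. fst \<omega> + real (snd \<omega>) > y} \<in> sets P" by simp
  show ?thesis by measurable
qed

lemma integral_cond_angle_law: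
  assumes pos: "0 < QN_tail y" and [measurable]: "\<psi> \<in> borel_measurable borel"
  shows "(\<integral>\<theta>. \<psi> \<theta> \<partial>cond_angle_law P y) = angle_mass \<psi> y / QN_tail y"
proof -
  define E where "E = {\<omega> \<in> space P. fst \<omega> + real (snd \<omega>) > y}"
  have [measurable]: "E \<in> sets P" unfolding E_def by measurable
  have SE: "QN_tail y = prob E" by (simp add: QN_tail_def E_def)
  have "uniform_measure P E = density P (\<lambda>\<omega>. ennreal (indicator E \<omega> / prob E))"
    unfolding uniform_measure_def
    by (intro density_cong) (use pos in \<open>auto simp: emeasure_eq_measure SE indicator_def divide_ennreal simp flip: ennreal_1\<close>)
  then have "(\<integral>\<theta>. \<psi> \<theta> \<partial>cond_angle_law P y) = (\<integral>\<omega>. \<psi> (angle \<omega>) \<partial>density P (\<lambda>\<omega>. ennreal (indicator E \<omega> / prob E)))"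
    unfolding cond_angle_law_def E_def[symmetric] by (subst integral_distr) auto
  also have "\<dots> = (\<integral>\<omega>. (indicator E \<omega> / prob E) *\<^sub>R \<psi> (angle \<omega>) \<partial>P)"
    by (subst integral_density) auto
  also have "\<dots> = angle_mass \<psi> y / QN_tail y"
    unfolding angle_mass_def SE by (subst integral_divide_zero[symmetric]) (auto simp: E_def indicator_def intro!: Bochner_Integration.integral_cong)
  finally show ?thesis .
qed

text \<open>In the ratio the constant \<open>b\<close> cancels and slow variation removes
  \<open>L\<close>, leaving only the power of t.\<close>

lemma QN_tail_ratio:
  assumes F: "\<forall>\<^sub>F x in at_top. F x = L x * x powr (- \<alpha>)" and L: "slowly_varying L"
    and b: "0 < b" and SF: "QN_tail \<sim>[at_top] (\<lambda>x. b * F x)" and t: "0 < t"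
  shows "((\<lambda>x. QN_tail (t * x) / QN_tail x) \<longlongrightarrow> t powr (- \<alpha>)) at_top" "\<forall>\<^sub>F x in at_top. 0 < QN_tail x"
proof -
  have Lpos: "\<forall>\<^sub>F x in at_top. 0 < L x" and Lt: "((\<lambda>x. L (t * x) / L x) \<longlongrightarrow> 1) at_top"
    using L t by (auto simp: slowly_varying_def)
  have Fpos: "\<forall>\<^sub>F x in at_top. 0 < F x"
    using F Lpos eventually_gt_at_top[of 0] by eventually_elim simp
  have flt: "filterlim (\<lambda>x. t * x) at_top at_top"
    using t by (intro filterlim_mult_pos_at_top) auto
  have ratio: "((\<lambda>x. QN_tail x / (b * F x)) \<longlongrightarrow> 1) at_top"
    by (rule asymp_equivD_strong[OF SF]) (use Fpos b in \<open>auto elim!: eventually_mono\<close>)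
  have Spos: "\<forall>\<^sub>F x in at_top. 0 < QN_tail x"
  proof -
    have "\<forall>\<^sub>F x in at_top. 0 < QN_tail x / (b * F x)" by (rule order_tendstoD(1)[OF ratio]) simp
    with Fpos show ?thesis by eventually_elim (use b in \<open>auto simp: zero_less_divide_iff mult_less_0_iff\<close>)
  qed
  have "((\<lambda>x. F (t * x) / F x) \<longlongrightarrow> 1 * t powr (- \<alpha>)) at_top"
  proof (rule Lim_transform_eventually[OF tendsto_mult[OF Lt tendsto_const]])
    show "\<forall>\<^sub>F x in at_top. L (t * x) / L x * t powr (- \<alpha>) = F (t * x) / F x"
      using F eventually_compose_filterlim[OF F flt] eventually_gt_at_top[of 0]
      by eventually_elim (use t in \<open>simp add: powr_mult\<close>)
  qed
  then have "((\<lambda>x. QN_tail (t * x) / (b * F (t * x)) * (F (t * x) / F x) * inverse (QN_tail x / (b * F x)))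
      \<longlongrightarrow> 1 * (1 * t powr (- \<alpha>)) * inverse 1) at_top"
    by (intro tendsto_mult tendsto_inverse ratio filterlim_compose[OF ratio flt]) auto
  then have "((\<lambda>x. QN_tail (t * x) / (b * F (t * x)) * (F (t * x) / F x) * inverse (QN_tail x / (b * F x)))
      \<longlongrightarrow> t powr (- \<alpha>)) at_top" by simp
  then show "((\<lambda>x. QN_tail (t * x) / QN_tail x) \<longlongrightarrow> t powr (- \<alpha>)) at_top"
  proof (rule Lim_transform_eventually)
    show "\<forall>\<^sub>F x in at_top. QN_tail (t * x) / (b * F (t * x)) * (F (t * x) / F x) * inverse (QN_tail x / (b * F x)) = QN_tail (t * x) / QN_tail x"
      using Fpos eventually_compose_filterlim[OF Fpos flt] by eventually_elim (use b in \<open>simp add: field_simps\<close>)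
  qed
  show "\<forall>\<^sub>F x in at_top. 0 < QN_tail x" by (rule Spos)
qed

text \<open>Weak convergence of the angle tests continuous functions only, so g is localised by a
  continuous partition rather than by its level sets. The resulting lower and upper bounds for the
  tail of Q + cN have the same constant \<kappa> and differ only by powers of l, which may be taken
  close to 1.\<close>

lemma condC_two_dim_RV:
  assumes "two_dim_RV P"
  shows "condC P r"
proof (rule condCI)
  fix c :: real assume c: "0 < c"
  from assms obtain \<alpha> L b G \<nu> where \<alpha>: "0 < \<alpha>" and L: "slowly_varying L" and b: "0 < b"
    and F: "\<forall>\<^sub>F x in at_top. tail G x = L x * x powr (- \<alpha>)"
    and SF: "(\<lambda>x. prob {\<omega> \<in> space P. fst \<omega> + real (snd \<omega>) > x}) \<sim>[at_top] (\<lambda>x. b * tail G x)"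
    and "prob_space \<nu>" and sets_\<nu> [measurable_cong]: "sets \<nu> = sets (borel :: (real \<times> real) measure)"
    and simplex: "measure \<nu> simplex1 = 1" and wc: "weak_conv_at_top (cond_angle_law P) \<nu>"
    unfolding two_dim_RV_def by blast
  interpret nu: prob_space \<nu> by fact
  have SF': "QN_tail \<sim>[at_top] (\<lambda>x. b * tail G x)" using SF by (simp add: QN_tail_def[abs_def])
  note S_lim = QN_tail_ratio(1)[OF F L b SF'] and S_pos = QN_tail_ratio(2)[OF F L b SF' zero_less_one]
  \<comment> \<open>Weak convergence at level t x, multiplied by the regular variation of the
    normalising tail.\<close>
  have A_lim: "((\<lambda>x. angle_mass \<psi> (t * x) / QN_tail x) \<longlongrightarrow> t powr (- \<alpha>) * (\<integral>\<theta>. \<psi> \<theta> \<partial>\<nu>)) at_top"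
    if \<psi>: "continuous_on UNIV \<psi>" "bounded (range \<psi>)" and t: "0 < t" for \<psi> t
  proof -
    have flt: "filterlim (\<lambda>x. t * x) at_top at_top"
      using t by (intro filterlim_mult_pos_at_top) auto
    have [measurable]: "\<psi> \<in> borel_measurable borel" using \<psi>(1) by (rule borel_measurable_continuous_onI)
    have "((\<lambda>y. \<integral>\<theta>. \<psi> \<theta> \<partial>cond_angle_law P y) \<longlongrightarrow> (\<integral>\<theta>. \<psi> \<theta> \<partial>\<nu>)) at_top"
      using wc \<psi> by (simp add: weak_conv_at_top_def)
    then have "((\<lambda>y. angle_mass \<psi> y / QN_tail y) \<longlongrightarrow> (\<integral>\<theta>. \<psi> \<theta> \<partial>\<nu>)) at_top"
      by (rule Lim_transform_eventually) (use S_pos in \<open>eventually_elim, simp add: integral_cond_angle_law\<close>)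
    from tendsto_mult[OF S_lim[OF t] filterlim_compose[OF this flt]]
    show ?thesis
      by (rule Lim_transform_eventually)
         (use eventually_compose_filterlim[OF S_pos flt] in \<open>eventually_elim, simp\<close>)
  qed
  define U where "U x = prob {\<omega> \<in> space P. fst \<omega> + c * real (snd \<omega>) > x}" for x
  have U_antimono: "antimono U" unfolding U_def by (rule antimono_prob_greater) measurable
  define m M where "m = min 1 c" and "M = max 1 c"
  have mM: "0 < m" "m \<le> M" "m \<le> 1" "m \<le> c" "1 \<le> M" "c \<le> M" using c by (auto simp: m_def M_def)
  define g :: "real \<times> real \<Rightarrow> real" where "g \<theta> = fst \<theta> + c * snd \<theta>" for \<theta>
  have g_simplex: "m \<le> g \<theta> \<and> g \<theta> \<le> M" if "\<theta> \<in> simplex1" for \<theta>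
  proof -
    have \<theta>: "0 \<le> fst \<theta>" "0 \<le> snd \<theta>" "fst \<theta> = 1 - snd \<theta>" using that by (auto simp: simplex1_def)
    have "m * fst \<theta> \<le> 1 * fst \<theta>" "m * snd \<theta> \<le> c * snd \<theta>" "1 * fst \<theta> \<le> M * fst \<theta>" "c * snd \<theta> \<le> M * snd \<theta>"
      using \<theta> mM by (intro mult_right_mono; simp)+
    then have "m * fst \<theta> + m * snd \<theta> \<le> g \<theta>" "g \<theta> \<le> M * fst \<theta> + M * snd \<theta>" unfolding g_def by linarith+
    then show ?thesis using \<theta>(3) by (simp add: algebra_simps)
  qed
  text \<open>The partition of unity \<open>\<psi> i\<close> localises \<open>g\<close> up to a factor \<open>l\<^sup>2\<close>, so that \<open>Q + c N = (Q + N) g\<close>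
    is compared with the regularly varying \<open>Q + N\<close> on each piece.\<close>
  have main: "\<exists>\<kappa>>0. \<exists>lo up. (\<forall>x>0. lo x \<le> U x \<and> U x \<le> up x) \<and>
      (\<forall>t>0. ((\<lambda>x. lo (t * x) / QN_tail x) \<longlongrightarrow> (l * t) powr (- \<alpha>) * \<kappa>) at_top) \<and>
      (\<forall>t>0. ((\<lambda>x. up (t * x) / QN_tail x) \<longlongrightarrow> (t / l) powr (- \<alpha>) * \<kappa>) at_top)" if l: "1 < l" for l
  proof -
    \<comment> \<open>\<open>u\<close> is g on a logarithmic scale with base l, shifted so that u >=
      1 on the simplex; the \<open>max\<close> keeps it continuous elsewhere. \<open>k i\<close>
      ramps up on [i, i+1], so \<open>\<psi> i\<close> is a tent in \<open>u\<close> on [i, i+2]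
      with its peak where g = \<open>s i\<close>.\<close>
    define u where "u \<theta> = 1 + ln (max m (g \<theta>) / m) / ln l" for \<theta>
    define k where "k i \<theta> = min 1 (max 0 (u \<theta> - real i))" for i \<theta>
    define \<psi> where "\<psi> i \<theta> = k i \<theta> - k (Suc i) \<theta>" for i \<theta>
    \<comment> \<open>Then u <= n on the simplex, so the telescoping sum of the tents equals 1
      there.\<close>
    obtain n :: nat where n: "1 + ln (M / m) / ln l \<le> real n" using real_arch_simple by blast
    define s where "s i = m * l ^ i" for i :: nat
    have s: "0 < s i" "m \<le> s i" for i using mM l by (auto simp: s_def mult_le_cancel_left1)
    have cont_u: "continuous_on UNIV u"
      unfolding u_def g_def using mM l
      by (intro continuous_intros) (auto simp: max_def)
    have cont: "continuous_on UNIV (\<psi> i)" for i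
      unfolding \<psi>_def k_def by (intro continuous_intros cont_u)
    have \<psi>_bd: "0 \<le> \<psi> i \<theta>" "\<psi> i \<theta> \<le> 1" for i \<theta> by (auto simp: \<psi>_def k_def)
    have bdd: "bounded (range (\<psi> i))" for i
      unfolding bounded_iff using \<psi>_bd by (intro exI[of _ 1]) auto
    have [measurable]: "\<psi> i \<in> borel_measurable borel" for i using cont by (rule borel_measurable_continuous_onI)
    have sum1: "(\<Sum>i<n. \<psi> i \<theta>) = 1" if \<theta>: "\<theta> \<in> simplex1" for \<theta>
    proof -
      have g: "m \<le> g \<theta>" "g \<theta> \<le> M" using g_simplex[OF \<theta>] by auto
      then have u: "u \<theta> = 1 + ln (g \<theta> / m) / ln l" by (simp add: u_def max_def)
      have "0 \<le> ln (g \<theta> / m) / ln l" using g mM l by simp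
      moreover have "ln (g \<theta> / m) / ln l \<le> ln (M / m) / ln l"
        using g mM l by (intro divide_right_mono) (auto simp: divide_right_mono)
      ultimately have "1 \<le> u \<theta>" "u \<theta> \<le> real n" using n u by auto
      then have "k 0 \<theta> = 1" "k n \<theta> = 0" by (auto simp: k_def)
      moreover have "(\<Sum>i<n. \<psi> i \<theta>) = k 0 \<theta> - k n \<theta>" unfolding \<psi>_def by (rule sum_lessThan_telescope')
      ultimately show ?thesis by simp
    qed
    have local: "s i / l < g \<theta> \<and> g \<theta> < s i * l" if \<theta>: "\<theta> \<in> simplex1" and nz: "\<psi> i \<theta> \<noteq> 0" for i \<theta>
    proof -
      have g: "m \<le> g \<theta>" "0 < g \<theta>" using g_simplex[OF \<theta>] mM by auto
      then have u: "u \<theta> = 1 + ln (g \<theta> / m) / ln l" by (simp add: u_def max_def)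
      have "real i < u \<theta>" "u \<theta> < real i + 2" using nz by (auto simp: \<psi>_def k_def min_def max_def split: if_splits)
      then have "(real i - 1) * ln l < ln (g \<theta> / m)" "ln (g \<theta> / m) < (real i + 1) * ln l"
        using l by (auto simp: u field_simps)
      then have ln: "ln (l powr (real i - 1)) < ln (g \<theta> / m)" "ln (g \<theta> / m) < ln (l powr (real i + 1))"
        using l by (auto simp: ln_powr)
      have "0 < g \<theta> / m" "0 < l powr (real i - 1)" "0 < l powr (real i + 1)" using g mM l by auto
      then have "l powr (real i - 1) < g \<theta> / m" "g \<theta> / m < l powr (real i + 1)"
        using ln by (simp_all only: ln_less_cancel_iff)
      then have "l powr real i / l < g \<theta> / m" "g \<theta> / m < l powr real i * l"
        using l by (auto simp: powr_diff powr_add)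
      then show ?thesis
        using l mM by (simp add: s_def powr_realpow field_simps)
    qed
    \<comment> \<open>On piece i, g lies between s_i / l and s_i l. So Q + N > (l / s_i) x forces Q
      + cN > x, which in turn forces Q + N > x / (l s_i).\<close>
    define lo where "lo x = (\<Sum>i<n. angle_mass (\<psi> i) (l / s i * x))" for x
    define up where "up x = (\<Sum>i<n. angle_mass (\<psi> i) (1 / (l * s i) * x))" for x
    define \<kappa> where "\<kappa> = (\<Sum>i<n. s i powr \<alpha> * (\<integral>\<theta>. \<psi> i \<theta> \<partial>\<nu>))"
    have int_nu: "integrable \<nu> (\<psi> i)" for i
      by (rule nu.integrable_const_bound[where B = 1]) (use \<psi>_bd in auto)
    have "0 < \<kappa>"
    proof -
      \<comment> \<open>Positivity: the partition has total \<open>\<nu>\<close>-mass 1 and every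
        \<open>s i\<close> is at least \<open>m\<close>.\<close>
      have "AE \<theta> in \<nu>. \<theta> \<in> simplex1" by (rule nu.AE_prob_1[OF simplex])
      then have "(\<integral>\<theta>. (\<Sum>i<n. \<psi> i \<theta>) \<partial>\<nu>) = (\<integral>\<theta>. 1 \<partial>\<nu>)"
        by (intro integral_cong_AE) (auto elim!: eventually_mono simp: sum1)
      then have one: "(\<Sum>i<n. \<integral>\<theta>. \<psi> i \<theta> \<partial>\<nu>) = 1"
        using int_nu by (simp add: nu.prob_space)
      have "0 < m powr \<alpha> * (\<Sum>i<n. \<integral>\<theta>. \<psi> i \<theta> \<partial>\<nu>)" using one mM by simp
      also have "\<dots> \<le> \<kappa>"
        unfolding \<kappa>_def sum_distrib_left
        using s mM \<alpha> \<psi>_bd by (intro sum_mono mult_right_mono powr_mono2 Bochner_Integration.integral_nonneg) auto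
      finally show ?thesis .
    qed
    moreover have "lo x \<le> U x \<and> U x \<le> up x" if x: "0 < x" for x
    proof -
      let ?Z = "\<lambda>\<omega> :: real \<times> nat. fst \<omega> + real (snd \<omega>)"
      let ?I = "\<lambda>y i \<omega>. indicator {\<omega>. ?Z \<omega> > y} \<omega> * \<psi> i (angle \<omega>) :: real"
      let ?J = "\<lambda>\<omega>. indicator {\<omega>. fst \<omega> + c * real (snd \<omega>) > x} \<omega> :: real"
      have intI: "integrable P (?I y i)" for y i
        by (rule integrable_const_bound[where B = 1]) (use \<psi>_bd in \<open>auto simp: indicator_def abs_mult\<close>)
      have [measurable]: "{\<omega>. fst \<omega> + c * real (snd \<omega>) > x} \<in> sets P"
      proof -
        have "{\<omega> \<in> space P. fst \<omega> + c * real (snd \<omega>) > x} \<in> sets P" by measurable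
        then show ?thesis by simp
      qed
      have intJ: "integrable P ?J"
        by (rule integrable_const_bound[where B = 1]) auto
      have U: "U x = (\<integral>\<omega>. ?J \<omega> \<partial>P)" by (simp add: U_def)
      have pw: "(\<Sum>i<n. ?I (l / s i * x) i \<omega>) \<le> ?J \<omega> \<and> ?J \<omega> \<le> (\<Sum>i<n. ?I (1 / (l * s i) * x) i \<omega>)"
        if q: "0 \<le> fst \<omega>" for \<omega>
      proof (cases "?Z \<omega> = 0")
        \<comment> \<open>At the origin division by zero places the angle off the simplex, so the
          partition is of no help; for x > 0 all indicators vanish there.\<close>
        case True
        then have "fst \<omega> = 0" "snd \<omega> = 0" using q by auto
        moreover have "\<not> l / s i * x < 0" "\<not> 1 / (l * s i) * x < 0" for i using l s[of i] x by (auto simp: not_less)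
        ultimately show ?thesis using x by simp
      next
        case False
        then have Z: "0 < ?Z \<omega>" using q by (simp add: order_less_le)
        have simp: "angle \<omega> \<in> simplex1"
          using q Z by (simp add: simplex1_def angle_def flip: add_divide_distrib)
        have gZ: "fst \<omega> + c * real (snd \<omega>) = ?Z \<omega> * g (angle \<omega>)"
        proof -
          have "g (angle \<omega>) = (fst \<omega> + c * real (snd \<omega>)) / ?Z \<omega>"
            by (simp add: g_def angle_def add_divide_distrib)
          then show ?thesis using Z by simp
        qed
        have 1: "?I (l / s i * x) i \<omega> \<le> ?J \<omega> * \<psi> i (angle \<omega>)" for i
        proof (cases "\<psi> i (angle \<omega>) = 0")
          case False
          have "x < ?Z \<omega> * g (angle \<omega>)" if "l / s i * x < ?Z \<omega>"
          proof -
            have "x < ?Z \<omega> * (s i / l)" using that l s[of i] by (simp add: field_simps)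
            also have "\<dots> \<le> ?Z \<omega> * g (angle \<omega>)" using local[OF simp False] Z by (intro mult_left_mono) auto
            finally show ?thesis .
          qed
          then show ?thesis using \<psi>_bd by (auto simp: indicator_def gZ)
        qed simp
        have 2: "?J \<omega> * \<psi> i (angle \<omega>) \<le> ?I (1 / (l * s i) * x) i \<omega>" for i
        proof (cases "\<psi> i (angle \<omega>) = 0")
          case False
          have "1 / (l * s i) * x < ?Z \<omega>" if "x < ?Z \<omega> * g (angle \<omega>)"
          proof -
            note that
            also have "?Z \<omega> * g (angle \<omega>) \<le> ?Z \<omega> * (s i * l)" using local[OF simp False] Z by (intro mult_left_mono) auto
            finally show ?thesis using l s[of i] by (simp add: field_simps)
          qed
          then show ?thesis using \<psi>_bd by (auto simp: indicator_def gZ)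
        qed simp
        have J: "(\<Sum>i<n. ?J \<omega> * \<psi> i (angle \<omega>)) = ?J \<omega>" by (simp only: sum1[OF simp] mult_1_right flip: sum_distrib_left)
        have "(\<Sum>i<n. ?I (l / s i * x) i \<omega>) \<le> (\<Sum>i<n. ?J \<omega> * \<psi> i (angle \<omega>))"
          by (intro sum_mono 1)
        moreover have "(\<Sum>i<n. ?J \<omega> * \<psi> i (angle \<omega>)) \<le> (\<Sum>i<n. ?I (1 / (l * s i) * x) i \<omega>)"
          by (intro sum_mono 2)
        ultimately show ?thesis unfolding J by (rule conjI)
      qed
      have "lo x = (\<integral>\<omega>. (\<Sum>i<n. ?I (l / s i * x) i \<omega>) \<partial>P)"
        unfolding lo_def angle_mass_def by (rule Bochner_Integration.integral_sum[symmetric]) (rule intI)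
      also have "\<dots> \<le> U x"
        unfolding U using Q_nonneg
        by (intro integral_mono_AE Bochner_Integration.integrable_sum intI intJ) (auto elim!: eventually_mono dest: pw)
      finally have "lo x \<le> U x" .
      have "U x \<le> (\<integral>\<omega>. (\<Sum>i<n. ?I (1 / (l * s i) * x) i \<omega>) \<partial>P)"
        unfolding U using Q_nonneg
        by (intro integral_mono_AE Bochner_Integration.integrable_sum intI intJ) (auto elim!: eventually_mono dest: pw)
      also have "\<dots> = up x"
        unfolding up_def angle_mass_def by (rule Bochner_Integration.integral_sum) (rule intI)
      finally show ?thesis using \<open>lo x \<le> U x\<close> by simp
    qed
    moreover have "((\<lambda>x. lo (t * x) / QN_tail x) \<longlongrightarrow> (l * t) powr (- \<alpha>) * \<kappa>) at_top" if t: "0 < t" for t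
    proof -
      have "((\<lambda>x. \<Sum>i<n. angle_mass (\<psi> i) (l / s i * t * x) / QN_tail x)
          \<longlongrightarrow> (\<Sum>i<n. (l / s i * t) powr (- \<alpha>) * (\<integral>\<theta>. \<psi> i \<theta> \<partial>\<nu>))) at_top"
        by (intro tendsto_sum A_lim cont bdd) (use l s t in auto)
      moreover have "(l / s i * t) powr (- \<alpha>) = (l * t) powr (- \<alpha>) * s i powr \<alpha>" for i
        using l s[of i] t by (simp add: powr_minus powr_divide powr_mult field_simps)
      ultimately show ?thesis
        by (simp add: lo_def \<kappa>_def sum_divide_distrib sum_distrib_left mult_ac)
    qed
    moreover have "((\<lambda>x. up (t * x) / QN_tail x) \<longlongrightarrow> (t / l) powr (- \<alpha>) * \<kappa>) at_top" if t: "0 < t" for t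
    proof -
      have "((\<lambda>x. \<Sum>i<n. angle_mass (\<psi> i) (1 / (l * s i) * t * x) / QN_tail x)
          \<longlongrightarrow> (\<Sum>i<n. (1 / (l * s i) * t) powr (- \<alpha>) * (\<integral>\<theta>. \<psi> i \<theta> \<partial>\<nu>))) at_top"
        by (intro tendsto_sum A_lim cont bdd) (use l s t in auto)
      moreover have "(1 / (l * s i) * t) powr (- \<alpha>) = (t / l) powr (- \<alpha>) * s i powr \<alpha>" for i
        using l s[of i] t by (simp add: powr_minus powr_divide powr_mult field_simps)
      ultimately show ?thesis
        by (simp add: up_def \<kappa>_def sum_divide_distrib sum_distrib_left mult_ac)
    qed
    ultimately show ?thesis by blast
  qed
  have U_pos: "0 < U x" for x
  proof -
    obtain \<kappa> lo where \<kappa>: "0 < \<kappa>" and lo: "\<And>x. 0 < x \<Longrightarrow> lo x \<le> U x"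
      and lim: "((\<lambda>x. lo (1 * x) / QN_tail x) \<longlongrightarrow> (2 * 1) powr (- \<alpha>) * \<kappa>) at_top"
      using main[of 2] by (metis one_less_numeral_iff semiring_norm(76) zero_less_one)
    have "\<forall>\<^sub>F x in at_top. 0 < lo (1 * x) / QN_tail x" using \<kappa> by (intro order_tendstoD(1)[OF lim]) simp
    with S_pos eventually_ge_at_top[of "max 1 x"]
    have "\<forall>\<^sub>F y in at_top. x \<le> y \<and> 0 < U y"
    proof eventually_elim
      case (elim y)
      then show ?case using lo[of y] by (auto simp: zero_less_divide_iff)
    qed
    then obtain y where "x \<le> y" "0 < U y" by (auto dest: eventually_happens)
    then show ?thesis using antimonoD[OF U_antimono] by fastforce
  qed
  have "irv_fun U"
    unfolding irv_fun_def
  proof (intro conjI allI impI U_antimono U_pos)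
    fix e :: real assume e: "0 < e"
    \<comment> \<open>Shrinking the level by 1/l and the losses in \<open>up\<close> and
      \<open>lo\<close> cost l^\<alpha> each; the exponent 1/(4\<alpha>) makes their product
      l^(3\<alpha>) strictly smaller than 1 + e.\<close>
    define l where "l = (1 + e) powr (1 / (4 * \<alpha>))"
    have l: "1 < l" using e \<alpha> by (simp add: l_def)
    have l4: "l powr (3 * \<alpha>) < 1 + e"
    proof -
      have "l powr (3 * \<alpha>) = (1 + e) powr (3 / 4)" using \<alpha> by (simp add: l_def powr_powr)
      also have "\<dots> < (1 + e) powr 1" using e by (intro powr_less_mono) auto
      finally show ?thesis using e by simp
    qed
    obtain \<kappa> lo up where \<kappa>: "0 < \<kappa>" and bounds: "\<forall>x>0. lo x \<le> U x \<and> U x \<le> up x"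
      and lims: "\<forall>t>0. ((\<lambda>x. lo (t * x) / QN_tail x) \<longlongrightarrow> (l * t) powr (- \<alpha>) * \<kappa>) at_top"
        "\<forall>t>0. ((\<lambda>x. up (t * x) / QN_tail x) \<longlongrightarrow> (t / l) powr (- \<alpha>) * \<kappa>) at_top"
      using main[OF l] by blast
    have "((\<lambda>x. (1 + e) * (lo (1 * x) / QN_tail x) - up (1 / l * x) / QN_tail x)
        \<longlongrightarrow> (1 + e) * ((l * 1) powr (- \<alpha>) * \<kappa>) - (1 / l / l) powr (- \<alpha>) * \<kappa>) at_top"
      by (intro tendsto_diff tendsto_mult tendsto_const lims[rule_format]) (use l in auto)
    moreover have "0 < (1 + e) * ((l * 1) powr (- \<alpha>) * \<kappa>) - (1 / l / l) powr (- \<alpha>) * \<kappa>"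
    proof -
      have "(1 / l / l) powr (- \<alpha>) = l powr (3 * \<alpha>) * l powr (- \<alpha>)"
      proof -
        have "1 / l / l = l powr (- 2)" using l by (simp add: powr_minus powr_realpow[of l 2, simplified] power2_eq_square field_simps)
        then show ?thesis using l by (simp add: powr_powr flip: powr_add)
      qed
      also have "\<dots> < (1 + e) * l powr (- \<alpha>)" using l l4 by (intro mult_strict_right_mono) auto
      finally have "(1 / l / l) powr (- \<alpha>) * \<kappa> < (1 + e) * l powr (- \<alpha>) * \<kappa>" using \<kappa> by (intro mult_strict_right_mono)
      then show ?thesis by (simp add: mult_ac)
    qed
    ultimately have "\<forall>\<^sub>F x in at_top. 0 < (1 + e) * (lo (1 * x) / QN_tail x) - up (1 / l * x) / QN_tail x"
      by (rule order_tendstoD(1))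
    with S_pos eventually_gt_at_top[of 0]
    have "\<forall>\<^sub>F x in at_top. U (1 / l * x) \<le> (1 + e) * U x"
    proof eventually_elim
      case (elim x)
      have "0 < 1 / l * x" using l elim by simp
      then have "U (1 / l * x) \<le> up (1 / l * x)" using bounds by blast
      also have "\<dots> \<le> (1 + e) * lo x"
      proof -
        have "up (1 / l * x) / QN_tail x < ((1 + e) * lo x) / QN_tail x" using elim(3) by simp
        then show ?thesis using elim(1) by (subst (asm) divide_less_cancel) simp
      qed
      also have "\<dots> \<le> (1 + e) * U x" using bounds elim e by (intro mult_left_mono) auto
      finally show ?case .
    qed
    then show "\<exists>a. 0 < a \<and> a < 1 \<and> (\<forall>\<^sub>F x in at_top. U (a * x) \<le> (1 + e) * U x)"
      using l by (intro exI[of _ "1 / l"]) simp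
  qed
  then show "irv_fun (\<lambda>x. prob {\<omega> \<in> space P. fst \<omega> + c * real (snd \<omega>) > x})"
    by (simp add: U_def[abs_def])
qed

end

theorem theorem1p1:
  fixes P :: "(real \<times> nat) measure"
  assumes P_prob: "prob_space P"
    and P_sets: "sets P = sets (borel \<Otimes>\<^sub>M (count_space UNIV :: nat measure))"
    and Q_nonneg: "AE \<omega> in P. 0 \<le> fst \<omega>"
    and Q_nondeg: "nondegenerate P fst"
    and N_nondeg: "nondegenerate P (\<lambda>\<omega>. real (snd \<omega>))"
    and N_int: "integrable P (\<lambda>\<omega>. real (snd \<omega>))"
    and N_mean: "(\<integral>\<omega>. real (snd \<omega>) \<partial>P) < 1"
    and Q_int: "integrable P fst"
  shows "((\<exists>!\<mu>. fp_solution P \<mu>) \<and>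
         (\<forall>\<mu>. fp_solution P \<mu> \<longrightarrow>
            (\<integral>x. x \<partial>\<mu>) = (\<integral>\<omega>. fst \<omega> \<partial>P) / (1 - (\<integral>\<omega>. real (snd \<omega>) \<partial>P))))
        \<and>
        (\<forall>\<mu>. fp_solution P \<mu> \<longrightarrow> condC P (\<integral>x. x \<partial>\<mu>) \<longrightarrow>
           (\<lambda>x. measure \<mu> {x<..}) \<sim>[at_top]
           (\<lambda>x. 1 / (1 - (\<integral>\<omega>. real (snd \<omega>) \<partial>P)) *
                 measure P {\<omega>\<in>space P. fst \<omega> + (\<integral>x. x \<partial>\<mu>) * real (snd \<omega>) > x}))
        \<and> (two_dim_RV P \<longrightarrow> condC P ((\<integral>\<omega>. fst \<omega> \<partial>P) / (1 - (\<integral>\<omega>. real (snd \<omega>) \<partial>P))))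
        \<and> (IRV (distr P borel fst) \<and>
         (\<lambda>x. measure P {\<omega>\<in>space P. real (snd \<omega>) > x}) \<in> o[at_top](\<lambda>x. measure P {\<omega>\<in>space P. fst \<omega> > x})
         \<longrightarrow> condC P ((\<integral>\<omega>. fst \<omega> \<partial>P) / (1 - (\<integral>\<omega>. real (snd \<omega>) \<partial>P))))
        \<and> (IRV (distr P borel (\<lambda>\<omega>. real (snd \<omega>))) \<and>
         (\<lambda>x. measure P {\<omega>\<in>space P. fst \<omega> > x}) \<in> o[at_top](\<lambda>x. measure P {\<omega>\<in>space P. real (snd \<omega>) > x})
         \<longrightarrow> condC P ((\<integral>\<omega>. fst \<omega> \<partial>P) / (1 - (\<integral>\<omega>. real (snd \<omega>) \<partial>P))))"
proof -
  interpret branching P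
    using P_prob P_sets Q_nonneg N_int Q_int by (simp add: branching_def branching_axioms_def)
  interpret subcritical_branching P
    by unfold_locales (rule N_mean)
  have qbar_pos: "0 < qbar"
  proof (rule ccontr)
    assume "\<not> 0 < qbar"
    then have "qbar = 0" using qbar_nonneg by linarith
    then have "AE \<omega> in P. fst \<omega> = 0"
      using integral_nonneg_eq_0_iff_AE[OF Q_int Q_nonneg] by simp
    then show False using Q_nondeg by (auto simp: nondegenerate_def)
  qed
  have asymp: "(\<lambda>x. measure \<mu> {x<..}) \<sim>[at_top]
      (\<lambda>x. 1 / (1 - nbar) * prob {\<omega>\<in>space P. fst \<omega> + (\<integral>x. x \<partial>\<mu>) * real (snd \<omega>) > x})"
    if \<mu>: "fp_solution P \<mu>" and C: "condC P (\<integral>x. x \<partial>\<mu>)" for \<mu>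
  proof -
    have mean: "(\<integral>x. x \<partial>\<mu>) = rbar" by (rule fp_solution_mean[OF \<mu>])
    interpret mu: nonneg_law \<mu> by (rule fp_solution_nonneg_law[OF \<mu>])
    interpret branching_solution P \<mu>
      by unfold_locales (use \<mu> qbar_pos in \<open>auto simp: fp_solution_def\<close>)
    \<comment> \<open>Condition (C) is applied at the centre c = \<open>rbar\<close>, which is
      admissible because \<open>rbar\<close> is positive.\<close>
    have "IRV (distr P borel V)"
      using C rbar_pos unfolding condC_def mean V_def[abs_def] by force
    then have "irv_fun W" by (simp add: IRV_distr_iff W_def[abs_def])
    then interpret irv_branching_solution P \<mu>
      by unfold_locales
    show ?thesis using T_asymp unfolding mean W_def V_def tail_def .
  qed
  show ?thesis
    using fp_solution_exists fp_solution_unique fp_solution_mean asymp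
      condC_two_dim_RV condC_Q_dominates condC_N_dominates
    unfolding rbar_def by (intro conjI) blast+
qed

end
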